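(* Let $\Omega\subset\mathbb{R}^2$ be either (a) a hexagonal domain with the structured uniform meshes of equilateral triangles described in the context, or (b) $\Omega=(0,1)^2$ with the structured uniform meshes of right triangles described in the context. Let $a\in C^2(\overline\Omega)$ with $a(\mathbf{x})\ge a_0>0$ ($a_0$ a constant), let $\vec\beta\in C^1(\overline\Omega)$ be a vector field with $\mathrm{div}(\vec\beta)\ge 0$ pointwise in $\Omega$, and let $f\in L^2(\Omega)$. Let $\{A_n(a,\vec\beta)\}$ and $\{P_n(a)\}$, $n=n(h)$, be the sequences of convection-diffusion finite element matrices and of preconditioners defined in the context. Then: (i) the sequence $\{P_n^{-1}(a)A_n(a,\vec\beta)\}$ is properly clustered at $1$ with respect to the eigenvalues, i.e. for every $\varepsilon>0$ the number of eigenvalues of $P_n^{-1}(a)A_n(a,\vec\beta)$ not belonging to the complex disk of center $1$ and radius $\varepsilon$ is bounded by a constant possibly depending on $\varepsilon$ but not on $n$; (ii) all these eigenvalues belong to a uniformly bounded rectangle with positive real part, well separated from zero, i.e. there are constants $d,D>0$ and $\hat d\ge 0$, independent of $n$, such that for every $n$ all the eigenvalues of $P_n^{-1}(a)A_n(a,\vec\beta)$ belong to $\{z\in\mathbb{C}:\mathrm{Re}(z)\in[d,D],\ \mathrm{Im}(z)\in[-\hat d,\hat d]\}$. The claim holds both when the integrals defining the entries of the diffusion matrix $\Theta_n(a)$ and of the convection matrix $\Psi_n(\vec\beta)$ are evaluated exactly and whenever a quadrature formula with error $O(h^2)$ is used to approximate these integrals.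
   Context: Problem: the matrices come from the linear finite element approximation of $\mathrm{div}(-a\nabla u+\vec\beta u)=f$ in $\Omega$, $u=0$ on $\partial\Omega$; the function $f$ enters only the right-hand side of the linear system, not the matrices. Meshes. (a) $\Omega$ is an open regular hexagon of side length $L$; for integers $m\ge1$, $\mathcal{T}_h$ is the partition of $\overline\Omega$ into congruent equilateral triangles of side $h=L/m$ obtained by dividing each side of the hexagon into $m$ equal parts and drawing all the lines through the division points parallel to the sides. (b) $\Omega=(0,1)^2$; for integers $m\ge2$, with mesh step $1/m$, $\mathcal{T}_h$ is obtained by dividing $[0,1]^2$ into $m^2$ equal squares and splitting each into two right triangles by a diagonal, all diagonals being parallel (Friedrichs-Keller mesh). In all cases $h$ denotes the mesh fineness parameter, which tends to $0$, and $n=n(h)$ is the number of internal nodes, i.e. mesh vertices lying in $\Omega$. Finite elements: $V_h$ is the space of continuous functions on $\overline\Omega$ that are affine on each triangle of $\mathcal{T}_h$ and vanish on $\partial\Omega$. For each internal node $i$, $\varphi_i\in V_h$ equals $1$ at node $i$ and $0$ at all other nodes. Matrices: for $i,j=1,\dots,n$, $$(\Theta_n(a))_{i,j}=\int_\Omega a\,\nabla\varphi_j\cdot\nabla\varphi_i,\qquad (\Psi_n(\vec\beta))_{i,j}=-\int_\Omega(\vec\beta\cdot\nabla\varphi_i)\,\varphi_j,\qquad A_n(a,\vec\beta)=\Theta_n(a)+\Psi_n(\vec\beta).$$ With $\mathrm{diag}(X)$ the diagonal matrix having the same main diagonal as $X$, $$D_n(a)=\mathrm{diag}(\Theta_n(a))\,\mathrm{diag}(\Theta_n(1))^{-1},\qquad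 P_n(a)=D_n^{1/2}(a)\,\Theta_n(1)\,D_n^{1/2}(a).$$ When a quadrature formula is used, all these matrices are the ones computed with it.
   Formalization: With quadrature, (ii) is claimed only for all sufficiently fine meshes (as stated it fails on coarse ones: an eigenvalue can be negative), and (i) only for those n for which P_n(a) is invertible; with exact integrals both hold for every n. *)

theory Defs
  imports
    "HOL-Analysis.Analysis"
    "Jordan_Normal_Form.Char_Poly"
    "Jordan_Normal_Form.Gauss_Jordan_Elimination"
begin

type_synonym R2 = "real \<times> real"


section \<open>Differential operators and smoothness up to the boundary\<close>

definition grad :: "(R2 \<Rightarrow> real) \<Rightarrow> R2 \<Rightarrow> R2" where
  "grad f x = (\<Sum>b\<in>Basis. frechet_derivative f (at x) b *\<^sub>R b)"

definition divergence :: "(R2 \<Rightarrow> R2) \<Rightarrow> R2 \<Rightarrow> real" where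
  "divergence F x = (\<Sum>b\<in>Basis. inner (frechet_derivative F (at x) b) b)"

text \<open>Differentiability is required in the open set only; the function and its
  derivatives must extend continuously to the closure.\<close>

definition C1_closure :: "R2 set \<Rightarrow> (R2 \<Rightarrow> 'b::real_normed_vector) \<Rightarrow> bool" where
  "C1_closure \<Omega> f \<longleftrightarrow> continuous_on (closure \<Omega>) f \<and>
     (\<exists>f' :: R2 \<Rightarrow> R2 \<Rightarrow>\<^sub>L 'b.
        (\<forall>x\<in>\<Omega>. (f has_derivative blinfun_apply (f' x)) (at x)) \<and>
        continuous_on (closure \<Omega>) f')"

definition C2_closure :: "R2 set \<Rightarrow> (R2 \<Rightarrow> 'b::real_normed_vector) \<Rightarrow> bool" where
  "C2_closure \<Omega> f \<longleftrightarrow> continuous_on (closure \<Omega>) f \<and>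
     (\<exists>f' :: R2 \<Rightarrow> R2 \<Rightarrow>\<^sub>L 'b.
        (\<forall>x\<in>\<Omega>. (f has_derivative blinfun_apply (f' x)) (at x)) \<and>
        C1_closure \<Omega> f')"


section \<open>Meshes\<close>

text \<open>A triangle is represented by the set \<open>S\<close> of its three vertices; the closed triangle
  itself is \<open>convex hull S\<close>. The lines through the points \<open>c + i u + j v\<close> in the
  directions \<open>u\<close>, \<open>v\<close> and \<open>u - v\<close> cut the plane into the triangles below, and the
  mesh consists of those lying in the closed domain.\<close>

definition lattice_mesh :: "R2 set \<Rightarrow> R2 \<Rightarrow> R2 \<Rightarrow> R2 \<Rightarrow> R2 set set" where
  "lattice_mesh \<Omega> c u v =
     {S. (\<exists>(i::int) (j::int). \<exists>p. p = c + of_int i *\<^sub>R u + of_int j *\<^sub>R v \<and>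
            (S = {p, p + u, p + v} \<or> S = {p + u, p + v, p + u + v})) \<and>
         convex hull S \<subseteq> closure \<Omega>}"

definition direction :: "real \<Rightarrow> R2" where
  "direction \<theta> = (cos \<theta>, sin \<theta>)"

text \<open>The open regular hexagon with centre \<open>c\<close> and side \<open>L\<close> (which is also its
  circumradius), in arbitrary position: \<open>\<theta>\<close> is the argument of one of its vertices
  seen from the centre.\<close>

definition hexagon :: "R2 \<Rightarrow> real \<Rightarrow> real \<Rightarrow> R2 set" where
  "hexagon c \<theta> L =
     interior (convex hull ((\<lambda>k::nat. c + L *\<^sub>R direction (\<theta> + of_nat k * pi / 3)) ` {..<6}))"

definition hexagon_mesh :: "R2 \<Rightarrow> real \<Rightarrow> real \<Rightarrow> nat \<Rightarrow> R2 set set" where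
  "hexagon_mesh c \<theta> L m =
     lattice_mesh (hexagon c \<theta> L) c
       ((L / real m) *\<^sub>R direction \<theta>) ((L / real m) *\<^sub>R direction (\<theta> + pi / 3))"

definition unit_square :: "R2 set" where
  "unit_square = {0<..<1} \<times> {0<..<1}"

text \<open>\<open>\<sigma> = 1\<close> and \<open>\<sigma> = -1\<close> are the two possible directions of the diagonals.\<close>

definition friedrichs_keller_mesh :: "real \<Rightarrow> nat \<Rightarrow> R2 set set" where
  "friedrichs_keller_mesh \<sigma> m =
     lattice_mesh unit_square (0, 0) (\<sigma> / real m, 0) (0, 1 / real m)"

text \<open>The meshes are \<open>\<T> m\<close> for \<open>m \<ge> m0\<close>, and \<open>h m\<close> is the mesh fineness parameter.\<close>

definition structured_meshes ::
    "R2 set \<Rightarrow> (nat \<Rightarrow> R2 set set) \<Rightarrow> (nat \<Rightarrow> real) \<Rightarrow> nat \<Rightarrow> bool" where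
  "structured_meshes \<Omega> \<T> h m0 \<longleftrightarrow>
     (\<exists>c \<theta> L. L > 0 \<and> \<Omega> = hexagon c \<theta> L \<and> \<T> = hexagon_mesh c \<theta> L \<and>
        h = (\<lambda>m. L / real m) \<and> m0 = 1) \<or>
     (\<exists>\<sigma>\<in>{1, -1}. \<Omega> = unit_square \<and> \<T> = friedrichs_keller_mesh \<sigma> \<and>
        h = (\<lambda>m. 1 / real m) \<and> m0 = 2)"

definition internal_nodes :: "R2 set \<Rightarrow> R2 set set \<Rightarrow> R2 set" where
  "internal_nodes \<Omega> \<T> = \<Union>\<T> \<inter> \<Omega>"

abbreviation num_nodes :: "R2 set \<Rightarrow> R2 set set \<Rightarrow> nat" where
  "num_nodes \<Omega> \<T> \<equiv> card (internal_nodes \<Omega> \<T>)"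


section \<open>Finite elements\<close>

definition FE_space :: "R2 set \<Rightarrow> R2 set set \<Rightarrow> (R2 \<Rightarrow> real) set" where
  "FE_space \<Omega> \<T> =
     {v. continuous_on (closure \<Omega>) v \<and>
         (\<forall>S\<in>\<T>. \<exists>g c. \<forall>x\<in>convex hull S. v x = inner g x + c) \<and>
         (\<forall>x\<in>frontier \<Omega>. v x = 0)}"

text \<open>The choice matters only outside the closure of \<open>\<Omega>\<close>: on the closure these
  conditions determine the basis function.\<close>

definition hat :: "R2 set \<Rightarrow> R2 set set \<Rightarrow> R2 \<Rightarrow> R2 \<Rightarrow> real" where
  "hat \<Omega> \<T> p = (SOME v. v \<in> FE_space \<Omega> \<T> \<and>
     (\<forall>q\<in>internal_nodes \<Omega> \<T>. v q = (if q = p then 1 else 0)))"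


section \<open>Matrices with exact integrals\<close>

text \<open>Here and below \<open>x\<close> is a numbering of the internal nodes by \<open>0, \<dots>, n - 1\<close>. The
  gradient of a basis function is undefined only on the edges, a null set.\<close>

definition stiffness :: "R2 set \<Rightarrow> R2 set set \<Rightarrow> (nat \<Rightarrow> R2) \<Rightarrow> (R2 \<Rightarrow> real) \<Rightarrow> real mat" where
  "stiffness \<Omega> \<T> x a = Matrix.mat (num_nodes \<Omega> \<T>) (num_nodes \<Omega> \<T>) (\<lambda>(i, j).
     integral \<Omega> (\<lambda>y. a y * inner (grad (hat \<Omega> \<T> (x j)) y) (grad (hat \<Omega> \<T> (x i)) y)))"

definition convection :: "R2 set \<Rightarrow> R2 set set \<Rightarrow> (nat \<Rightarrow> R2) \<Rightarrow> (R2 \<Rightarrow> R2) \<Rightarrow> real mat" where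
  "convection \<Omega> \<T> x \<beta> = Matrix.mat (num_nodes \<Omega> \<T>) (num_nodes \<Omega> \<T>) (\<lambda>(i, j).
     - integral \<Omega> (\<lambda>y. inner (\<beta> y) (grad (hat \<Omega> \<T> (x i)) y) * hat \<Omega> \<T> (x j) y))"


section \<open>Matrices computed with a quadrature formula\<close>

text \<open>A quadrature formula is a list of pairs (weight, node), the nodes lying in the closed
  reference triangle with vertices \<open>(0,0)\<close>, \<open>(1,0)\<close>, \<open>(0,1)\<close>. It is transported to each
  mesh triangle \<open>S\<close> by the affine map sending the reference vertices to \<open>\<nu> S 0\<close>, \<open>\<nu> S 1\<close>,
  \<open>\<nu> S 2\<close>, where \<open>\<nu> S\<close> is a local numbering of the vertices of \<open>S\<close>; weights are
  normalised by the area, so a formula exact on constants has total weight 1.\<close>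

type_synonym quadrature = "(real \<times> R2) list"

definition quadrature_formula :: "quadrature \<Rightarrow> bool" where
  "quadrature_formula q \<longleftrightarrow>
     (\<forall>(w, \<xi>)\<in>set q. 0 \<le> fst \<xi> \<and> 0 \<le> snd \<xi> \<and> fst \<xi> + snd \<xi> \<le> 1)"

definition local_numbering :: "R2 set set \<Rightarrow> (R2 set \<Rightarrow> nat \<Rightarrow> R2) \<Rightarrow> bool" where
  "local_numbering \<T> \<nu> \<longleftrightarrow> (\<forall>S\<in>\<T>. bij_betw (\<nu> S) {..<3} S)"

definition ref_map :: "(nat \<Rightarrow> R2) \<Rightarrow> R2 \<Rightarrow> R2" where
  "ref_map s \<xi> = s 0 + fst \<xi> *\<^sub>R (s 1 - s 0) + snd \<xi> *\<^sub>R (s 2 - s 0)"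

definition quad_triangle ::
    "quadrature \<Rightarrow> (R2 set \<Rightarrow> nat \<Rightarrow> R2) \<Rightarrow> R2 set \<Rightarrow> (R2 \<Rightarrow> real) \<Rightarrow> real" where
  "quad_triangle q \<nu> S g =
     measure lebesgue (convex hull S) * (\<Sum>(w, \<xi>)\<leftarrow>q. w * g (ref_map (\<nu> S) \<xi>))"

text \<open>The constant value on the triangle of the gradient of a piecewise affine function. Since
  quadrature nodes may lie on edges, where the global gradient does not exist, it is read
  off at the centroid.\<close>

definition tri_grad :: "R2 set \<Rightarrow> (R2 \<Rightarrow> real) \<Rightarrow> R2" where
  "tri_grad S v = grad v ((1 / 3) *\<^sub>R \<Sum>S)"

definition stiffness_quad ::
    "quadrature \<Rightarrow> (R2 set \<Rightarrow> nat \<Rightarrow> R2) \<Rightarrow> R2 set \<Rightarrow> R2 set set \<Rightarrow> (nat \<Rightarrow> R2) \<Rightarrow>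
     (R2 \<Rightarrow> real) \<Rightarrow> real mat" where
  "stiffness_quad q \<nu> \<Omega> \<T> x a = Matrix.mat (num_nodes \<Omega> \<T>) (num_nodes \<Omega> \<T>) (\<lambda>(i, j).
     \<Sum>S\<in>\<T>. quad_triangle q \<nu> S
       (\<lambda>y. a y * inner (tri_grad S (hat \<Omega> \<T> (x j))) (tri_grad S (hat \<Omega> \<T> (x i)))))"

definition convection_quad ::
    "quadrature \<Rightarrow> (R2 set \<Rightarrow> nat \<Rightarrow> R2) \<Rightarrow> R2 set \<Rightarrow> R2 set set \<Rightarrow> (nat \<Rightarrow> R2) \<Rightarrow>
     (R2 \<Rightarrow> R2) \<Rightarrow> real mat" where
  "convection_quad q \<nu> \<Omega> \<T> x \<beta> = Matrix.mat (num_nodes \<Omega> \<T>) (num_nodes \<Omega> \<T>) (\<lambda>(i, j).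
     - (\<Sum>S\<in>\<T>. quad_triangle q \<nu> S
         (\<lambda>y. inner (\<beta> y) (tri_grad S (hat \<Omega> \<T> (x i))) * hat \<Omega> \<T> (x j) y)))"

text \<open>Entrywise error \<open>O(h\<^sup>2)\<close> between two sequences of square matrices, uniformly in the
  entries.\<close>

definition entries_error_h2 ::
    "(nat \<Rightarrow> real) \<Rightarrow> nat \<Rightarrow> (nat \<Rightarrow> real mat) \<Rightarrow> (nat \<Rightarrow> real mat) \<Rightarrow> bool" where
  "entries_error_h2 h m0 X Y \<longleftrightarrow>
     (\<exists>C. \<forall>m\<ge>m0. \<forall>i<dim_row (Y m). \<forall>j<dim_col (Y m).
        \<bar>X m $$ (i, j) - Y m $$ (i, j)\<bar> \<le> C * (h m)\<^sup>2)"


section \<open>The preconditioner\<close>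

text \<open>Meaningful for invertible \<open>X\<close> only.\<close>

definition minv :: "real mat \<Rightarrow> real mat" where
  "minv X = the (mat_inverse X)"

definition diag_part :: "real mat \<Rightarrow> real mat" where
  "diag_part X = mat_diag (dim_row X) (\<lambda>i. X $$ (i, i))"

definition diag_sqrt :: "real mat \<Rightarrow> real mat" where
  "diag_sqrt X = mat_diag (dim_row X) (\<lambda>i. sqrt (X $$ (i, i)))"

text \<open>The arguments are the diffusion matrices \<open>\<Theta>(a)\<close> and \<open>\<Theta>(1)\<close>.\<close>

definition precond :: "real mat \<Rightarrow> real mat \<Rightarrow> real mat" where
  "precond \<Theta>a \<Theta>1 =
     (let R = diag_sqrt (diag_part \<Theta>a * minv (diag_part \<Theta>1)) in R * \<Theta>1 * R)"


section \<open>Eigenvalues\<close>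

definition cmat :: "real mat \<Rightarrow> complex mat" where
  "cmat X = map_mat complex_of_real X"

text \<open>Eigenvalues are counted with algebraic multiplicity.\<close>

definition num_eigenvalues_outside :: "complex mat \<Rightarrow> complex set \<Rightarrow> nat" where
  "num_eigenvalues_outside X B =
     (\<Sum>z\<in>{z. eigenvalue X z} - B. order z (char_poly X))"

definition properly_clustered :: "nat set \<Rightarrow> (nat \<Rightarrow> complex mat) \<Rightarrow> complex \<Rightarrow> bool" where
  "properly_clustered M X s \<longleftrightarrow>
     (\<forall>\<epsilon>>0. \<exists>C. \<forall>m\<in>M. num_eigenvalues_outside (X m) (ball s \<epsilon>) \<le> C)"

definition in_positive_rectangle :: "nat set \<Rightarrow> (nat \<Rightarrow> complex mat) \<Rightarrow> bool" where
  "in_positive_rectangle M X \<longleftrightarrow>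
     (\<exists>d D d'. d > 0 \<and> D > 0 \<and> d' \<ge> 0 \<and>
        (\<forall>m\<in>M. \<forall>z. eigenvalue (X m) z \<longrightarrow> Re z \<in> {d..D} \<and> Im z \<in> {-d'..d'}))"

end

theory Submission
  imports Defs "Jordan_Normal_Form.Schur_Decomposition"
begin

text \<open>
  Let \<open>P = P\<^sub>n(a)\<close> and \<open>A = A\<^sub>n(a, \<beta>)\<close>. The eigenvalues of \<open>P\<^sup>-\<^sup>1 A\<close> are the numbers \<open>A(q\<^sub>j, q\<^sub>j)\<close> for a suitable
  \<open>P\<close>-orthonormal basis \<open>q\<^sub>j\<close>, obtained from the Schur form by Gram--Schmidt. Hence (ii) follows from bounds of the forms
  by the energy \<open>|z|\<^sub>1\<^sup>2\<close> of the nodal values, and by Bessel's inequality (i) holds as soon as, for each \<open>\<epsilon> > 0\<close>,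
  \<open>|A(z, z) - P(z, z)| \<le> \<epsilon>/2 P(z, z) + \<Sum>\<^sub>l |l(z)|\<^sup>2\<close> with boundedly many uniformly bounded functionals \<open>l\<close>.

  Both matrices are assembled from triangles, on which \<open>a\<close> and the entries of \<open>D\<^sub>n(a)\<close> vary by \<open>O(h)\<close>. With Young's
  inequality the difference of the forms is therefore at most \<open>\<delta> |z|\<^sub>1\<^sup>2 + C\<^sub>\<delta> h\<^sup>2 |z|\<^sup>2\<close>, and the last term is handled by the
  Poincare inequality on a fixed number of coarse cells, whose means are the functionals \<open>l\<close>. The real part of the
  convection form is nonnegative because \<open>\<integral> div(\<beta> w\<^sup>2) = 0\<close> for \<open>w\<close> vanishing on the boundary and \<open>div \<beta> \<ge> 0\<close>; quadrature
  changes it by at most \<open>O(h) |z|\<^sub>1\<^sup>2\<close>.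
\<close>

section \<open>Eigenvalues of preconditioned matrices\<close>

text \<open>P^-1 A is not normal, so counting independent eigenvectors could miss algebraic
  multiplicities; the diagonal of a triangular form carries them exactly, and orthonormality in the
  inner product of P avoids square roots of P. The obstacle in the estimates is that the products of
  values and differences, coming from the variation of D and from convection, are not small relative
  to the energy: Poincare bounds h^2 |z|^2 only by a constant times the energy. Only boundedly many
  coarse modes are responsible, so the remainder has bounded rank rather than small norm. To treat
  both domains alike, vectors become functions on pairs of integers, extended by zero to a square
  box, where one Poincare inequality suffices; exact integration and quadrature then differ only in
  the numbers attached to each triangle. In two dimensions the area, of order h^2, cancels the
  squared gradients, of order h^-2, so the constants do not see the mesh width. Meshes below a fixed
  threshold are finitely many and only enlarge the bound on the number of outliers.\<close>

definition sesq :: "nat \<Rightarrow> real mat \<Rightarrow> (nat \<Rightarrow> complex) \<Rightarrow> (nat \<Rightarrow> complex) \<Rightarrow> complex" where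
  "sesq n M X Y = (\<Sum>i<n. \<Sum>j<n. cnj (X i) * complex_of_real (M $$ (i, j)) * Y j)"

lemma sesq_sum_right: "sesq n M X (\<lambda>i. \<Sum>k\<in>K. u k * Y k i) = (\<Sum>k\<in>K. u k * sesq n M X (Y k))"
proof -
  have "sesq n M X (\<lambda>i. \<Sum>k\<in>K. u k * Y k i) =
      (\<Sum>i<n. \<Sum>j<n. \<Sum>k\<in>K. u k * (cnj (X i) * complex_of_real (M $$ (i, j)) * Y k j))"
    by (simp add: sesq_def sum_distrib_left mult_ac)
  also have "\<dots> = (\<Sum>i<n. \<Sum>k\<in>K. \<Sum>j<n. u k * (cnj (X i) * complex_of_real (M $$ (i, j)) * Y k j))"
    by (intro sum.cong refl sum.swap)
  also have "\<dots> = (\<Sum>k\<in>K. \<Sum>i<n. \<Sum>j<n. u k * (cnj (X i) * complex_of_real (M $$ (i, j)) * Y k j))"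
    by (rule sum.swap)
  finally show ?thesis by (simp add: sesq_def sum_distrib_left)
qed

lemma sesq_sum_left: "sesq n M (\<lambda>i. \<Sum>k\<in>K. u k * X k i) Y = (\<Sum>k\<in>K. cnj (u k) * sesq n M (X k) Y)"
proof -
  have "sesq n M (\<lambda>i. \<Sum>k\<in>K. u k * X k i) Y =
      (\<Sum>i<n. \<Sum>j<n. \<Sum>k\<in>K. cnj (u k) * (cnj (X k i) * complex_of_real (M $$ (i, j)) * Y j))"
    by (simp add: sesq_def sum_distrib_left sum_distrib_right mult_ac)
  also have "\<dots> = (\<Sum>i<n. \<Sum>k\<in>K. \<Sum>j<n. cnj (u k) * (cnj (X k i) * complex_of_real (M $$ (i, j)) * Y j))"
    by (intro sum.cong refl sum.swap)
  also have "\<dots> = (\<Sum>k\<in>K. \<Sum>i<n. \<Sum>j<n. cnj (u k) * (cnj (X k i) * complex_of_real (M $$ (i, j)) * Y j))"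
    by (rule sum.swap)
  finally show ?thesis by (simp add: sesq_def sum_distrib_left)
qed

lemma sesq_diff_right: "sesq n M X (\<lambda>i. Y i - Z i) = sesq n M X Y - sesq n M X Z"
  by (simp add: sesq_def algebra_simps sum_subtractf)

lemma sesq_scale_right: "sesq n M X (\<lambda>i. u * Y i) = u * sesq n M X Y"
  by (simp add: sesq_def sum_distrib_left mult_ac)

lemma sesq_scale_left: "sesq n M (\<lambda>i. u * X i) Y = cnj u * sesq n M X Y"
  by (simp add: sesq_def sum_distrib_left mult_ac)

lemma sesq_cong:
  assumes "\<And>i. i < n \<Longrightarrow> X i = X' i" "\<And>i. i < n \<Longrightarrow> Y i = Y' i"
  shows "sesq n M X Y = sesq n M X' Y'"
  unfolding sesq_def by (intro sum.cong refl) (use assms in auto)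

lemma sesq_add_mat:
  assumes "A \<in> carrier_mat n n" "B \<in> carrier_mat n n"
  shows "sesq n (A + B) X Y = sesq n A X Y + sesq n B X Y"
  unfolding sesq_def sum.distrib[symmetric]
  by (intro sum.cong refl) (use assms in \<open>auto simp: algebra_simps\<close>)

lemma sesq_hermitian:
  assumes "\<And>i j. i < n \<Longrightarrow> j < n \<Longrightarrow> M $$ (i, j) = M $$ (j, i)"
  shows "sesq n M Y X = cnj (sesq n M X Y)"
  unfolding sesq_def cnj_sum
  by (subst sum.swap, intro sum.cong refl) (use assms in \<open>auto simp: mult_ac\<close>)

lemma sesq_mult_vec:
  assumes M: "M \<in> carrier_mat n n" and w: "w \<in> carrier_vec n"
  shows "(\<Sum>i<n. cnj (X i) * vec_index (cmat M *\<^sub>v w) i) = sesq n M X (vec_index w)"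
  unfolding sesq_def
proof (intro sum.cong refl)
  fix i assume i: "i \<in> {..<n}"
  have "vec_index (cmat M *\<^sub>v w) i = (\<Sum>j<n. complex_of_real (M $$ (i,j)) * vec_index w j)"
    using i M w by (auto simp: cmat_def scalar_prod_def lessThan_atLeast0 intro!: sum.cong)
  then show "cnj (X i) * vec_index (cmat M *\<^sub>v w) i =
     (\<Sum>j<n. cnj (X i) * complex_of_real (M $$ (i, j)) * vec_index w j)"
    by (simp add: sum_distrib_left mult_ac)
qed

text \<open>Complex test vectors are used because a real matrix may have complex eigenvectors;
  symmetry makes the form real, so \<open>Re\<close> discards nothing.\<close>

definition posdef :: "nat \<Rightarrow> real mat \<Rightarrow> bool" where
  "posdef n P \<longleftrightarrow> P \<in> carrier_mat n n \<and> (\<forall>i<n. \<forall>j<n. P $$ (i, j) = P $$ (j, i)) \<and>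
     (\<forall>X. (\<exists>i<n. X i \<noteq> 0) \<longrightarrow> 0 < Re (sesq n P X X))"

lemma minv_inverse:
  assumes P: "P \<in> carrier_mat n n" and det: "det P \<noteq> 0"
  shows "invertible_mat P" "minv P \<in> carrier_mat n n" "P * minv P = 1\<^sub>m n" "minv P * P = 1\<^sub>m n"
proof -
  have "P \<in> Units (ring_mat TYPE(real) n ())"
    by (rule det_non_zero_imp_unit[OF P det])
  with mat_inverse(1)[OF P, where b="()"] obtain B where B: "mat_inverse P = Some B" by (cases "mat_inverse P") auto
  then have *: "minv P = B" by (simp add: minv_def)
  from mat_inverse(2)[OF P B] show "minv P \<in> carrier_mat n n" "P * minv P = 1\<^sub>m n" "minv P * P = 1\<^sub>m n"
    unfolding * by auto
  then show "invertible_mat P" using P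
    unfolding invertible_mat_def inverts_mat_def square_mat.simps by (intro conjI exI[of _ "minv P"]) auto
qed

lemma nonzero_vec_index:
  assumes "v \<in> carrier_vec n" "v \<noteq> 0\<^sub>v n"
  shows "\<exists>i<n. vec_index v i \<noteq> 0"
proof (rule ccontr)
  assume "\<not> ?thesis"
  then have "v = 0\<^sub>v n" using assms(1) by (intro eq_vecI) auto
  then show False using assms(2) by simp
qed

text \<open>A real kernel vector, read as a complex one, would have form zero; so the determinant is
  nonzero and \<open>minv\<close> is a genuine inverse.\<close>

lemma posdef_inverse:
  assumes "posdef n P"
  shows "invertible_mat P" "minv P \<in> carrier_mat n n" "P * minv P = 1\<^sub>m n" "minv P * P = 1\<^sub>m n"
proof -
  have P: "P \<in> carrier_mat n n" using assms by (simp add: posdef_def)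
  have "det P \<noteq> 0"
  proof
    assume "det P = 0"
    then obtain v where v: "v \<in> carrier_vec n" "v \<noteq> 0\<^sub>v n" "P *\<^sub>v v = 0\<^sub>v n"
      using det_0_iff_vec_prod_zero_field[OF P] by auto
    have nz: "\<exists>i<n. vec_index v i \<noteq> 0" using v(1,2) by (rule nonzero_vec_index)
    let ?w = "map_vec complex_of_real v"
    have "cmat P *\<^sub>v ?w = map_vec complex_of_real (P *\<^sub>v v)"
      unfolding cmat_def by (rule of_real_hom.mult_mat_vec_hom[OF P v(1), symmetric])
    also have "\<dots> = 0\<^sub>v n" using v(3) by auto
    finally have "sesq n P (vec_index ?w) (vec_index ?w) = 0"
      using sesq_mult_vec[OF P, of ?w "vec_index ?w"] v(1) by simp
    moreover have "\<exists>i<n. vec_index ?w i \<noteq> 0" using nz v(1) by auto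
    ultimately show False using assms unfolding posdef_def by fastforce
  qed
  from minv_inverse[OF P this]
  show "invertible_mat P" "minv P \<in> carrier_mat n n" "P * minv P = 1\<^sub>m n" "minv P * P = 1\<^sub>m n" by auto
qed

lemma cmat_mult:
  assumes "A \<in> carrier_mat n n" "B \<in> carrier_mat n n"
  shows "cmat (A * B) = cmat A * cmat B"
  unfolding cmat_def by (rule of_real_hom.mat_hom_mult[OF assms])

lemma cmat_carrier[simp]: "A \<in> carrier_mat n n \<Longrightarrow> cmat A \<in> carrier_mat n n"
  by (simp add: cmat_def)

text \<open>Multiplication by P removes the inverse: C v = z v becomes A v = z P v, so that later
  arguments see only the two forms.\<close>

lemma precond_product:
  assumes P: "posdef n P" and A: "A \<in> carrier_mat n n"
  shows "cmat P * cmat (minv P * A) = cmat A"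
proof -
  have Pc: "P \<in> carrier_mat n n" using P by (simp add: posdef_def)
  have "cmat P * cmat (minv P * A) = cmat (P * (minv P * A))"
    by (rule cmat_mult[symmetric, OF Pc]) (use posdef_inverse[OF P] A in auto)
  also have "P * (minv P * A) = A"
    using assoc_mult_mat[OF Pc posdef_inverse(2)[OF P] A] posdef_inverse[OF P] A by auto
  finally show ?thesis .
qed

text \<open>Testing A v = z P v with v makes z a generalised Rayleigh quotient. This serves the
  rectangle; the count of eigenvalues needs the Schur form below.\<close>

lemma eigenvalue_precond:
  assumes P: "posdef n P" and A: "A \<in> carrier_mat n n"
    and ev: "eigenvalue (cmat (minv P * A)) z"
  shows "\<exists>X. (\<exists>i<n. X i \<noteq> 0) \<and> sesq n A X X = z * sesq n P X X"
proof -
  let ?C = "cmat (minv P * A)"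
  have Pc: "P \<in> carrier_mat n n" using P by (simp add: posdef_def)
  have C: "?C \<in> carrier_mat n n" using posdef_inverse[OF P] A by auto
  obtain v where v: "v \<in> carrier_vec n" "v \<noteq> 0\<^sub>v n" "?C *\<^sub>v v = z \<cdot>\<^sub>v v"
    using ev C unfolding eigenvalue_def eigenvector_def by auto
  have nz: "\<exists>i<n. vec_index v i \<noteq> 0" using v(1,2) by (rule nonzero_vec_index)
  have "cmat A *\<^sub>v v = cmat P *\<^sub>v (?C *\<^sub>v v)"
    using assoc_mult_mat_vec[OF cmat_carrier[OF Pc] C v(1)] precond_product[OF P A] by simp
  also have "\<dots> = cmat P *\<^sub>v (z \<cdot>\<^sub>v v)" by (simp add: v(3))
  finally have "sesq n A (vec_index v) (vec_index v) = sesq n P (vec_index v) (vec_index (z \<cdot>\<^sub>v v))"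
    using sesq_mult_vec[OF A v(1), of "vec_index v"] sesq_mult_vec[OF Pc, of "z \<cdot>\<^sub>v v" "vec_index v"] v(1)
    by (simp add: smult_carrier_vec)
  also have "\<dots> = sesq n P (vec_index v) (\<lambda>i. z * vec_index v i)"
    by (rule sesq_cong) (use v(1) in auto)
  also have "\<dots> = z * sesq n P (vec_index v) (vec_index v)" by (rule sesq_scale_right)
  finally show ?thesis using nz by blast
qed

text \<open>Besides the coefficients \<open>U\<close> of \<open>s\<close> in \<open>q\<close>, the
  induction carries the coefficients \<open>T\<close> of \<open>q\<close> in \<open>s\<close>: they
  show that the next residual is a combination of the \<open>s k\<close> with leading coefficient 1,
  hence nonzero by the independence hypothesis \<open>ind\<close>.\<close>

lemma gram_schmidt_posdef:
  assumes P: "posdef n P" and jn: "j \<le> (N::nat)"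
    and ind: "\<And>u i. i < N \<Longrightarrow> u i \<noteq> 0 \<Longrightarrow> \<exists>r<n. (\<Sum>k\<le>i. u k * s k r) \<noteq> 0"
  shows "\<exists>q U. (\<forall>a<j. \<forall>b<j. sesq n P (q a) (q b) = (if a = b then 1 else 0)) \<and>
     (\<forall>l<j. U l l \<noteq> 0 \<and> (\<forall>r. s l r = (\<Sum>i\<le>l. U i l * q i r))) \<and>
     (\<forall>l<j. \<exists>T. \<forall>r. q l r = (\<Sum>k\<le>l. T k * s k r))"
  using jn
proof (induction j)
  case 0
  then show ?case by auto
next
  case (Suc j)
  from Suc.IH[OF Suc_leD[OF Suc.prems]] obtain q U where
    IH: "(\<forall>a<j. \<forall>b<j. sesq n P (q a) (q b) = (if a = b then 1 else 0)) \<and>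
     (\<forall>l<j. U l l \<noteq> 0 \<and> (\<forall>r. s l r = (\<Sum>i\<le>l. U i l * q i r))) \<and>
     (\<forall>l<j. \<exists>T. \<forall>r. q l r = (\<Sum>k\<le>l. T k * s k r))" by (elim exE)
  have orth: "sesq n P (q a) (q b) = (if a = b then 1 else 0)" if "a < j" "b < j" for a b
    using IH that by blast
  have U: "U l l \<noteq> 0" "s l r = (\<Sum>i\<le>l. U i l * q i r)" if "l < j" for l r
    using IH that by blast+
  have T: "\<forall>l<j. \<exists>T. \<forall>r. q l r = (\<Sum>k\<le>l. T k * s k r)"
    using IH by blast
  from T obtain T where T: "\<And>l r. l < j \<Longrightarrow> q l r = (\<Sum>k\<le>l. T l k * s k r)" by metis
  have herm: "sesq n P Y X = cnj (sesq n P X Y)" for X Y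
    using P by (intro sesq_hermitian) (auto simp: posdef_def)
  define al where "al i = sesq n P (q i) (s j)" for i
  define w where "w r = s j r - (\<Sum>i<j. al i * q i r)" for r
  \<comment> \<open>\<open>V\<close> lists the coefficients of the residual \<open>w\<close> in the
    vectors \<open>s k\<close>; the one at \<open>j\<close> is 1.\<close>
  define V where "V k = (if k = j then 1 else - (\<Sum>i\<in>{i. i < j \<and> k \<le> i}. al i * T i k))" for k
  have w_s: "w r = (\<Sum>k\<le>j. V k * s k r)" for r
  proof -
    have "(\<Sum>i<j. al i * q i r) = (\<Sum>i<j. \<Sum>k<j. if k \<le> i then al i * T i k * s k r else 0)"
    proof (rule sum.cong[OF refl])
      fix i assume "i \<in> {..<j}"
      then have "{..<j} \<inter> {k. k \<le> i} = {..i}" by auto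
      then show "al i * q i r = (\<Sum>k<j. if k \<le> i then al i * T i k * s k r else 0)"
        using \<open>i \<in> {..<j}\<close> by (simp add: T sum_distrib_left mult_ac sum.If_cases)
    qed
    also have "\<dots> = (\<Sum>k<j. \<Sum>i<j. if k \<le> i then al i * T i k * s k r else 0)" by (rule sum.swap)
    also have "\<dots> = (\<Sum>k<j. (\<Sum>i\<in>{i. i < j \<and> k \<le> i}. al i * T i k) * s k r)"
    proof (rule sum.cong[OF refl])
      fix k
      have "{..<j} \<inter> {i. k \<le> i} = {i. i < j \<and> k \<le> i}" by auto
      then show "(\<Sum>i<j. if k \<le> i then al i * T i k * s k r else 0) = (\<Sum>i\<in>{i. i < j \<and> k \<le> i}. al i * T i k) * s k r"
        by (simp add: sum_distrib_right sum.If_cases)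
    qed
    also have "\<dots> = (\<Sum>k<j. - V k * s k r)" by (rule sum.cong) (auto simp: V_def)
    finally have "w r = s j r + (\<Sum>k<j. V k * s k r)" by (simp add: w_def sum_negf)
    then show ?thesis by (simp add: V_def lessThan_Suc_atMost[symmetric])
  qed
  have "\<exists>r<n. w r \<noteq> 0" unfolding w_s using Suc.prems by (intro ind) (auto simp: V_def)
  then have pos: "0 < Re (sesq n P w w)" using P by (simp add: posdef_def)
  have real: "sesq n P w w = complex_of_real (Re (sesq n P w w))"
    using herm[of w w] by (simp add: complex_eq_iff)
  define c where "c = sqrt (Re (sesq n P w w))"
  have c: "c > 0" "complex_of_real c * complex_of_real c = sesq n P w w"
    using pos real by (auto simp: c_def simp flip: of_real_mult)
  define q' where "q' = q(j := (\<lambda>r. inverse (complex_of_real c) * w r))"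
  define U' where "U' i l = (if l = j then (if i = j then complex_of_real c else al i) else U i l)" for i l
  have orthw: "sesq n P (q a) w = 0" if "a < j" for a
  proof -
    have "sesq n P (q a) w = al a - (\<Sum>i<j. al i * sesq n P (q a) (q i))"
      unfolding w_def al_def by (simp only: sesq_diff_right sesq_sum_right)
    also have "(\<Sum>i<j. al i * sesq n P (q a) (q i)) = (\<Sum>i<j. if a = i then al i else 0)"
      by (rule sum.cong) (use that orth in auto)
    finally show ?thesis using that by simp
  qed
  have orthw': "sesq n P w (q a) = 0" if "a < j" for a using orthw[OF that] herm[of w "q a"] by simp
  have o': "sesq n P (q' a) (q' b) = (if a = b then 1 else 0)" if ab: "a < Suc j" "b < Suc j" for a b
  proof -
    have s: "sesq n P (\<lambda>r. inverse (complex_of_real c) * w r) Y = inverse (complex_of_real c) * sesq n P w Y"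
      "sesq n P Y (\<lambda>r. inverse (complex_of_real c) * w r) = inverse (complex_of_real c) * sesq n P Y w" for Y
      by (simp_all add: sesq_scale_left sesq_scale_right)
    consider "a = j" "b = j" | "a = j" "b < j" | "a < j" "b = j" | "a < j" "b < j"
      using ab unfolding less_Suc_eq by blast
    then show ?thesis
    proof cases
      case 1
      then show ?thesis using c(1) by (simp add: q'_def s c(2)[symmetric] mult.assoc[symmetric])
    qed (simp_all add: q'_def s orth orthw orthw')
  qed
  have u': "U' l l \<noteq> 0 \<and> (\<forall>r. s l r = (\<Sum>i\<le>l. U' i l * q' i r))" if "l < Suc j" for l
  proof (cases "l = j")
    case True
    have "s j r = (\<Sum>i\<le>j. U' i j * q' i r)" for r
    proof -
      have "(\<Sum>i\<le>j. U' i j * q' i r) = (\<Sum>i<j. U' i j * q' i r) + U' j j * q' j r"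
        by (simp add: lessThan_Suc_atMost[symmetric])
      also have "(\<Sum>i<j. U' i j * q' i r) = (\<Sum>i<j. al i * q i r)"
        by (rule sum.cong) (auto simp: U'_def q'_def)
      finally have "(\<Sum>i\<le>j. U' i j * q' i r) = (\<Sum>i<j. al i * q i r) + complex_of_real c * (inverse (complex_of_real c) * w r)"
        by (simp add: U'_def q'_def)
      also have "complex_of_real c * (inverse (complex_of_real c) * w r) = w r"
        using c(1) by (simp only: mult.assoc[symmetric]) simp
      finally show ?thesis by (simp add: w_def)
    qed
    then show ?thesis using True c by (auto simp: U'_def)
  next
    case False
    then have "(\<Sum>i\<le>l. U' i l * q' i r) = (\<Sum>i\<le>l. U i l * q i r)" for r
      using that by (intro sum.cong) (auto simp: U'_def q'_def)
    then show ?thesis using False that U[of l] by (auto simp: U'_def)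
  qed
  have t': "\<exists>T. \<forall>r. q' l r = (\<Sum>k\<le>l. T k * s k r)" if "l < Suc j" for l
  proof (cases "l = j")
    case True
    then show ?thesis by (intro exI[of _ "\<lambda>k. inverse (complex_of_real c) * V k"])
        (auto simp: q'_def w_s sum_distrib_left mult_ac)
  next
    case False
    then have l: "l < j" "l \<noteq> j" using that by auto
    show ?thesis by (intro exI[of _ "T l"]) (simp add: q'_def T[OF l(1)] l(2))
  qed
  show ?case
  proof (rule exI[of _ q'], rule exI[of _ U'], intro conjI)
    show "\<forall>a<Suc j. \<forall>b<Suc j. sesq n P (q' a) (q' b) = (if a = b then 1 else 0)"
      by (intro allI impI o')
    show "\<forall>l<Suc j. U' l l \<noteq> 0 \<and> (\<forall>r. s l r = (\<Sum>i\<le>l. U' i l * q' i r))"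
      by (intro allI impI u')
    show "\<forall>l<Suc j. \<exists>T. \<forall>r. q' l r = (\<Sum>k\<le>l. T k * s k r)"
      by (intro allI impI t')
  qed
qed

text \<open>The columns of the Schur matrix span a flag invariant under P^-1 A. Gram-Schmidt in the
  inner product of P keeps this flag, so the form of A in the new basis is triangular with the Schur
  diagonal.\<close>

lemma schur_posdef:
  assumes P: "posdef n P" and A: "A \<in> carrier_mat n n"
    and cp: "char_poly (cmat (minv P * A)) = (\<Prod>e\<leftarrow>es. [:- e, 1:])"
  shows "length es = n \<and> (\<exists>q. (\<forall>a<n. \<forall>b<n. sesq n P (q a) (q b) = (if a = b then 1 else 0)) \<and>
     (\<forall>j<n. sesq n A (q j) (q j) = es ! j))"
proof -
  let ?C = "cmat (minv P * A)"
  have Pc: "P \<in> carrier_mat n n" using P by (simp add: posdef_def)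
  have C: "?C \<in> carrier_mat n n" using posdef_inverse[OF P] A by auto
  obtain B S S' where "schur_decomposition ?C es = (B, S, S')" by (metis prod_cases3)
  with schur_decomposition[OF C cp this] have wit: "similar_mat_wit ?C B S S'" and ut: "upper_triangular B"
    and diag: "diag_mat B = es" by auto
  from wit C have carr: "B \<in> carrier_mat n n" "S \<in> carrier_mat n n" "S' \<in> carrier_mat n n"
    and inv: "S * S' = 1\<^sub>m n" "S' * S = 1\<^sub>m n" and CB: "?C = S * B * S'"
    unfolding similar_mat_wit_def by (auto simp: Let_def)
  have len: "length es = n" using diag carr by (auto simp: diag_mat_def)
  have Bjj: "B $$ (j,j) = es ! j" if "j < n" for j using diag carr that by (auto simp: diag_mat_def)
  have CS: "?C * S = S * B"
  proof -
    have "S * B * S' * S = S * B * (S' * S)" by (rule assoc_mult_mat[OF mult_carrier_mat[OF carr(2,1)] carr(3,2)])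
    then show ?thesis using CB inv carr by auto
  qed
  define s where "s k r = S $$ (r, k)" for k r
  have ASe: "cmat A * S = cmat P * (S * B)"
  proof -
    have "cmat A * S = cmat P * ?C * S" using precond_product[OF P A] by simp
    also have "\<dots> = cmat P * (?C * S)" by (rule assoc_mult_mat[OF cmat_carrier[OF Pc] C carr(2)])
    finally show ?thesis by (simp add: CS)
  qed
  \<comment> \<open>Column \<open>j\<close> of C S = S B, multiplied by P; triangularity of
    \<open>B\<close> cuts the sum off at \<open>j\<close>.\<close>
  have As: "sesq n A Y (s j) = (\<Sum>k\<le>j. B $$ (k,j) * sesq n P Y (s k))" if j: "j < n" for Y j
  proof -
    have v: "cmat A *\<^sub>v col S j = cmat P *\<^sub>v col (S * B) j"
      using col_mult2[OF cmat_carrier[OF A] carr(2) j] col_mult2[OF cmat_carrier[OF Pc] mult_carrier_mat[OF carr(2,1)] j]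
      by (simp only: ASe)
    have cc: "col S j \<in> carrier_vec n" "col (S * B) j \<in> carrier_vec n"
      using carr(1,2) by (auto intro!: carrier_vecI)
    have "sesq n A Y (s j) = sesq n A Y (vec_index (col S j))"
      by (rule sesq_cong) (use carr j in \<open>auto simp: s_def\<close>)
    also have "\<dots> = sesq n P Y (vec_index (col (S * B) j))"
      using sesq_mult_vec[OF A cc(1), of Y] sesq_mult_vec[OF Pc cc(2), of Y] unfolding v
      by (rule trans[OF sym])
    also have "\<dots> = sesq n P Y (\<lambda>r. \<Sum>k\<le>j. B $$ (k,j) * s k r)"
    proof (rule sesq_cong)
      fix r assume r: "r < n"
      have "vec_index (col (S * B) j) r = (\<Sum>k<n. B $$ (k,j) * s k r)"
        using carr j r by (auto simp: scalar_prod_def s_def lessThan_atLeast0 mult_ac intro!: sum.cong)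
      also have "\<dots> = (\<Sum>k\<le>j. B $$ (k,j) * s k r)"
        using j ut carr by (intro sum.mono_neutral_right) (auto simp: upper_triangular_def)
      finally show "vec_index (col (S * B) j) r = (\<Sum>k\<le>j. B $$ (k,j) * s k r)" .
    qed simp
    finally show ?thesis by (simp add: sesq_sum_right)
  qed
  \<comment> \<open>The columns of the invertible matrix \<open>S\<close> are independent.\<close>
  have ind: "\<exists>r<n. (\<Sum>k\<le>i. u k * s k r) \<noteq> 0" if i: "i < n" "u i \<noteq> 0" for u i
  proof (rule ccontr)
    assume "\<not> ?thesis"
    then have z: "(\<Sum>k\<le>i. u k * s k r) = 0" if "r < n" for r using that by auto
    define v where "v = Matrix.vec n (\<lambda>k. if k \<le> i then u k else 0)"
    have v: "v \<in> carrier_vec n" by (simp add: v_def)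
    have "S *\<^sub>v v = 0\<^sub>v n"
    proof (intro eq_vecI)
      fix r assume r: "r < dim_vec (0\<^sub>v n :: complex vec)"
      then have "vec_index (S *\<^sub>v v) r = (\<Sum>k<n. (if k \<le> i then u k else 0) * s k r)"
        using carr v by (auto simp: scalar_prod_def s_def v_def lessThan_atLeast0 mult_ac intro!: sum.cong)
      also have "\<dots> = (\<Sum>k\<le>i. (if k \<le> i then u k else 0) * s k r)"
        using i by (intro sum.mono_neutral_right) auto
      also have "\<dots> = 0" using z r by simp
      finally show "vec_index (S *\<^sub>v v) r = vec_index (0\<^sub>v n) r" using r by simp
    qed (use carr in auto)
    then have "S' *\<^sub>v (S *\<^sub>v v) = 0\<^sub>v n" using carr by auto
    then have "v = 0\<^sub>v n" using assoc_mult_mat_vec[OF carr(3) carr(2) v] inv v by simp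
    then have "vec_index v i = 0" using i by simp
    then show False using i by (simp add: v_def)
  qed
  have "\<exists>q U. (\<forall>a<n. \<forall>b<n. sesq n P (q a) (q b) = (if a = b then 1 else 0)) \<and>
     (\<forall>l<n. U l l \<noteq> 0 \<and> (\<forall>r. s l r = (\<Sum>i\<le>l. U i l * q i r))) \<and>
     (\<forall>l<n. \<exists>T. \<forall>r. q l r = (\<Sum>k\<le>l. T k * s k r))"
    by (rule gram_schmidt_posdef[OF P order_refl], rule ind)
  then obtain q U where GS: "(\<forall>a<n. \<forall>b<n. sesq n P (q a) (q b) = (if a = b then 1 else 0)) \<and>
     (\<forall>l<n. U l l \<noteq> 0 \<and> (\<forall>r. s l r = (\<Sum>i\<le>l. U i l * q i r))) \<and>
     (\<forall>l<n. \<exists>T. \<forall>r. q l r = (\<Sum>k\<le>l. T k * s k r))"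
    by (elim exE)
  have orth: "sesq n P (q a) (q b) = (if a = b then 1 else 0)" if "a < n" "b < n" for a b
    using conjunct1[OF GS] that by blast
  have U: "U l l \<noteq> 0" "s l = (\<lambda>r. \<Sum>i\<le>l. U i l * q i r)" if "l < n" for l
    using conjunct1[OF conjunct2[OF GS], rule_format, OF that] by (auto simp: fun_eq_iff)
  \<comment> \<open>Stated for every \<open>Y\<close> that is P-orthogonal to the earlier
    \<open>q i\<close>, not only for \<open>q j\<close>: the induction hypothesis then applies to
    each earlier index with the same \<open>Y\<close> and makes \<open>sesq n A Y (q i)\<close>
    vanish.\<close>
  have key: "sesq n A Y (q j) = B $$ (j,j) * sesq n P Y (q j)"
    if "j < n" "\<And>i. i < j \<Longrightarrow> sesq n P Y (q i) = 0" for j Y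
    using that
  proof (induction j arbitrary: Y rule: less_induct)
    case (less j)
    have ms: "sesq n M Y (s l) = (\<Sum>i<l. U i l * sesq n M Y (q i)) + U l l * sesq n M Y (q l)" if "l < n" for M l
      unfolding U(2)[OF that] sesq_sum_right by (simp add: lessThan_Suc_atMost[symmetric])
    have A0: "sesq n A Y (q i) = 0" if "i < j" for i
      using less.IH[of i Y] less.prems that by auto
    have P0: "sesq n P Y (s l) = 0" if "l < j" for l
      using ms[of l P] less.prems that by auto
    have "U j j * sesq n A Y (q j) = sesq n A Y (s j)" using ms[of j A] less.prems A0 by simp
    also have "\<dots> = B $$ (j,j) * sesq n P Y (s j)"
      using As[of j Y] less.prems P0 by (simp add: lessThan_Suc_atMost[symmetric])
    also have "\<dots> = B $$ (j,j) * (U j j * sesq n P Y (q j))" using ms[of j P] less.prems by simp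
    finally show ?case using U(1)[of j] less.prems by simp
  qed
  have "sesq n A (q j) (q j) = es ! j" if "j < n" for j
    using key[of j "q j"] orth[of j j] orth Bjj[of j] that by simp
  then show ?thesis using orth len by blast
qed

text \<open>Duality: the functional is tested on the combination of the \<open>q j\<close> whose
  coefficients are the conjugates of its own values. Its value there and the squared P-norm both
  equal the sum \<open>S\<close>, so the bound reads S^2 <= B S.\<close>

lemma bessel_posdef:
  assumes orth: "\<And>a b. a < n \<Longrightarrow> b < n \<Longrightarrow> sesq n P (q a) (q b) = (if a = b then 1 else 0)"
    and bd: "\<And>X. (cmod (\<Sum>i<n. w i * X i))\<^sup>2 \<le> B * Re (sesq n P X X)"
    and K: "K \<subseteq> {..<n}" and B: "B \<ge> 0"
  shows "(\<Sum>j\<in>K. (cmod (\<Sum>i<n. w i * q j i))\<^sup>2) \<le> B"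
proof -
  have fin: "finite K" using K finite_subset by blast
  define l where "l j = (\<Sum>i<n. w i * q j i)" for j
  define S where "S = (\<Sum>j\<in>K. (cmod (l j))\<^sup>2)"
  define X where "X i = (\<Sum>j\<in>K. cnj (l j) * q j i)" for i
  have "(\<Sum>i<n. w i * X i) = (\<Sum>j\<in>K. cnj (l j) * l j)"
    unfolding X_def l_def sum_distrib_left by (subst sum.swap) (simp add: mult_ac)
  also have "\<dots> = complex_of_real S"
    unfolding S_def of_real_sum by (intro sum.cong refl) (metis complex_norm_square mult.commute)
  finally have 1: "(\<Sum>i<n. w i * X i) = complex_of_real S" .
  have "sesq n P X X = (\<Sum>a\<in>K. l a * (\<Sum>b\<in>K. cnj (l b) * sesq n P (q a) (q b)))"
    unfolding X_def sesq_sum_left sesq_sum_right by simp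
  also have "\<dots> = (\<Sum>a\<in>K. l a * (\<Sum>b\<in>K. if a = b then cnj (l b) else 0))"
    by (intro sum.cong refl arg_cong2[where f="(*)"]) (use K orth in \<open>auto simp: subset_eq\<close>)
  also have "\<dots> = (\<Sum>a\<in>K. l a * cnj (l a))" using fin by (intro sum.cong) auto
  also have "\<dots> = complex_of_real S"
    unfolding S_def of_real_sum by (intro sum.cong refl) (metis complex_norm_square)
  finally have "S\<^sup>2 \<le> B * S" using bd[of X] 1 by (simp add: power2_abs)
  moreover have "S \<ge> 0" by (simp add: S_def sum_nonneg)
  ultimately have "S \<le> B" using B by (cases "S = 0") (auto simp: power2_eq_square)
  then show ?thesis unfolding S_def l_def .
qed

text \<open>The order of a root of a product of linear factors is its multiplicity in the list, so
  algebraic multiplicity becomes a number of positions; these positions index the Schur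
  diagonal.\<close>

lemma num_eigenvalues_outside_filter:
  assumes C: "C \<in> carrier_mat n n" and cp: "char_poly C = (\<Prod>e\<leftarrow>es. [:- e, 1:])"
  shows "num_eigenvalues_outside C B = card {j. j < length es \<and> es ! j \<notin> B}"
proof -
  have ev: "eigenvalue C z \<longleftrightarrow> z \<in> set es" for z
    unfolding eigenvalue_root_char_poly[OF C] cp by (auto simp: poly_prod_list prod_list_zero_iff)
  have ord: "Polynomial.order z (\<Prod>e\<leftarrow>es. [:- e, 1:]) = count_list es z" for z
  proof (induction es)
    case (Cons e es)
    have nz: "[:- e, 1:] * (\<Prod>e\<leftarrow>es. [:- e, 1:]) \<noteq> 0" by (auto simp del: mult_pCons_left simp: prod_list_zero_iff)
    have "Polynomial.order z [:- e, 1:] = (if e = z then 1 else 0)"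
      using order_power_n_n[of z 1] by (auto simp: order_0I)
    then show ?case using Cons order_mult[OF nz, of z] by simp
  qed (simp add: order_0I)
  have "num_eigenvalues_outside C B = (\<Sum>z\<in>set es - B. count_list es z)"
    unfolding num_eigenvalues_outside_def cp ord ev by simp
  also have "\<dots> = (\<Sum>z\<in>set es - B. card {j. j < length es \<and> es ! j = z})"
    by (intro sum.cong refl) (simp add: count_list_eq_length_filter length_filter_conv_card eq_commute)
  also have "\<dots> = card (\<Union>z\<in>set es - B. {j. j < length es \<and> es ! j = z})"
    by (rule card_UN_disjoint[symmetric]) auto
  also have "(\<Union>z\<in>set es - B. {j. j < length es \<and> es ! j = z}) = {j. j < length es \<and> es ! j \<notin> B}"
    by auto
  finally show ?thesis .
qed

text \<open>The diagonal entries of a triangular form that is orthonormal for \<open>P\<close> are the eigenvalues, so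
  Bessel's inequality turns a bound of the quadratic form of \<open>A - P\<close> into a bound of their number.\<close>

lemma num_eigenvalues_outside_le:
  fixes B :: real
  assumes P: "posdef n P" and A: "A \<in> carrier_mat n n" and eps: "\<epsilon> > 0"
    and form: "\<And>X. cmod (sesq n A X X - sesq n P X X) \<le>
        \<epsilon> / 2 * Re (sesq n P X X) + (\<Sum>l\<in>L. (cmod (\<Sum>i<n. w l i * X i))\<^sup>2)"
    and bd: "\<And>l X. l \<in> L \<Longrightarrow> (cmod (\<Sum>i<n. w l i * X i))\<^sup>2 \<le> B * Re (sesq n P X X)"
    and B: "B \<ge> 0"
  shows "real (num_eigenvalues_outside (cmat (minv P * A)) (ball 1 \<epsilon>)) \<le> 2 * card L * B / \<epsilon>"
proof -
  let ?C = "cmat (minv P * A)"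
  have C: "?C \<in> carrier_mat n n" using posdef_inverse[OF P] A by auto
  obtain es where cp: "char_poly ?C = (\<Prod>e\<leftarrow>es. [:- e, 1:])" using char_poly_factorized[OF C] by auto
  obtain q where len: "length es = n"
    and orth: "\<And>a b. a < n \<Longrightarrow> b < n \<Longrightarrow> sesq n P (q a) (q b) = (if a = b then 1 else 0)"
    and diag: "\<And>j. j < n \<Longrightarrow> sesq n A (q j) (q j) = es ! j"
    using schur_posdef[OF P A cp] by auto
  define K where "K = {j. j < length es \<and> es ! j \<notin> ball 1 \<epsilon>}"
  have K: "K \<subseteq> {..<n}" using len by (auto simp: K_def)
  \<comment> \<open>At a position outside the disk the form of A - P at \<open>q j\<close> has
    modulus |z - 1| >= \<epsilon>, while the form of P is 1; half of \<epsilon> is absorbed, and the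
    functionals must pay for the rest.\<close>
  have "\<epsilon> * card K = (\<Sum>j\<in>K. \<epsilon>)" by simp
  also have "\<dots> \<le> (\<Sum>j\<in>K. \<epsilon> / 2 + (\<Sum>l\<in>L. (cmod (\<Sum>i<n. w l i * q j i))\<^sup>2))"
  proof (rule sum_mono)
    fix j assume j: "j \<in> K"
    then have "\<epsilon> \<le> cmod (es ! j - 1)" by (simp add: K_def dist_norm norm_minus_commute)
    also have "\<dots> \<le> \<epsilon> / 2 + (\<Sum>l\<in>L. (cmod (\<Sum>i<n. w l i * q j i))\<^sup>2)"
      using form[of "q j"] diag[of j] orth[of j j] j K by auto
    finally show "\<epsilon> \<le> \<epsilon> / 2 + (\<Sum>l\<in>L. (cmod (\<Sum>i<n. w l i * q j i))\<^sup>2)" .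
  qed
  also have "\<dots> = \<epsilon> / 2 * card K + (\<Sum>l\<in>L. \<Sum>j\<in>K. (cmod (\<Sum>i<n. w l i * q j i))\<^sup>2)"
    by (simp add: sum.distrib sum.swap[of _ K])
  also have "(\<Sum>l\<in>L. \<Sum>j\<in>K. (cmod (\<Sum>i<n. w l i * q j i))\<^sup>2) \<le> (\<Sum>l\<in>L. B)"
    by (intro sum_mono bessel_posdef[where q=q and P=P and n=n] bd orth K B)
  finally have "\<epsilon> / 2 * card K \<le> card L * B" by simp
  then show ?thesis using eps
    unfolding num_eigenvalues_outside_filter[OF C cp] K_def[symmetric] by (simp add: field_simps)
qed

text \<open>The finitely many \<open>m < m1\<close> have finite counts; their sum is added to the
  bound valid from \<open>m1\<close> on.\<close>

lemma properly_clusteredI: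
  assumes "\<And>\<epsilon>. \<epsilon> > 0 \<Longrightarrow> \<exists>m1 C. \<forall>m\<in>M. m \<ge> m1 \<longrightarrow> real (num_eigenvalues_outside (X m) (ball s \<epsilon>)) \<le> C"
  shows "properly_clustered M X s"
  unfolding properly_clustered_def
proof (intro allI impI)
  fix \<epsilon> :: real assume "\<epsilon> > 0"
  then obtain m1 C where C: "\<And>m. m \<in> M \<Longrightarrow> m \<ge> m1 \<Longrightarrow> real (num_eigenvalues_outside (X m) (ball s \<epsilon>)) \<le> C"
    using assms by blast
  define D where "D = (\<Sum>m<m1. num_eigenvalues_outside (X m) (ball s \<epsilon>)) + nat \<lceil>C\<rceil>"
  have "num_eigenvalues_outside (X m) (ball s \<epsilon>) \<le> D" if "m \<in> M" for m
  proof (cases "m < m1")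
    case True
    then have "num_eigenvalues_outside (X m) (ball s \<epsilon>) \<le> (\<Sum>m<m1. num_eigenvalues_outside (X m) (ball s \<epsilon>))"
      by (intro member_le_sum) auto
    then show ?thesis by (simp add: D_def)
  next
    case False
    then have "real (num_eigenvalues_outside (X m) (ball s \<epsilon>)) \<le> C" using C that by simp
    then show ?thesis unfolding D_def by linarith
  qed
  then show "\<exists>C. \<forall>m\<in>M. num_eigenvalues_outside (X m) (ball s \<epsilon>) \<le> C" by blast
qed

section \<open>Discrete Poincare inequalities\<close>

lemma cmod_add_sq: "(cmod (a + b))\<^sup>2 \<le> 2 * (cmod a)\<^sup>2 + 2 * (cmod b)\<^sup>2"
proof -
  have "(cmod (a + b))\<^sup>2 \<le> (cmod a + cmod b)\<^sup>2" by (simp add: norm_triangle_ineq power_mono)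
  also have "\<dots> \<le> 2 * (cmod a)\<^sup>2 + 2 * (cmod b)\<^sup>2"
    using sum_squares_bound[of "cmod a" "cmod b"] by (simp add: power2_sum)
  finally show ?thesis .
qed

lemma cmod_sum_sq_le:
  assumes "finite A"
  shows "(cmod (\<Sum>i\<in>A. f i))\<^sup>2 \<le> card A * (\<Sum>i\<in>A. (cmod (f i))\<^sup>2)"
proof -
  have "(cmod (\<Sum>i\<in>A. f i))\<^sup>2 \<le> (\<Sum>i\<in>A. cmod (f i))\<^sup>2" by (intro power_mono norm_sum) auto
  also have "\<dots> \<le> card A * (\<Sum>i\<in>A. (cmod (f i))\<^sup>2)"
    using Cauchy_Schwarz_ineq_sum[of "\<lambda>_. 1" "\<lambda>i. cmod (f i)" A] by simp
  finally show ?thesis .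
qed

text \<open>Telescoping and Cauchy-Schwarz.\<close>

lemma cmod_diff_sq_le:
  fixes f :: "nat \<Rightarrow> complex"
  assumes "i \<le> K" "j \<le> K"
  shows "(cmod (f i - f j))\<^sup>2 \<le> K * (\<Sum>r<K. (cmod (f (Suc r) - f r))\<^sup>2)"
  using assms
proof (induction i j rule: linorder_wlog)
  case (le i j)
  have "f j - f i = (\<Sum>r\<in>{i..<j}. f (Suc r) - f r)" using le by (simp add: sum_Suc_diff')
  then have "(cmod (f i - f j))\<^sup>2 = (cmod (\<Sum>r\<in>{i..<j}. f (Suc r) - f r))\<^sup>2"
    by (metis norm_minus_commute)
  also have "\<dots> \<le> card {i..<j} * (\<Sum>r\<in>{i..<j}. (cmod (f (Suc r) - f r))\<^sup>2)" by (rule cmod_sum_sq_le) simp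
  also have "\<dots> \<le> K * (\<Sum>r<K. (cmod (f (Suc r) - f r))\<^sup>2)"
    using le by (intro mult_mono sum_mono2) (auto intro: sum_nonneg)
  finally show ?case .
next
  case (sym i j)
  have "cmod (f j - f i) = cmod (f i - f j)" by (rule norm_minus_commute)
  then show ?case using sym by simp
qed

text \<open>Each deviation from the mean is an average of differences, and the mean splits off by
  orthogonality. The differences run up to \<open>f K\<close>, one step beyond the averaged range,
  so that adjacent cells join without a gap.\<close>

lemma poincare_mean:
  fixes f :: "nat \<Rightarrow> complex"
  assumes "K > 0"
  shows "(\<Sum>i<K. (cmod (f i))\<^sup>2) \<le> (cmod (\<Sum>i<K. f i))\<^sup>2 / K + K\<^sup>2 * (\<Sum>r<K. (cmod (f (Suc r) - f r))\<^sup>2)"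
proof -
  define T where "T = (\<Sum>r<K. (cmod (f (Suc r) - f r))\<^sup>2)"
  define \<mu> where "\<mu> = (\<Sum>i<K. f i) / K"
  have \<mu>: "(\<Sum>i<K. f i) = K * \<mu>" using assms by (simp add: \<mu>_def)
  have dev: "(cmod (f i - \<mu>))\<^sup>2 \<le> K * T" if "i < K" for i
  proof -
    have "K * (f i - \<mu>) = (\<Sum>j<K. f i - f j)" by (simp add: sum_subtractf \<mu> algebra_simps)
    then have "(K * cmod (f i - \<mu>))\<^sup>2 = (cmod (\<Sum>j<K. f i - f j))\<^sup>2"
      by (metis norm_mult norm_of_nat)
    also have "\<dots> \<le> K * (\<Sum>j<K. (cmod (f i - f j))\<^sup>2)" using cmod_sum_sq_le[of "{..<K}"] by simp
    also have "\<dots> \<le> K * (\<Sum>j<K. K * T)"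
      unfolding T_def using that by (intro mult_left_mono sum_mono cmod_diff_sq_le) auto
    finally have "(real K)\<^sup>2 * (cmod (f i - \<mu>))\<^sup>2 \<le> (real K)\<^sup>2 * (K * T)"
      by (simp add: power_mult_distrib power2_eq_square mult_ac)
    then show ?thesis using assms by simp
  qed
  have "(cmod (f i))\<^sup>2 = (cmod (f i - \<mu>))\<^sup>2 + 2 * (inner \<mu> (f i)) - (cmod \<mu>)\<^sup>2" for i
    using dot_norm_neg[of \<mu> "f i"] norm_minus_commute[of "f i" \<mu>] by simp
  then have "(\<Sum>i<K. (cmod (f i))\<^sup>2) = (\<Sum>i<K. (cmod (f i - \<mu>))\<^sup>2) + 2 * (inner \<mu> (\<Sum>i<K. f i)) - K * (cmod \<mu>)\<^sup>2"
    by (simp add: sum.distrib sum_subtractf inner_sum_right sum_distrib_left)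
  also have "inner \<mu> (\<Sum>i<K. f i) = K * (cmod \<mu>)\<^sup>2"
  proof -
    have "(\<Sum>i<K. f i) = real K *\<^sub>R \<mu>" by (simp add: \<mu> scaleR_conv_of_real)
    then show ?thesis by (simp add: power2_norm_eq_inner)
  qed
  also have "(\<Sum>i<K. (cmod (f i - \<mu>))\<^sup>2) \<le> (\<Sum>i<K. K * T)" using dev by (intro sum_mono) auto
  finally have "(\<Sum>i<K. (cmod (f i))\<^sup>2) \<le> K\<^sup>2 * T + K * (cmod \<mu>)\<^sup>2" by (simp add: power2_eq_square)
  moreover have "(cmod (\<Sum>i<K. f i))\<^sup>2 / K = K * (cmod \<mu>)\<^sup>2"
    using assms by (simp add: \<mu> norm_mult power_mult_distrib power2_eq_square)
  ultimately show ?thesis by (simp add: T_def)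
qed

text \<open>The one-dimensional inequality is applied along each row and then to the row sums; the
  factor \<open>K\<close> lost by Cauchy-Schwarz on differences of row sums is compensated by the
  1/K of the mean.\<close>

lemma poincare_mean_square:
  fixes f :: "nat \<Rightarrow> nat \<Rightarrow> complex"
  assumes K: "K > 0"
  shows "(\<Sum>i<K. \<Sum>j<K. (cmod (f i j))\<^sup>2) \<le> (cmod (\<Sum>i<K. \<Sum>j<K. f i j))\<^sup>2 / K\<^sup>2 +
     K\<^sup>2 * (\<Sum>i<K. \<Sum>j<K. (cmod (f (Suc i) j - f i j))\<^sup>2 + (cmod (f i (Suc j) - f i j))\<^sup>2)"
proof -
  define F where "F i = (\<Sum>j<K. f i j)" for i
  have "(\<Sum>i<K. \<Sum>j<K. (cmod (f i j))\<^sup>2) \<le>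
      (\<Sum>i<K. (cmod (F i))\<^sup>2 / K + K\<^sup>2 * (\<Sum>j<K. (cmod (f i (Suc j) - f i j))\<^sup>2))"
    unfolding F_def using poincare_mean[OF K] by (intro sum_mono) simp
  also have "\<dots> = (\<Sum>i<K. (cmod (F i))\<^sup>2) / K + K\<^sup>2 * (\<Sum>i<K. \<Sum>j<K. (cmod (f i (Suc j) - f i j))\<^sup>2)"
    by (simp add: sum.distrib sum_divide_distrib sum_distrib_left)
  also have "(\<Sum>i<K. (cmod (F i))\<^sup>2) / K \<le>
      ((cmod (\<Sum>i<K. F i))\<^sup>2 / K + K\<^sup>2 * (\<Sum>i<K. (cmod (F (Suc i) - F i))\<^sup>2)) / K"
    using poincare_mean[OF K, of F] by (intro divide_right_mono) auto
  also have "\<dots> = (cmod (\<Sum>i<K. F i))\<^sup>2 / K\<^sup>2 + K * (\<Sum>i<K. (cmod (F (Suc i) - F i))\<^sup>2)"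
    using K by (simp add: add_divide_distrib power2_eq_square)
  also have "(\<Sum>i<K. (cmod (F (Suc i) - F i))\<^sup>2) \<le> (\<Sum>i<K. K * (\<Sum>j<K. (cmod (f (Suc i) j - f i j))\<^sup>2))"
  proof (rule sum_mono)
    fix i
    have "F (Suc i) - F i = (\<Sum>j<K. f (Suc i) j - f i j)" by (simp add: F_def sum_subtractf)
    then show "(cmod (F (Suc i) - F i))\<^sup>2 \<le> K * (\<Sum>j<K. (cmod (f (Suc i) j - f i j))\<^sup>2)"
      using cmod_sum_sq_le[of "{..<K}" "\<lambda>j. f (Suc i) j - f i j"] by simp
  qed
  finally have "(\<Sum>i<K. \<Sum>j<K. (cmod (f i j))\<^sup>2) \<le> (cmod (\<Sum>i<K. F i))\<^sup>2 / K\<^sup>2 +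
      K * (\<Sum>i<K. K * (\<Sum>j<K. (cmod (f (Suc i) j - f i j))\<^sup>2)) +
      K\<^sup>2 * (\<Sum>i<K. \<Sum>j<K. (cmod (f i (Suc j) - f i j))\<^sup>2)"
    by (simp add: mult_left_mono)
  then show ?thesis
    by (simp add: F_def sum.distrib sum_distrib_left power2_eq_square algebra_simps)
qed

text \<open>The cells partition the index square, and the differences assigned to them partition all
  differences, so none is counted twice.\<close>

lemma poincare_blocks:
  fixes f :: "nat \<Rightarrow> nat \<Rightarrow> complex"
  assumes K: "K > 0"
  shows "(\<Sum>i<N * K. \<Sum>j<N * K. (cmod (f i j))\<^sup>2) \<le>
     (\<Sum>k<N. \<Sum>l<N. (cmod (\<Sum>i\<in>{k * K..<k * K + K}. \<Sum>j\<in>{l * K..<l * K + K}. f i j))\<^sup>2 / K\<^sup>2) +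
     K\<^sup>2 * (\<Sum>i<N * K. \<Sum>j<N * K. (cmod (f (Suc i) j - f i j))\<^sup>2 + (cmod (f i (Suc j) - f i j))\<^sup>2)"
proof -
  have blk: "(\<Sum>i<N * K. \<Sum>j<N * K. g i j) = (\<Sum>k<N. \<Sum>l<N. \<Sum>i<K. \<Sum>j<K. g (i + k * K) (j + l * K))"
    for g :: "nat \<Rightarrow> nat \<Rightarrow> 'z::comm_monoid_add"
  proof -
    have sh: "sum h {k * K..<k * K + K} = (\<Sum>i<K. h (i + k * K))" for h :: "nat \<Rightarrow> 'z" and k
      using sum.shift_bounds_nat_ivl[of h 0 "k * K" K] by (simp add: atLeast0LessThan add.commute)
    have "(\<Sum>i<N * K. \<Sum>j<N * K. g i j) = (\<Sum>k<N. \<Sum>i<K. \<Sum>l<N. \<Sum>j<K. g (i + k * K) (j + l * K))"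
      unfolding sum.nat_group[symmetric] sh ..
    also have "\<dots> = (\<Sum>k<N. \<Sum>l<N. \<Sum>i<K. \<Sum>j<K. g (i + k * K) (j + l * K))"
      by (intro sum.cong refl sum.swap)
    finally show ?thesis .
  qed
  have sh: "sum h {k * K..<k * K + K} = (\<Sum>i<K. h (i + k * K))" for h :: "nat \<Rightarrow> complex" and k
    using sum.shift_bounds_nat_ivl[of h 0 "k * K" K] by (simp add: atLeast0LessThan add.commute)
  show ?thesis
    unfolding blk sh sum_distrib_left sum.distrib[symmetric]
    unfolding sum_distrib_left[symmetric]
    apply (intro sum_mono)
    subgoal for k l using poincare_mean_square[OF K, of "\<lambda>i j. f (i + k * K) (j + l * K)"] by simp
    done
qed

text \<open>The vanishing first value takes the place of the mean.\<close>

lemma poincare_zero: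
  fixes f :: "nat \<Rightarrow> complex"
  assumes "f 0 = 0"
  shows "(\<Sum>i<K. (cmod (f i))\<^sup>2) \<le> K\<^sup>2 * (\<Sum>r<K. (cmod (f (Suc r) - f r))\<^sup>2)"
proof -
  have "(\<Sum>i<K. (cmod (f i))\<^sup>2) \<le> (\<Sum>i<K. K * (\<Sum>r<K. (cmod (f (Suc r) - f r))\<^sup>2))"
    using cmod_diff_sq_le[of _ K 0 f] assms by (intro sum_mono) auto
  then show ?thesis by (simp add: power2_eq_square)
qed

text \<open>For \<open>z\<close> vanishing outside \<open>inner_box m\<close> every nonzero difference is counted in \<open>dir_energy m z\<close>.\<close>

definition box :: "nat \<Rightarrow> (int \<times> int) set" where
  "box m = {- int m..int m} \<times> {- int m..int m}"

definition inner_box :: "nat \<Rightarrow> (int \<times> int) set" where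
  "inner_box m = {- int m<..<int m} \<times> {- int m<..<int m}"

definition dir_energy :: "nat \<Rightarrow> (int \<times> int \<Rightarrow> complex) \<Rightarrow> real" where
  "dir_energy m z = (\<Sum>k\<in>box m. (cmod (z (k + (1, 0)) - z k))\<^sup>2 + (cmod (z (k + (0, 1)) - z k))\<^sup>2)"

definition sq_norm :: "nat \<Rightarrow> (int \<times> int \<Rightarrow> complex) \<Rightarrow> real" where
  "sq_norm m z = (\<Sum>k\<in>box m. (cmod (z k))\<^sup>2)"

lemma dir_energy_nonneg: "dir_energy m z \<ge> 0" and sq_norm_nonneg: "sq_norm m z \<ge> 0"
  unfolding dir_energy_def sq_norm_def by (intro sum_nonneg; simp)+

lemma finite_box[simp]: "finite (box m)" by (simp add: box_def)

text \<open>The index range may exceed the box, which leaves its length free to be a multiple of the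
  cell size.\<close>

lemma sum_box_shift:
  fixes g :: "int \<times> int \<Rightarrow> real"
  assumes M: "M \<ge> 2 * m + 1" and z: "\<And>k. k \<notin> box m \<Longrightarrow> g k = 0"
  shows "(\<Sum>i<M. \<Sum>j<M. g (int i - int m, int j - int m)) = (\<Sum>k\<in>box m. g k)"
proof -
  have "(\<Sum>i<M. \<Sum>j<M. g (int i - int m, int j - int m)) =
      (\<Sum>(i, j)\<in>{..<M} \<times> {..<M}. g (int i - int m, int j - int m))"
    by (simp add: sum.cartesian_product)
  also have "\<dots> = (\<Sum>k\<in>(\<lambda>(i, j). (int i - int m, int j - int m)) ` ({..<M} \<times> {..<M}). g k)"
    by (subst sum.reindex) (auto simp: inj_on_def intro!: sum.cong)
  also have "\<dots> = (\<Sum>k\<in>box m. g k)"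
  proof (rule sum.mono_neutral_right)
    show "box m \<subseteq> (\<lambda>(i, j). (int i - int m, int j - int m)) ` ({..<M} \<times> {..<M})"
    proof
      fix k assume "k \<in> box m"
      then have "k = (\<lambda>(i, j). (int i - int m, int j - int m)) (nat (fst k + m), nat (snd k + m))"
        "(nat (fst k + m), nat (snd k + m)) \<in> {..<M} \<times> {..<M}"
        using M by (auto simp: box_def)
      then show "k \<in> (\<lambda>(i, j). (int i - int m, int j - int m)) ` ({..<M} \<times> {..<M})" by (rule image_eqI)
    qed
  qed (use z in auto)
  finally show ?thesis .
qed

lemma shifted_sums:
  assumes M: "M \<ge> 2 * m + 1" and z: "\<And>k. k \<notin> inner_box m \<Longrightarrow> z k = 0"
  defines "f \<equiv> \<lambda>i j. z (int i - int m, int j - int m)"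
  shows "(\<Sum>i<M. \<Sum>j<M. (cmod (f i j))\<^sup>2) = sq_norm m z"
    and "(\<Sum>i<M. \<Sum>j<M. (cmod (f (Suc i) j - f i j))\<^sup>2 + (cmod (f i (Suc j) - f i j))\<^sup>2) = dir_energy m z"
proof -
  show "(\<Sum>i<M. \<Sum>j<M. (cmod (f i j))\<^sup>2) = sq_norm m z"
    unfolding f_def sq_norm_def
  proof (rule sum_box_shift[OF M, where g="\<lambda>k. (cmod (z k))\<^sup>2"])
    fix k assume "k \<notin> box m"
    then have "k \<notin> inner_box m" by (auto simp: box_def inner_box_def)
    then show "(cmod (z k))\<^sup>2 = 0" by (simp add: z)
  qed
  define g where "g k = (cmod (z (k + (1, 0)) - z k))\<^sup>2 + (cmod (z (k + (0, 1)) - z k))\<^sup>2" for k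
  have "g k = 0" if "k \<notin> box m" for k
  proof -
    have "k \<notin> inner_box m" "k + (1, 0) \<notin> inner_box m" "k + (0, 1) \<notin> inner_box m"
      using that by (cases k; auto simp: box_def inner_box_def)+
    then show ?thesis by (simp add: g_def z)
  qed
  then have "(\<Sum>i<M. \<Sum>j<M. g (int i - int m, int j - int m)) = (\<Sum>k\<in>box m. g k)"
    by (rule sum_box_shift[OF M])
  then show "(\<Sum>i<M. \<Sum>j<M. (cmod (f (Suc i) j - f i j))\<^sup>2 + (cmod (f i (Suc j) - f i j))\<^sup>2) = dir_energy m z"
    by (simp add: g_def f_def dir_energy_def algebra_simps)
qed

text \<open>Differences in one direction suffice, since each line starts at the coordinate -m,
  outside \<open>inner_box m\<close>. The constant 9 comes from 2m + 1 <= 3m.\<close>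

lemma sq_norm_le_dir_energy:
  assumes m: "m \<ge> 1" and z: "\<And>k. k \<notin> inner_box m \<Longrightarrow> z k = 0"
  shows "sq_norm m z \<le> 9 * (real m)\<^sup>2 * dir_energy m z"
proof -
  define M where "M = 2 * m + 1"
  define f where "f i j = z (int i - int m, int j - int m)" for i j
  have sh: "(\<Sum>i<M. \<Sum>j<M. (cmod (f i j))\<^sup>2) = sq_norm m z"
    "(\<Sum>i<M. \<Sum>j<M. (cmod (f (Suc i) j - f i j))\<^sup>2 + (cmod (f i (Suc j) - f i j))\<^sup>2) = dir_energy m z"
    unfolding f_def using shifted_sums[of m M z] z by (auto simp: M_def)
  have "sq_norm m z = (\<Sum>j<M. \<Sum>i<M. (cmod (f i j))\<^sup>2)" unfolding sh(1)[symmetric] by (rule sum.swap)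
  also have "\<dots> \<le> (\<Sum>j<M. (real M)\<^sup>2 * (\<Sum>i<M. (cmod (f (Suc i) j - f i j))\<^sup>2))"
  proof (rule sum_mono)
    fix j
    have "f 0 j = 0" by (simp add: f_def z inner_box_def)
    then show "(\<Sum>i<M. (cmod (f i j))\<^sup>2) \<le> (real M)\<^sup>2 * (\<Sum>i<M. (cmod (f (Suc i) j - f i j))\<^sup>2)"
      using poincare_zero[of "\<lambda>i. f i j" M] by simp
  qed
  also have "\<dots> = (real M)\<^sup>2 * (\<Sum>i<M. \<Sum>j<M. (cmod (f (Suc i) j - f i j))\<^sup>2)"
    unfolding sum_distrib_left[symmetric] by (intro arg_cong2[where f="(*)"] refl sum.swap)
  also have "\<dots> \<le> (real M)\<^sup>2 * dir_energy m z"
    unfolding sh(2)[symmetric] by (intro mult_left_mono sum_mono) auto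
  also have "\<dots> \<le> (3 * real m)\<^sup>2 * dir_energy m z"
  proof (intro mult_right_mono dir_energy_nonneg power_mono)
    show "real M \<le> 3 * real m" using m by (simp add: M_def)
  qed auto
  finally show ?thesis by (simp add: power_mult_distrib)
qed

text \<open>The side \<open>K\<close> is chosen such that \<open>N\<^sup>2\<close> cells cover \<open>box m\<close>, while \<open>N K \<le> 3 m\<close> for \<open>m \<ge> N\<close>.\<close>

definition coarse :: "nat \<Rightarrow> nat \<Rightarrow> nat \<times> nat \<Rightarrow> (int \<times> int) set" where
  "coarse m N l = (let K = Suc ((2 * m) div N) in
     {int (fst l * K) - int m..<int (fst l * K + K) - int m} \<times>
     {int (snd l * K) - int m..<int (snd l * K + K) - int m})"

lemma sum_coarse:
  fixes z :: "int \<times> int \<Rightarrow> complex"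
  fixes m N :: nat
  defines "K \<equiv> Suc ((2 * m) div N)"
  shows "(\<Sum>k\<in>coarse m N (a, b). z k) =
    (\<Sum>i\<in>{a * K..<a * K + K}. \<Sum>j\<in>{b * K..<b * K + K}. z (int i - int m, int j - int m))"
proof -
  have im: "{int p - int m..<int q - int m} = (\<lambda>i. int i - int m) ` {p..<q}" for p q
  proof -
    have "x \<in> (\<lambda>i. int i - int m) ` {p..<q}" if "x \<in> {int p - int m..<int q - int m}" for x
      using that by (intro image_eqI[of _ _ "nat (x + m)"]) auto
    then show ?thesis by auto
  qed
  have inj: "inj_on (\<lambda>i. int i - int m) A" for A by (auto simp: inj_on_def)
  show ?thesis
    unfolding coarse_def Let_def K_def[symmetric] fst_conv snd_conv im
    by (simp add: sum.Sigma[symmetric] sum.cartesian_product' sum.reindex[OF inj] del: of_nat_add of_nat_mult)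
qed

text \<open>The energy carries the factor 9/N^2, small for large \<open>N\<close>, while the number
  N^2 of functionals does not depend on \<open>m\<close>.\<close>

lemma coarse_poincare:
  assumes N: "N > 0" and m: "m \<ge> N" and z: "\<And>k. k \<notin> inner_box m \<Longrightarrow> z k = 0"
  shows "sq_norm m z / (real m)\<^sup>2 \<le> 9 / (real N)\<^sup>2 * dir_energy m z +
     (\<Sum>l\<in>{..<N} \<times> {..<N}. (cmod (complex_of_real (N / (real m)\<^sup>2) * (\<Sum>k\<in>coarse m N l. z k)))\<^sup>2)"
proof -
  define K where "K = Suc ((2 * m) div N)"
  define f where "f i j = z (int i - int m, int j - int m)" for i j
  have "K > 0" by (simp add: K_def)
  have M: "N * K \<ge> 2 * m + 1"
    unfolding K_def using N by (metis dividend_less_times_div Suc_eq_plus1 Suc_leI mult_Suc_right add.commute)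
  have K: "N * K \<le> 3 * m"
    unfolding K_def using m times_div_less_eq_dividend[of N "2 * m"] by (simp del: times_div_less_eq_dividend)
  have sh: "(\<Sum>i<N * K. \<Sum>j<N * K. (cmod (f i j))\<^sup>2) = sq_norm m z"
    "(\<Sum>i<N * K. \<Sum>j<N * K. (cmod (f (Suc i) j - f i j))\<^sup>2 + (cmod (f i (Suc j) - f i j))\<^sup>2) = dir_energy m z"
    unfolding f_def using shifted_sums[OF M, of z] z by auto
  \<comment> \<open>\<open>K\<close> lies between m/N and 3m/N: the upper bound controls the factor
    K^2 of the energy, the lower one replaces 1/K by N/m in the functionals.\<close>
  have K': "real K \<le> 3 * m / N"
  proof -
    have "real (N * K) \<le> real (3 * m)" using K by (rule of_nat_mono)
    then show ?thesis using N by (simp add: le_divide_eq mult.commute)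
  qed
  have sc: "(\<Sum>k\<in>coarse m N (a, b). z k) = (\<Sum>i\<in>{a * K..<a * K + K}. \<Sum>j\<in>{b * K..<b * K + K}. f i j)" for a b
    unfolding f_def K_def by (rule sum_coarse)
  have K'': "real K \<ge> m / N"
  proof -
    have "real (2 * m + 1) \<le> real (N * K)" using M by (rule of_nat_mono)
    then show ?thesis using N by (simp add: divide_le_eq mult.commute)
  qed
  have "sq_norm m z \<le> (\<Sum>k<N. \<Sum>l<N. (cmod (\<Sum>i\<in>{k * K..<k * K + K}. \<Sum>j\<in>{l * K..<l * K + K}. f i j))\<^sup>2 / K\<^sup>2) +
     (real K)\<^sup>2 * dir_energy m z"
    using poincare_blocks[OF \<open>K > 0\<close>, where N=N and f=f] unfolding sh by simp
  also have "(\<Sum>k<N. \<Sum>l<N. (cmod (\<Sum>i\<in>{k * K..<k * K + K}. \<Sum>j\<in>{l * K..<l * K + K}. f i j))\<^sup>2 / K\<^sup>2) =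
      (\<Sum>l\<in>{..<N} \<times> {..<N}. (cmod (\<Sum>k\<in>coarse m N l. z k))\<^sup>2 / K\<^sup>2)"
    by (simp add: sum.cartesian_product' sc)
  also have "\<dots> \<le> (\<Sum>l\<in>{..<N} \<times> {..<N}. (cmod (\<Sum>k\<in>coarse m N l. z k))\<^sup>2 * (N / m)\<^sup>2)"
  proof (rule sum_mono)
    fix l
    have "1 / real K \<le> N / m" using K'' N m \<open>K > 0\<close> by (simp add: field_simps)
    then have "(1 / real K)\<^sup>2 \<le> (N / m)\<^sup>2" by (intro power_mono) auto
    then have "(cmod (\<Sum>k\<in>coarse m N l. z k))\<^sup>2 * (1 / real K)\<^sup>2 \<le> (cmod (\<Sum>k\<in>coarse m N l. z k))\<^sup>2 * (N / m)\<^sup>2"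
      by (intro mult_left_mono) auto
    then show "(cmod (\<Sum>k\<in>coarse m N l. z k))\<^sup>2 / K\<^sup>2 \<le> (cmod (\<Sum>k\<in>coarse m N l. z k))\<^sup>2 * (N / m)\<^sup>2"
      by (simp add: power_divide)
  qed
  also have "(real K)\<^sup>2 * dir_energy m z \<le> (3 * m / N)\<^sup>2 * dir_energy m z"
    by (intro mult_right_mono power_mono K' dir_energy_nonneg) auto
  finally have "sq_norm m z / (real m)\<^sup>2 \<le>
      ((\<Sum>l\<in>{..<N} \<times> {..<N}. (cmod (\<Sum>k\<in>coarse m N l. z k))\<^sup>2 * (N / m)\<^sup>2) + (3 * m / N)\<^sup>2 * dir_energy m z) / (real m)\<^sup>2"
    by (intro divide_right_mono) auto
  also have "\<dots> = 9 / (real N)\<^sup>2 * dir_energy m z +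
     (\<Sum>l\<in>{..<N} \<times> {..<N}. (cmod (complex_of_real (N / (real m)\<^sup>2) * (\<Sum>k\<in>coarse m N l. z k)))\<^sup>2)"
    using m N unfolding norm_mult norm_of_real power_mult_distrib
    by (simp add: add_divide_distrib power_divide sum_divide_distrib power_mult_distrib mult_ac power2_eq_square)
  finally show ?thesis .
qed

text \<open>Cauchy-Schwarz on the K^2 points of a cell, then the global Poincare inequality: 81 is 9
  from (N K)^2 <= 9 m^2 times the Poincare constant 9. Bessel's inequality requires this uniform
  bound.\<close>

lemma coarse_bounded:
  assumes N: "N > 0" and m: "m \<ge> N" and z: "\<And>k. k \<notin> inner_box m \<Longrightarrow> z k = 0"
  shows "(cmod (complex_of_real (N / (real m)\<^sup>2) * (\<Sum>k\<in>coarse m N l. z k)))\<^sup>2 \<le> 81 * dir_energy m z"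
proof -
  define K where "K = Suc ((2 * m) div N)"
  have K: "N * K \<le> 3 * m"
    unfolding K_def using m times_div_less_eq_dividend[of N "2 * m"] by (simp del: times_div_less_eq_dividend)
  have K0: "(0::real) \<le> (real K)\<^sup>2" by simp
  have fin: "finite (coarse m N l)" and card: "card (coarse m N l) = K\<^sup>2"
    by (simp_all add: coarse_def Let_def card_cartesian_product K_def[symmetric] power2_eq_square)
  have "(cmod (\<Sum>k\<in>coarse m N l. z k))\<^sup>2 \<le> (real K)\<^sup>2 * (\<Sum>k\<in>coarse m N l. (cmod (z k))\<^sup>2)"
    using cmod_sum_sq_le[OF fin, of z] by (simp add: card)
  also have "(real K)\<^sup>2 * (\<Sum>k\<in>coarse m N l. (cmod (z k))\<^sup>2) \<le> (real K)\<^sup>2 * (9 * (real m)\<^sup>2 * dir_energy m z)"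
  proof (rule mult_left_mono[OF _ K0])
    have "(\<Sum>k\<in>coarse m N l. (cmod (z k))\<^sup>2) = (\<Sum>k\<in>coarse m N l \<inter> box m. (cmod (z k))\<^sup>2)"
    proof (intro sum.mono_neutral_right ballI)
      fix k assume "k \<in> coarse m N l - coarse m N l \<inter> box m"
      then have "k \<notin> inner_box m" by (auto simp: box_def inner_box_def)
      then show "(cmod (z k))\<^sup>2 = 0" by (simp add: z)
    qed (use fin in auto)
    also have "\<dots> \<le> sq_norm m z" unfolding sq_norm_def by (intro sum_mono2) auto
    also have "\<dots> \<le> 9 * (real m)\<^sup>2 * dir_energy m z" using N m by (intro sq_norm_le_dir_energy z) auto
    finally show "(\<Sum>k\<in>coarse m N l. (cmod (z k))\<^sup>2) \<le> 9 * (real m)\<^sup>2 * dir_energy m z" .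
  qed
  finally have "(N / (real m)\<^sup>2)\<^sup>2 * (cmod (\<Sum>k\<in>coarse m N l. z k))\<^sup>2 \<le>
      (N / (real m)\<^sup>2)\<^sup>2 * (K\<^sup>2 * (9 * (real m)\<^sup>2 * dir_energy m z))"
    by (intro mult_left_mono) auto
  also have "\<dots> = (real (N * K))\<^sup>2 * (9 * dir_energy m z) / (real m)\<^sup>2"
    using m N by (simp add: power2_eq_square field_simps)
  also have "\<dots> \<le> (real (3 * m))\<^sup>2 * (9 * dir_energy m z) / (real m)\<^sup>2"
    by (intro divide_right_mono mult_right_mono power_mono of_nat_mono K) (auto simp: dir_energy_nonneg)
  also have "\<dots> = 81 * dir_energy m z" using m N by (simp add: power2_eq_square)
  finally show ?thesis by (simp only: norm_mult power_mult_distrib norm_of_real power2_abs)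
qed

section \<open>Lattice domains and their triangulations\<close>

text \<open>Both domains are \<open>{y. a1 < p \<bullet> (y - c) < a2 \<and> b1 < q \<bullet> (y - c) < b2 \<and> g1 < (p + q) \<bullet> (y - c) < g2}\<close> with integer
  bounds, where \<open>(p, q)\<close> is dual to the basis \<open>(uu, vv)\<close> spanning the lattice; the mesh of level \<open>m\<close> is cut out
  by the level sets of \<open>p\<close>, \<open>q\<close> and \<open>p + q\<close> at the multiples of \<open>1 / m\<close>. The signs in \<open>acute\<close> say that the triangles are
  not obtuse.\<close>

locale lattice_domain =
  fixes \<Omega> :: "R2 set" and c uu vv p q :: R2 and a1 a2 b1 b2 g1 g2 :: int
  assumes dual: "inner p uu = 1" "inner p vv = 0" "inner q uu = 0" "inner q vv = 1"
    and expand: "\<And>y. y = inner p y *\<^sub>R uu + inner q y *\<^sub>R vv"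
    and acute: "inner p q \<le> 0" "inner p p + inner p q > 0" "inner q q + inner p q > 0"
    and Omega: "\<Omega> = {y. of_int a1 < inner p (y - c) \<and> inner p (y - c) < of_int a2 \<and>
       of_int b1 < inner q (y - c) \<and> inner q (y - c) < of_int b2 \<and>
       of_int g1 < inner p (y - c) + inner q (y - c) \<and> inner p (y - c) + inner q (y - c) < of_int g2}"
    and closure_Omega: "closure \<Omega> = {y. of_int a1 \<le> inner p (y - c) \<and> inner p (y - c) \<le> of_int a2 \<and>
       of_int b1 \<le> inner q (y - c) \<and> inner q (y - c) \<le> of_int b2 \<and>
       of_int g1 \<le> inner p (y - c) + inner q (y - c) \<and> inner p (y - c) + inner q (y - c) \<le> of_int g2}"
    and bounds: "- 1 \<le> a1" "a2 \<le> 1" "- 1 \<le> b1" "b2 \<le> 1"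
    and node_exists: "\<And>m::nat. m \<ge> 2 \<Longrightarrow> \<exists>i j. a1 * int m < i \<and> i < a2 * int m \<and> b1 * int m < j \<and> j < b2 * int m \<and>
       g1 * int m < i + j \<and> i + j < g2 * int m"
begin

definition sc :: "R2 \<Rightarrow> real" where "sc y = inner p (y - c)"
definition tc :: "R2 \<Rightarrow> real" where "tc y = inner q (y - c)"

definition nd :: "nat \<Rightarrow> int \<times> int \<Rightarrow> R2" where
  "nd m k = c + (of_int (fst k) / m) *\<^sub>R uu + (of_int (snd k) / m) *\<^sub>R vv"

definition nodes :: "nat \<Rightarrow> (int \<times> int) set" where
  "nodes m = {(i, j). a1 * int m < i \<and> i < a2 * int m \<and> b1 * int m < j \<and> j < b2 * int m \<and>
       g1 * int m < i + j \<and> i + j < g2 * int m}"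

definition cnodes :: "nat \<Rightarrow> (int \<times> int) set" where
  "cnodes m = {(i, j). a1 * int m \<le> i \<and> i \<le> a2 * int m \<and> b1 * int m \<le> j \<and> j \<le> b2 * int m \<and>
       g1 * int m \<le> i + j \<and> i + j \<le> g2 * int m}"

text \<open>A triangle of the mesh is encoded as \<open>(k, s)\<close>, where \<open>k\<close> is its vertex opposite to the edge of direction
  \<open>uu - vv\<close> and the sign \<open>s\<close> tells its orientation.\<close>

definition vtx :: "(int \<times> int) \<times> int \<Rightarrow> nat \<Rightarrow> int \<times> int" where
  "vtx t r = (if r = 0 then fst t else if r = 1 then fst t + (snd t, 0) else fst t + (0, snd t))"

definition tri :: "nat \<Rightarrow> (int \<times> int) \<times> int \<Rightarrow> R2 set" where
  "tri m t = {nd m (vtx t 0), nd m (vtx t 1), nd m (vtx t 2)}"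

definition tris :: "nat \<Rightarrow> ((int \<times> int) \<times> int) set" where
  "tris m = {t. snd t \<in> {1, -1} \<and> (\<forall>r<3. vtx t r \<in> cnodes m)}"

definition bary :: "nat \<Rightarrow> (int \<times> int) \<times> int \<Rightarrow> nat \<Rightarrow> R2 \<Rightarrow> real" where
  "bary m t r y = (let x1 = of_int (snd t) * (m * sc y - of_int (fst (fst t)));
       x2 = of_int (snd t) * (m * tc y - of_int (snd (fst t)))
     in if r = 0 then 1 - x1 - x2 else if r = 1 then x1 else x2)"

lemmas less3 = numeral_3_eq_3 less_Suc_eq

lemma sum3: "(\<Sum>r<3. f r) = f 0 + f 1 + f (2::nat)" for f :: "nat \<Rightarrow> 'z::comm_monoid_add"
  by (simp add: numeral_3_eq_3 numeral_2_eq_2)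

lemma all3: "(\<forall>r<3. P r) \<longleftrightarrow> P 0 \<and> P 1 \<and> P (2::nat)"
  by (auto simp: numeral_3_eq_3 numeral_2_eq_2 less_Suc_eq)

lemma sc_nd: "sc (nd m k) = of_int (fst k) / m" and tc_nd: "tc (nd m k) = of_int (snd k) / m"
  by (simp_all add: sc_def tc_def nd_def inner_diff_right inner_add_right dual)

lemma st_expand: "y = c + sc y *\<^sub>R uu + tc y *\<^sub>R vv"
  using expand[of "y - c"] by (simp add: sc_def tc_def algebra_simps)

lemma st_eqI: "sc y = sc z \<Longrightarrow> tc y = tc z \<Longrightarrow> y = z"
  by (metis st_expand)

lemma Omega_iff: "y \<in> \<Omega> \<longleftrightarrow> of_int a1 < sc y \<and> sc y < of_int a2 \<and> of_int b1 < tc y \<and> tc y < of_int b2 \<and>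
    of_int g1 < sc y + tc y \<and> sc y + tc y < of_int g2"
  by (subst Omega) (simp add: sc_def tc_def)

lemma closure_iff: "y \<in> closure \<Omega> \<longleftrightarrow> of_int a1 \<le> sc y \<and> sc y \<le> of_int a2 \<and> of_int b1 \<le> tc y \<and> tc y \<le> of_int b2 \<and>
    of_int g1 \<le> sc y + tc y \<and> sc y + tc y \<le> of_int g2"
  by (subst closure_Omega) (simp add: sc_def tc_def)

lemma nd_Omega: assumes "m > 0" shows "nd m k \<in> \<Omega> \<longleftrightarrow> k \<in> nodes m"
proof -
  have *: "real_of_int x < of_int i / real m \<longleftrightarrow> x * int m < i" "of_int i / real m < real_of_int x \<longleftrightarrow> i < x * int m" for x i
  proof -
    have m: "real m > 0" using assms by simp
    have e: "real_of_int x * real m = of_int (x * int m)" by simp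
    show "real_of_int x < of_int i / real m \<longleftrightarrow> x * int m < i" "of_int i / real m < real_of_int x \<longleftrightarrow> i < x * int m"
      unfolding pos_less_divide_eq[OF m] pos_divide_less_eq[OF m] e of_int_less_iff by (rule refl)+
  qed
  have "sc (nd m k) + tc (nd m k) = of_int (fst k + snd k) / m"
    by (simp add: sc_nd tc_nd add_divide_distrib)
  then show ?thesis
    unfolding Omega_iff by (cases k) (simp only: sc_nd tc_nd * nodes_def, simp)
qed

lemma nd_closure: assumes "m > 0" shows "nd m k \<in> closure \<Omega> \<longleftrightarrow> k \<in> cnodes m"
proof -
  have *: "real_of_int x \<le> of_int i / real m \<longleftrightarrow> x * int m \<le> i" "of_int i / real m \<le> real_of_int x \<longleftrightarrow> i \<le> x * int m" for x i
  proof -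
    have m: "real m > 0" using assms by simp
    have e: "real_of_int x * real m = of_int (x * int m)" by simp
    show "real_of_int x \<le> of_int i / real m \<longleftrightarrow> x * int m \<le> i" "of_int i / real m \<le> real_of_int x \<longleftrightarrow> i \<le> x * int m"
      unfolding pos_le_divide_eq[OF m] pos_divide_le_eq[OF m] e of_int_le_iff by (rule refl)+
  qed
  have "sc (nd m k) + tc (nd m k) = of_int (fst k + snd k) / m"
    by (simp add: sc_nd tc_nd add_divide_distrib)
  then show ?thesis
    unfolding closure_iff by (cases k) (simp only: sc_nd tc_nd * cnodes_def, simp)
qed

lemma nd_inj: "m > 0 \<Longrightarrow> nd m k = nd m k' \<longleftrightarrow> k = k'"
proof
  assume m: "m > 0" and "nd m k = nd m k'"
  then have "sc (nd m k) = sc (nd m k')" "tc (nd m k) = tc (nd m k')" by auto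
  then show "k = k'" using m by (auto simp: sc_nd tc_nd prod_eq_iff)
qed auto

lemma Omega_halfspaces: "\<Omega> = {y. inner p y > of_int a1 + inner p c} \<inter> {y. inner p y < of_int a2 + inner p c} \<inter>
    {y. inner q y > of_int b1 + inner q c} \<inter> {y. inner q y < of_int b2 + inner q c} \<inter>
    {y. inner (p + q) y > of_int g1 + inner (p + q) c} \<inter> {y. inner (p + q) y < of_int g2 + inner (p + q) c}"
  by (subst Omega) (auto simp: inner_diff_right inner_add_left algebra_simps)

lemma open_Omega: "open \<Omega>"
  by (subst Omega_halfspaces) (intro open_Int open_halfspace_gt open_halfspace_lt)

lemma convex_Omega: "convex \<Omega>"
  by (subst Omega_halfspaces) (intro convex_Int convex_halfspace_gt convex_halfspace_lt)

lemma st_bounds: "y \<in> closure \<Omega> \<Longrightarrow> \<bar>sc y\<bar> \<le> 1 \<and> \<bar>tc y\<bar> \<le> 1"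
proof -
  have "(of_int (-1)::real) \<le> of_int a1" "(of_int a2::real) \<le> of_int 1" "(of_int (-1)::real) \<le> of_int b1" "(of_int b2::real) \<le> of_int 1"
    by (simp_all only: of_int_le_iff bounds)
  then have "-1 \<le> (of_int a1::real)" "(of_int a2::real) \<le> 1" "-1 \<le> (of_int b1::real)" "(of_int b2::real) \<le> 1"
    by simp_all
  then show "y \<in> closure \<Omega> \<Longrightarrow> \<bar>sc y\<bar> \<le> 1 \<and> \<bar>tc y\<bar> \<le> 1" unfolding closure_iff by linarith
qed

lemma bounded_Omega: "bounded \<Omega>"
proof -
  have "norm y \<le> norm c + norm uu + norm vv" if "y \<in> \<Omega>" for y
  proof -
    have "norm y \<le> norm c + norm (sc y *\<^sub>R uu) + norm (tc y *\<^sub>R vv)"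
      using arg_cong[OF st_expand[of y], of norm] norm_triangle_ineq[of "c + sc y *\<^sub>R uu" "tc y *\<^sub>R vv"]
        norm_triangle_ineq[of c "sc y *\<^sub>R uu"] by linarith
    also have "\<dots> \<le> norm c + norm uu + norm vv"
      using st_bounds[of y] that closure_subset[of \<Omega>] by (auto intro!: add_mono mult_left_le_one_le)
    finally show ?thesis .
  qed
  then show ?thesis unfolding bounded_iff by blast
qed

lemma compact_closure_Omega: "compact (closure \<Omega>)"
  using bounded_Omega by (simp add: compact_closure)

lemma cnodes_bounds: "k \<in> cnodes m \<Longrightarrow> \<bar>fst k\<bar> \<le> int m \<and> \<bar>snd k\<bar> \<le> int m"
  and nodes_bounds: "k \<in> nodes m \<Longrightarrow> \<bar>fst k\<bar> < int m \<and> \<bar>snd k\<bar> < int m"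
proof -
  have *: "- int m \<le> a1 * int m" "a2 * int m \<le> int m" "- int m \<le> b1 * int m" "b2 * int m \<le> int m"
    using mult_right_mono[OF bounds(1), of "int m"] mult_right_mono[OF bounds(2), of "int m"]
      mult_right_mono[OF bounds(3), of "int m"] mult_right_mono[OF bounds(4), of "int m"] by simp_all
  obtain i j where k: "k = (i, j)" by (cases k)
  show "\<bar>fst k\<bar> \<le> int m \<and> \<bar>snd k\<bar> \<le> int m" if "k \<in> cnodes m"
  proof -
    have "a1 * int m \<le> i" "i \<le> a2 * int m" "b1 * int m \<le> j" "j \<le> b2 * int m"
      using that k by (auto simp: cnodes_def)
    then show ?thesis using * unfolding k fst_conv snd_conv abs_le_iff by linarith
  qed
  show "\<bar>fst k\<bar> < int m \<and> \<bar>snd k\<bar> < int m" if "k \<in> nodes m"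
  proof -
    have "a1 * int m < i" "i < a2 * int m" "b1 * int m < j" "j < b2 * int m"
      using that k by (auto simp: nodes_def)
    then show ?thesis using * unfolding k fst_conv snd_conv abs_less_iff by linarith
  qed
qed

lemma nodes_subset: "nodes m \<subseteq> cnodes m" by (auto simp: nodes_def cnodes_def)

lemma finite_cnodes: "finite (cnodes m)"
proof (rule finite_subset)
  show "cnodes m \<subseteq> {- int m..int m} \<times> {- int m..int m}" using cnodes_bounds by fastforce
qed auto

lemma finite_tris: "finite (tris m)"
proof (rule finite_subset)
  show "tris m \<subseteq> cnodes m \<times> {1, -1}" by (auto simp: tris_def all3 vtx_def)
qed (auto simp: finite_cnodes)

lemma tris_sign: "t \<in> tris m \<Longrightarrow> snd t = 1 \<or> snd t = -1" by (auto simp: tris_def)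

lemma vtx_cnodes: "t \<in> tris m \<Longrightarrow> r < 3 \<Longrightarrow> vtx t r \<in> cnodes m" by (auto simp: tris_def)

text \<open>An internal node satisfies the strict integer inequalities with slack one, and inside a
  triangle each of the coordinates i, j and i + j changes by at most one.\<close>

lemma tris_node:
  assumes "snd t = 1 \<or> snd t = -1" "r < 3" "vtx t r \<in> nodes m"
  shows "t \<in> tris m"
  using assms unfolding tris_def all3 nodes_def cnodes_def vtx_def
  by (cases t; cases "fst t") (auto split: if_splits)

lemma sum_bary: "(\<Sum>r<3. bary m t r y) = 1" by (simp add: sum3 bary_def Let_def)

lemma bary_expand:
  assumes m: "m > 0" and s: "snd t = 1 \<or> snd t = -1"
  shows "y = (\<Sum>r<3. bary m t r y *\<^sub>R nd m (vtx t r))"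
proof (rule st_eqI)
  have *: "sc (u0 *\<^sub>R x0 + u1 *\<^sub>R x1 + u2 *\<^sub>R x2) = u0 * sc x0 + u1 * sc x1 + u2 * sc x2"
    "tc (u0 *\<^sub>R x0 + u1 *\<^sub>R x1 + u2 *\<^sub>R x2) = u0 * tc x0 + u1 * tc x1 + u2 * tc x2"
    if "u0 = 1 - u1 - u2" for u0 u1 u2 x0 x1 x2
    unfolding that by (simp_all add: sc_def tc_def inner_diff_right inner_add_right algebra_simps)
  have "bary m t 0 y = 1 - bary m t 1 y - bary m t 2 y" by (simp add: bary_def Let_def)
  note e = *[OF this, of "nd m (vtx t 0)" "nd m (vtx t 1)" "nd m (vtx t 2)"]
  show "sc y = sc (\<Sum>r<3. bary m t r y *\<^sub>R nd m (vtx t r))"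
    using m s unfolding sum3 e sc_nd by (auto simp: bary_def Let_def vtx_def field_simps)
  show "tc y = tc (\<Sum>r<3. bary m t r y *\<^sub>R nd m (vtx t r))"
    using m s unfolding sum3 e tc_nd by (auto simp: bary_def Let_def vtx_def field_simps)
qed

lemma bary_affine:
  "bary m t r (u *\<^sub>R x + v *\<^sub>R y) = u * bary m t r x + v * bary m t r y" if "u + v = 1"
proof -
  have *: "sc (u *\<^sub>R x + v *\<^sub>R y) = u * sc x + v * sc y" "tc (u *\<^sub>R x + v *\<^sub>R y) = u * tc x + v * tc y"
    using that by (simp_all add: sc_def tc_def inner_diff_right inner_add_right algebra_simps)
      (metis distrib_right mult_1)+
  have "v = 1 - u" using that by simp
  then show ?thesis unfolding bary_def Let_def * unfolding \<open>v = 1 - u\<close> by (simp add: algebra_simps)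
qed

lemma bary_vtx:
  assumes m: "m > 0" and s: "snd t = 1 \<or> snd t = -1" and r: "r < 3" "r' < 3"
  shows "bary m t r (nd m (vtx t r')) = (if r = r' then 1 else 0)"
  using assms by (auto simp: bary_def Let_def sc_nd tc_nd vtx_def less3)

lemma hull_iff:
  assumes m: "m > 0" and s: "snd t = 1 \<or> snd t = -1"
  shows "y \<in> convex hull (tri m t) \<longleftrightarrow> (\<forall>r<3. 0 \<le> bary m t r y)"
proof
  assume "y \<in> convex hull (tri m t)"
  moreover have "convex {y. \<forall>r<3. 0 \<le> bary m t r y}"
    by (rule convexI) (auto simp: bary_affine)
  moreover have "tri m t \<subseteq> {y. \<forall>r<3. 0 \<le> bary m t r y}"
    using bary_vtx[OF m s] by (auto simp: tri_def)
  ultimately show "\<forall>r<3. 0 \<le> bary m t r y" using hull_minimal[of "tri m t" _ convex] by blast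
next
  assume "\<forall>r<3. 0 \<le> bary m t r y"
  then have "(\<Sum>r<3. bary m t r y *\<^sub>R nd m (vtx t r)) \<in> convex hull (tri m t)"
    using sum_bary[of m t y]
    by (intro convex_sum) (auto simp: convex_convex_hull tri_def less3 numeral_2_eq_2 intro!: hull_inc)
  then show "y \<in> convex hull (tri m t)" using bary_expand[OF m s, of y] by simp
qed

lemma hull_subset_closure:
  assumes m: "m > 0" and s: "snd t = 1 \<or> snd t = -1"
  shows "convex hull (tri m t) \<subseteq> closure \<Omega> \<longleftrightarrow> t \<in> tris m"
proof -
  have "convex hull (tri m t) \<subseteq> closure \<Omega> \<longleftrightarrow> tri m t \<subseteq> closure \<Omega>"
    using convex_closure[OF convex_Omega] by (metis hull_minimal hull_subset subset_trans)
  also have "\<dots> \<longleftrightarrow> t \<in> tris m"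
    using s by (auto simp: tri_def nd_closure[OF m] tris_def all3)
  finally show ?thesis .
qed

text \<open>The two shapes in \<open>lattice_mesh\<close> are the triangle of sign 1 with corner p
  and the triangle of sign -1 with the opposite corner p + u + v of the same parallelogram.\<close>

lemma mesh_eq:
  assumes m: "m > 0"
  shows "lattice_mesh \<Omega> c ((1 / real m) *\<^sub>R uu) ((1 / real m) *\<^sub>R vv) = tri m ` tris m"
proof -
  have up: "tri m ((i, j), 1) = {nd m (i, j), nd m (i, j) + (1 / real m) *\<^sub>R uu, nd m (i, j) + (1 / real m) *\<^sub>R vv}" for i j
    by (auto simp: tri_def vtx_def nd_def add_divide_distrib scaleR_add_left algebra_simps)
  have dn: "tri m ((i + 1, j + 1), - 1) = {nd m (i, j) + (1 / real m) *\<^sub>R uu, nd m (i, j) + (1 / real m) *\<^sub>R vv,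
      nd m (i, j) + (1 / real m) *\<^sub>R uu + (1 / real m) *\<^sub>R vv}" for i j
    by (auto simp: tri_def vtx_def nd_def add_divide_distrib scaleR_add_left algebra_simps)
  have nd: "c + of_int i *\<^sub>R (1 / real m) *\<^sub>R uu + of_int j *\<^sub>R (1 / real m) *\<^sub>R vv = nd m (i, j)" for i j
    by (simp add: nd_def)
  have "S \<in> lattice_mesh \<Omega> c ((1 / real m) *\<^sub>R uu) ((1 / real m) *\<^sub>R vv) \<longleftrightarrow>
      (\<exists>i j. S = tri m ((i, j), 1) \<or> S = tri m ((i + 1, j + 1), - 1)) \<and> convex hull S \<subseteq> closure \<Omega>" for S
    unfolding lattice_mesh_def nd up dn by auto
  also have "\<dots> S \<longleftrightarrow> S \<in> tri m ` tris m" for S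
  proof
    assume A: "(\<exists>i j. S = tri m ((i, j), 1) \<or> S = tri m ((i + 1, j + 1), - 1)) \<and> convex hull S \<subseteq> closure \<Omega>"
    then obtain t where "S = tri m t" "snd t = 1 \<or> snd t = -1" by auto
    then show "S \<in> tri m ` tris m" using A hull_subset_closure[OF m, of t] by auto
  next
    assume "S \<in> tri m ` tris m"
    then obtain t where t: "t \<in> tris m" "S = tri m t" by auto
    moreover have "\<exists>i j. t = ((i, j), 1) \<or> t = ((i + 1, j + 1), - 1)"
      using tris_sign[OF t(1)]
      by (metis diff_add_cancel prod.collapse)
    ultimately show "(\<exists>i j. S = tri m ((i, j), 1) \<or> S = tri m ((i + 1, j + 1), - 1)) \<and> convex hull S \<subseteq> closure \<Omega>"
      using hull_subset_closure[OF m tris_sign] by blast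
  qed
  finally show ?thesis by blast
qed

definition cen :: "R2 set \<Rightarrow> R2" where "cen S = (1 / 3) *\<^sub>R \<Sum>S"

lemma cen_tri:
  assumes m: "m > 0" and s: "snd t = 1 \<or> snd t = -1"
  shows "cen (tri m t) = (1 / 3) *\<^sub>R (nd m (vtx t 0) + nd m (vtx t 1) + nd m (vtx t 2))"
proof -
  have "vtx t 0 \<noteq> vtx t 1" "vtx t 0 \<noteq> vtx t 2" "vtx t 1 \<noteq> vtx t 2"
    using s by (auto simp: vtx_def prod_eq_iff)
  then show ?thesis unfolding cen_def tri_def by (simp add: nd_inj[OF m] add.assoc)
qed

lemma bary_cen:
  assumes m: "m > 0" and s: "snd t = 1 \<or> snd t = -1" and r: "r < 3"
  shows "bary m t r (cen (tri m t)) = 1 / 3"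
proof -
  have "cen (tri m t) = (2 / 3) *\<^sub>R ((1 / 2) *\<^sub>R nd m (vtx t 0) + (1 / 2) *\<^sub>R nd m (vtx t 1)) + (1 / 3) *\<^sub>R nd m (vtx t 2)"
    unfolding cen_tri[OF m s] by (simp add: scaleR_add_right)
  also have "bary m t r \<dots> = (2 / 3) * ((1 / 2) * bary m t r (nd m (vtx t 0)) + (1 / 2) * bary m t r (nd m (vtx t 1))) +
      (1 / 3) * bary m t r (nd m (vtx t 2))"
    by (subst bary_affine, simp, subst bary_affine, simp_all)
  also have "\<dots> = 1 / 3" using r by (auto simp: bary_vtx[OF m s] less3)
  finally show ?thesis .
qed

text \<open>The centroid determines the code: its scaled coordinates are an integer plus or minus
  1/3, which reveals the sign, and then the corner. Sums over triangles as sets can thus be read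
  over codes.\<close>

lemma inj_tri: assumes m: "m > 0" shows "inj_on (tri m) (tris m)"
proof (rule inj_onI)
  fix t t' assume t: "t \<in> tris m" "t' \<in> tris m" "tri m t = tri m t'"
  have "bary m t 1 (cen (tri m t)) = 1 / 3" "bary m t' 1 (cen (tri m t)) = 1 / 3"
    "bary m t 2 (cen (tri m t)) = 1 / 3" "bary m t' 2 (cen (tri m t)) = 1 / 3"
    using bary_cen[OF m tris_sign[OF t(1)]] bary_cen[OF m tris_sign[OF t(2)]] by (simp_all add: t(3))
  then have e: "of_int (snd t) * (X - of_int (fst (fst t))) = 1 / 3" "of_int (snd t') * (X - of_int (fst (fst t'))) = 1 / 3"
    "of_int (snd t) * (W - of_int (snd (fst t))) = 1 / 3" "of_int (snd t') * (W - of_int (snd (fst t'))) = 1 / 3"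
    if "X = m * sc (cen (tri m t))" "W = m * tc (cen (tri m t))" for X W :: real
    using that by (simp_all add: bary_def Let_def)
  have h: "i = i' \<and> s = s'" if "of_int s * (Y - of_int i) = (1 / 3 :: real)" "of_int s' * (Y - of_int i') = (1 / 3 :: real)"
    "s = 1 \<or> s = -1" "s' = 1 \<or> s' = -1" for i i' s s' :: int and Y
  proof -
    have "Y = of_int i + of_int s / 3" "Y = of_int i' + of_int s' / 3"
      using that by auto
    then have "real_of_int (3 * (i - i')) = of_int (s' - s)" by simp
    then have "3 * (i - i') = s' - s" by (simp only: of_int_eq_iff)
    then show ?thesis using that(3,4) by presburger
  qed
  show "t = t'"
    using h[OF e(1,2)[OF refl refl] tris_sign[OF t(1)] tris_sign[OF t(2)]]
      h[OF e(3,4)[OF refl refl] tris_sign[OF t(1)] tris_sign[OF t(2)]]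
    by (simp add: prod_eq_iff)
qed

lemma tri_nodes_internal:
  assumes m: "m > 0"
  shows "internal_nodes \<Omega> (tri m ` tris m) = nd m ` nodes m"
proof -
  have "nd m k \<in> \<Union> (tri m ` tris m)" if "k \<in> nodes m" for k
  proof -
    have "(k, 1) \<in> tris m" by (rule tris_node[of _ 0]) (use that in \<open>auto simp: vtx_def\<close>)
    moreover have "nd m k \<in> tri m (k, 1)" by (simp add: tri_def vtx_def)
    ultimately show ?thesis by blast
  qed
  then show ?thesis unfolding internal_nodes_def
    by (auto simp: tri_def nd_Omega[OF m])
qed

section \<open>The null set of mesh lines\<close>

definition grid :: "nat \<Rightarrow> R2 set" where
  "grid m = {y. m * sc y \<in> \<int> \<or> m * tc y \<in> \<int> \<or> m * sc y + m * tc y \<in> \<int>}"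

lemma negligible_grid: assumes m: "m > 0" shows "negligible (grid m)"
proof -
  have pq: "p \<noteq> 0" "q \<noteq> 0" "p + q \<noteq> 0"
    using dual by (metis inner_zero_left zero_neq_one, metis inner_zero_left zero_neq_one,
      metis add.right_neutral inner_add_left inner_zero_left zero_neq_one)
  have "grid m = (\<Union>i::int. {y. inner p y = of_int i / m + inner p c}) \<union> (\<Union>i::int. {y. inner q y = of_int i / m + inner q c})
     \<union> (\<Union>i::int. {y. inner (p + q) y = of_int i / m + inner (p + q) c})"
  proof -
    have "m * inner w (y - c) \<in> \<int> \<longleftrightarrow> (\<exists>i::int. inner w y = of_int i / m + inner w c)" for w y
    proof -
      have "m * inner w (y - c) \<in> \<int> \<longleftrightarrow> (\<exists>i::int. m * inner w (y - c) = of_int i)" by (auto elim: Ints_cases)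
      also have "\<dots> \<longleftrightarrow> (\<exists>i::int. inner w (y - c) = of_int i / m)"
        using m by (simp add: eq_divide_eq mult.commute)
      also have "\<dots> \<longleftrightarrow> (\<exists>i::int. inner w y = of_int i / m + inner w c)"
        by (simp add: inner_diff_right diff_eq_eq)
      finally show ?thesis .
    qed
    from this[of p] this[of q] this[of "p + q"] show ?thesis
      unfolding grid_def sc_def tc_def by (auto simp: inner_add_left distrib_left)
  qed
  then show ?thesis
    using pq by (auto intro!: negligible_Un negligible_countable_Union negligible_hyperplane)
qed

text \<open>Integer parts locate the lattice parallelogram, and comparing X + W with i + j + 1 picks
  one of its two triangles. The bounds of the domain pass to that triangle since they are
  integers.\<close>

lemma off_grid_cover:
  assumes m: "m > 0" and y: "y \<in> closure \<Omega>" "y \<notin> grid m"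
  shows "\<exists>t\<in>tris m. y \<in> convex hull (tri m t)"
proof -
  define X where "X = m * sc y"
  define W where "W = m * tc y"
  have ni: "X \<notin> \<int>" "W \<notin> \<int>" "X + W \<notin> \<int>" using y(2) by (auto simp: grid_def X_def W_def)
  have m0: "real m > 0" using m by simp
  have B: "of_int (a1 * int m) \<le> X" "X \<le> of_int (a2 * int m)" "of_int (b1 * int m) \<le> W" "W \<le> of_int (b2 * int m)"
    "of_int (g1 * int m) \<le> X + W" "X + W \<le> of_int (g2 * int m)"
    using y(1) m0 unfolding closure_iff X_def W_def
    by (simp_all add: mult.commute flip: distrib_left)
  have fr: "of_int (floor x) < x" "x < of_int (floor x) + 1" if "x \<notin> \<int>" for x :: real
    using that floor_correct[of x] by (metis Ints_of_int order_le_less, linarith)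
  define i where "i = floor X"
  define j where "j = floor W"
  note f = fr[OF ni(1), folded i_def] fr[OF ni(2), folded j_def]
  have h: "a \<le> b" if "real_of_int a < of_int b + 1" for a b :: int
    using that of_int_less_iff[of a "b + 1", where 'a=real] by simp
  have i: "a1 * int m \<le> i" "i + 1 \<le> a2 * int m" "b1 * int m \<le> j" "j + 1 \<le> b2 * int m"
    using B f by (auto intro!: h simp del: of_int_mult)
  have ne: "X + W \<noteq> of_int (i + j + 1)" using ni(3) by (metis Ints_of_int)
  show ?thesis
  proof (cases "X + W < of_int (i + j + 1)")
    case True
    have "g1 * int m \<le> i + j" "i + j + 1 \<le> g2 * int m"
      using B f True by (auto intro!: h simp del: of_int_mult)
    then have t: "((i, j), 1) \<in> tris m" using i by (auto simp: tris_def all3 vtx_def cnodes_def)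
    moreover have "y \<in> convex hull (tri m ((i, j), 1))"
      unfolding hull_iff[OF m tris_sign[OF t]] all3 bary_def Let_def X_def[symmetric] W_def[symmetric]
      using f True by auto
    ultimately show ?thesis by blast
  next
    case False
    then have gt: "X + W > of_int (i + j + 1)" using ne by simp
    have "g1 * int m \<le> i + j + 1" "i + j + 2 \<le> g2 * int m"
      using B f gt by (auto intro!: h simp del: of_int_mult)
    then have t: "((i + 1, j + 1), - 1) \<in> tris m" using i by (auto simp: tris_def all3 vtx_def cnodes_def)
    moreover have "y \<in> convex hull (tri m ((i + 1, j + 1), - 1))"
      unfolding hull_iff[OF m tris_sign[OF t]] all3 bary_def Let_def X_def[symmetric] W_def[symmetric]
      using f gt by auto
    ultimately show ?thesis by blast
  qed
qed

lemma off_grid_bary_pos: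
  assumes m: "m > 0" and s: "snd t = 1 \<or> snd t = -1" and y: "y \<in> convex hull (tri m t)" "y \<notin> grid m" and r: "r < 3"
  shows "bary m t r y > 0"
proof -
  have ni: "m * sc y \<noteq> of_int i" "m * tc y \<noteq> of_int i" "m * sc y + m * tc y \<noteq> of_int i" for i
    using y(2) unfolding grid_def by (auto simp: Ints_def)
  have "bary m t r y \<noteq> 0"
    using s ni(1)[of "fst (fst t)"] ni(2)[of "snd (fst t)"] ni(3)[of "fst (fst t) + snd (fst t) + snd t"]
    by (auto simp: bary_def Let_def)
  then show ?thesis using y(1) r unfolding hull_iff[OF m s] by (metis order_le_less)
qed

text \<open>Positive barycentric coordinates give strict inequalities between integers: equal
  orientations force equal corners, opposite ones are contradictory.\<close>

lemma off_grid_unique: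
  assumes m: "m > 0" and t: "t \<in> tris m" "t' \<in> tris m"
    and y: "y \<in> convex hull (tri m t)" "y \<in> convex hull (tri m t')" "y \<notin> grid m"
  shows "t = t'"
proof -
  note P = off_grid_bary_pos[OF m tris_sign[OF t(1)] y(1,3)] off_grid_bary_pos[OF m tris_sign[OF t(2)] y(2,3)]
  have "0 < bary m t 0 y" "0 < bary m t 1 y" "0 < bary m t 2 y"
    "0 < bary m t' 0 y" "0 < bary m t' 1 y" "0 < bary m t' 2 y" using P by auto
  then have e: "0 < of_int (snd t) * (X - of_int (fst (fst t)))" "0 < of_int (snd t') * (X - of_int (fst (fst t')))"
    "0 < of_int (snd t) * (W - of_int (snd (fst t)))" "0 < of_int (snd t') * (W - of_int (snd (fst t')))"
    "of_int (snd t) * (X - of_int (fst (fst t))) + of_int (snd t) * (W - of_int (snd (fst t))) < 1"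
    "of_int (snd t') * (X - of_int (fst (fst t'))) + of_int (snd t') * (W - of_int (snd (fst t'))) < 1"
    if "X = m * sc y" "W = m * tc y" for X W :: real
    using that by (simp_all add: bary_def Let_def)
  have h: "s = s' \<and> i = i' \<and> j = j'"
    if "0 < of_int s * (X - of_int i)" "0 < of_int s' * (X - of_int i')"
    "0 < of_int s * (W - of_int j)" "0 < of_int s' * (W - of_int j')"
    "of_int s * (X - of_int i) + of_int s * (W - of_int j) < 1"
    "of_int s' * (X - of_int i') + of_int s' * (W - of_int j') < 1"
    "s = 1 \<or> s = -1" "s' = 1 \<or> s' = -1" for i i' j j' s s' :: int and X W :: real
  proof -
    have l: "a < b" if "real_of_int a < of_int b" for a b :: int using that by (simp only: of_int_less_iff)
    show ?thesis
      using that(7)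
    proof
      assume s: "s = 1"
      show ?thesis using that(8)
      proof
        assume s': "s' = 1"
        have "i < i' + 1" "i' < i + 1" "j < j' + 1" "j' < j + 1"
          using that(1-6) s s' by (auto intro!: l)
        then show ?thesis using s s' by simp
      next
        assume s': "s' = -1"
        have "i < i'" "j < j'" "i' + j' - 1 < i + j + 1"
          using that(1-6) s s' by (auto intro!: l)
        then show ?thesis by simp
      qed
    next
      assume s: "s = -1"
      show ?thesis using that(8)
      proof
        assume s': "s' = 1"
        have "i' < i" "j' < j" "i + j - 1 < i' + j' + 1"
          using that(1-6) s s' by (auto intro!: l)
        then show ?thesis by simp
      next
        assume s': "s' = -1"
        have "i < i' + 1" "i' < i + 1" "j < j' + 1" "j' < j + 1"
          using that(1-6) s s' by (auto intro!: l)
        then show ?thesis using s s' by simp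
      qed
    qed
  qed
  show ?thesis
    using h[OF e[OF refl refl] tris_sign[OF t(1)] tris_sign[OF t(2)]] by (simp add: prod_eq_iff)
qed

end

section \<open>Basis functions\<close>

text \<open>\<open>(d1, d2)\<close> is the offset of the corner of a triangle from a node,
  \<open>(x, w)\<close> the position in the triangle. All offsets but the three listed keep the
  point at hexagonal distance at least 1 from the node.\<close>

lemma hat_reference:
  fixes d1 d2 :: int and x w :: real
  assumes "0 \<le> x" "0 \<le> w" "x + w \<le> 1"
  shows "max 0 (1 - max \<bar>of_int d1 + x\<bar> (max \<bar>of_int d2 + w\<bar> \<bar>of_int d1 + x + (of_int d2 + w)\<bar>)) =
    (if d1 = 0 \<and> d2 = 0 then 1 - x - w else if d1 = -1 \<and> d2 = 0 then x else if d1 = 0 \<and> d2 = -1 then w else 0)"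
proof -
  have zero: "max 0 (1 - max a (max b e)) = 0" if "1 \<le> a \<or> 1 \<le> b \<or> 1 \<le> e" for a b e :: real
    using that by linarith
  have big: "1 \<le> \<bar>of_int d + y\<bar>" if "d \<ge> 1 \<or> d \<le> -2" "0 \<le> y" "y \<le> 1" for d :: int and y :: real
  proof -
    have "(1::real) \<le> of_int d \<or> of_int d \<le> (-2::real)" using that(1) by auto
    then show ?thesis using that by linarith
  qed
  consider "d1 \<ge> 1 \<or> d1 \<le> -2" | "d2 \<ge> 1 \<or> d2 \<le> -2" | "d1 = 0" "d2 = 0" | "d1 = -1" "d2 = 0" | "d1 = 0" "d2 = -1"
    | "d1 = -1" "d2 = -1" by linarith
  then show ?thesis
  proof cases
    case 1
    then show ?thesis using big[OF 1, of x] assms by (subst zero) auto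
  next
    case 2
    then show ?thesis using big[OF 2, of w] assms by (subst zero) auto
  next
    case 6
    then show ?thesis using assms by (subst zero) auto
  qed (use assms in \<open>auto simp: max_def abs_if\<close>)
qed

context lattice_domain
begin

text \<open>One minus the norm whose unit ball is the hexagon of the six triangles around the node,
  cut off at zero. This global formula gives continuity and a Lipschitz bound on the whole
  plane.\<close>

definition phi :: "nat \<Rightarrow> int \<times> int \<Rightarrow> R2 \<Rightarrow> real" where
  "phi m k y = max 0 (1 - max \<bar>m * sc y - of_int (fst k)\<bar> (max \<bar>m * tc y - of_int (snd k)\<bar>
     \<bar>m * sc y - of_int (fst k) + (m * tc y - of_int (snd k))\<bar>))"

text \<open>Triangles of sign -1 reduce to the reference case by the central symmetry of the
  hexagonal norm.\<close>

lemma phi_tri: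
  assumes m: "m > 0" and s: "snd t = 1 \<or> snd t = -1" and y: "y \<in> convex hull (tri m t)"
  shows "phi m k y = (\<Sum>r<3. bary m t r y * of_bool (vtx t r = k))"
proof -
  obtain i j e where t: "t = ((i, j), e)" by (metis prod.collapse)
  obtain k1 k2 where k: "k = (k1, k2)" by (metis prod.collapse)
  define x where "x = bary m t 1 y"
  define w where "w = bary m t 2 y"
  have b: "0 \<le> x" "0 \<le> w" "x + w \<le> 1" "bary m t 0 y = 1 - x - w"
    using y unfolding hull_iff[OF m s] all3 by (auto simp: x_def w_def bary_def Let_def)
  have st: "m * sc y = of_int i + of_int e * x" "m * tc y = of_int j + of_int e * w"
    using s by (auto simp: t x_def w_def bary_def Let_def)
  have "(\<Sum>r<3. bary m t r y * of_bool (vtx t r = k)) =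
      (1 - x - w) * of_bool (k = (i, j)) + x * of_bool (k = (i + e, j)) + w * of_bool (k = (i, j + e))"
    unfolding sum3 b(4) x_def[symmetric] w_def[symmetric] by (auto simp: vtx_def t)
  also have "\<dots> = phi m k y"
  proof (cases "e = 1")
    case True
    have "phi m k y = max 0 (1 - max \<bar>of_int (i - k1) + x\<bar> (max \<bar>of_int (j - k2) + w\<bar> \<bar>of_int (i - k1) + x + (of_int (j - k2) + w)\<bar>))"
      unfolding phi_def st k True by (simp add: algebra_simps)
    also have "\<dots> = (1 - x - w) * of_bool (k = (i, j)) + x * of_bool (k = (i + e, j)) + w * of_bool (k = (i, j + e))"
      unfolding hat_reference[OF b(1-3)] using True k by auto
    finally show ?thesis by simp
  next
    case False
    then have e: "e = -1" using s t by auto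
    have "phi m k y = max 0 (1 - max \<bar>- (of_int (k1 - i) + x)\<bar> (max \<bar>- (of_int (k2 - j) + w)\<bar> \<bar>- (of_int (k1 - i) + x + (of_int (k2 - j) + w))\<bar>))"
      unfolding phi_def st k e by (simp add: algebra_simps)
    also have "\<dots> = (1 - x - w) * of_bool (k = (i, j)) + x * of_bool (k = (i + e, j)) + w * of_bool (k = (i, j + e))"
      unfolding abs_minus_cancel hat_reference[OF b(1-3)] using e k by auto
    finally show ?thesis by simp
  qed
  finally show ?thesis by simp
qed

lemma phi_lipschitz: "\<bar>phi m k y - phi m k z\<bar> \<le> m * (norm p + norm q) * norm (y - z)"
proof -
  have mx: "\<bar>max a b - max a' b'\<bar> \<le> e" if "\<bar>a - a'\<bar> \<le> e" "\<bar>b - b'\<bar> \<le> e" for a b a' b' e :: real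
    using that by linarith
  define e where "e = \<bar>m * sc y - m * sc z\<bar> + \<bar>m * tc y - m * tc z\<bar>"
  have t1: "\<bar>\<bar>u - k\<bar> - \<bar>v - k\<bar>\<bar> \<le> \<bar>u - v\<bar> + \<bar>x - w\<bar>" "\<bar>\<bar>x - k\<bar> - \<bar>w - k\<bar>\<bar> \<le> \<bar>u - v\<bar> + \<bar>x - w\<bar>"
    "\<bar>\<bar>u - k + (x - l)\<bar> - \<bar>v - k + (w - l)\<bar>\<bar> \<le> \<bar>u - v\<bar> + \<bar>x - w\<bar>" for u v x w k l :: real
  proof -
    show "\<bar>\<bar>u - k\<bar> - \<bar>v - k\<bar>\<bar> \<le> \<bar>u - v\<bar> + \<bar>x - w\<bar>" "\<bar>\<bar>x - k\<bar> - \<bar>w - k\<bar>\<bar> \<le> \<bar>u - v\<bar> + \<bar>x - w\<bar>"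
      by (rule order_trans[OF abs_triangle_ineq3], simp)+
    have e: "u - k + (x - l) - (v - k + (w - l)) = (u - v) + (x - w)" by simp
    show "\<bar>\<bar>u - k + (x - l)\<bar> - \<bar>v - k + (w - l)\<bar>\<bar> \<le> \<bar>u - v\<bar> + \<bar>x - w\<bar>"
      by (rule order_trans[OF abs_triangle_ineq3]) (unfold e, rule abs_triangle_ineq)
  qed
  have m1: "\<bar>max 0 (1 - a) - max 0 (1 - b)\<bar> \<le> d" if "\<bar>a - b\<bar> \<le> d" for a b d :: real
    using that by linarith
  have "\<bar>phi m k y - phi m k z\<bar> \<le> e"
    unfolding phi_def e_def by (intro m1 mx t1)
  also have "e = m * \<bar>inner p (y - z)\<bar> + m * \<bar>inner q (y - z)\<bar>"
    by (simp add: e_def sc_def tc_def inner_diff_right abs_mult flip: right_diff_distrib)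
  also have "\<dots> \<le> m * (norm p * norm (y - z)) + m * (norm q * norm (y - z))"
    by (intro add_mono mult_left_mono Cauchy_Schwarz_ineq2) auto
  finally show ?thesis by (simp add: algebra_simps)
qed

lemma phi_continuous: "continuous_on A (phi m k)"
proof (rule lipschitz_on_continuous_on)
  show "(m * (norm p + norm q))-lipschitz_on A (phi m k)"
    by (rule lipschitz_onI) (use phi_lipschitz in \<open>auto simp: dist_norm\<close>)
qed

text \<open>At an internal node the integer bounds hold with slack one, so a point violating one of
  them is at distance at least 1 in the corresponding coordinate.\<close>

lemma phi_outside:
  assumes m: "m > 0" and k: "k \<in> nodes m" and y: "y \<notin> \<Omega>"
  shows "phi m k y = 0"
proof -
  obtain i j where ij: "k = (i, j)" by (cases k)
  have int: "a1 * int m + 1 \<le> i" "i + 1 \<le> a2 * int m" "b1 * int m + 1 \<le> j" "j + 1 \<le> b2 * int m"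
    "g1 * int m + 1 \<le> i + j" "i + j + 1 \<le> g2 * int m"
    using k ij by (auto simp: nodes_def)
  have r: "of_int a1 * real m + 1 \<le> of_int i" "real_of_int i + 1 \<le> of_int a2 * real m"
    "of_int b1 * real m + 1 \<le> of_int j" "real_of_int j + 1 \<le> of_int b2 * real m"
    "of_int g1 * real m + 1 \<le> of_int i + of_int j" "real_of_int i + of_int j + 1 \<le> of_int g2 * real m"
    using int[THEN of_int_le_iff[where 'a=real, THEN iffD2]] by simp_all
  have mm: "m * x \<le> real_of_int a * real m" if "x \<le> of_int a" for x :: real and a :: int
    using that m by (simp add: mult.commute)
  have mm': "real_of_int a * real m \<le> m * x" if "of_int a \<le> x" for x :: real and a :: int
    using that m by (simp add: mult.commute)
  have "sc y \<le> of_int a1 \<or> of_int a2 \<le> sc y \<or> tc y \<le> of_int b1 \<or> of_int b2 \<le> tc y \<or>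
      sc y + tc y \<le> of_int g1 \<or> of_int g2 \<le> sc y + tc y"
    using y unfolding Omega_iff by linarith
  then have "m * sc y \<le> real_of_int a1 * real m \<or> real_of_int a2 * real m \<le> m * sc y \<or>
      m * tc y \<le> real_of_int b1 * real m \<or> real_of_int b2 * real m \<le> m * tc y \<or>
      m * (sc y + tc y) \<le> real_of_int g1 * real m \<or> real_of_int g2 * real m \<le> m * (sc y + tc y)"
    using mm mm' by blast
  then have "1 \<le> \<bar>m * sc y - of_int i\<bar> \<or> 1 \<le> \<bar>m * tc y - of_int j\<bar> \<or> 1 \<le> \<bar>m * sc y - of_int i + (m * tc y - of_int j)\<bar>"
    unfolding distrib_left using r by linarith
  then show ?thesis unfolding phi_def ij by auto
qed

lemma phi_node: assumes m: "m > 0" shows "phi m k (nd m k') = of_bool (k = k')"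
proof -
  have e: "m * sc (nd m k') = of_int (fst k')" "m * tc (nd m k') = of_int (snd k')"
    using m by (simp_all add: sc_nd tc_nd)
  have "1 \<le> \<bar>real_of_int (fst k') - of_int (fst k)\<bar> \<or> 1 \<le> \<bar>real_of_int (snd k') - of_int (snd k)\<bar>" if "k \<noteq> k'"
  proof -
    have "1 \<le> \<bar>fst k' - fst k\<bar> \<or> 1 \<le> \<bar>snd k' - snd k\<bar>" using that by (auto simp: prod_eq_iff)
    then show ?thesis by (metis of_int_1_le_iff of_int_abs of_int_diff)
  qed
  then show ?thesis unfolding phi_def e by auto
qed

definition gb :: "nat \<Rightarrow> (int \<times> int) \<times> int \<Rightarrow> nat \<Rightarrow> R2" where
  "gb m t r = (of_int (snd t) * real m) *\<^sub>R (if r = 0 then - p - q else if r = 1 then p else q)"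

lemma bary_inner: "bary m t r y - bary m t r z = inner (gb m t r) (y - z)"
  by (simp add: bary_def Let_def gb_def sc_def tc_def inner_diff_right inner_diff_left algebra_simps)

text \<open>\<open>gr m t k\<close> is the gradient on the triangle \<open>t\<close> of the basis function of the node \<open>k\<close>.\<close>

definition gr :: "nat \<Rightarrow> (int \<times> int) \<times> int \<Rightarrow> int \<times> int \<Rightarrow> R2" where
  "gr m t k = (\<Sum>r<3. of_bool (vtx t r = k) *\<^sub>R gb m t r)"

lemma frontier_Omega: "frontier \<Omega> = closure \<Omega> - \<Omega>"
  using open_Omega by (simp add: frontier_def interior_open)

lemma combo_inner:
  "(\<Sum>r<3. bary m t r y * u r) = inner (\<Sum>r<3. u r *\<^sub>R gb m t r) y + (\<Sum>r<3. bary m t r 0 * u r)"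
proof -
  define d where "d r = bary m t r 0" for r
  have "bary m t r y = inner (gb m t r) y + d r" for r
    using bary_inner[of m t r y 0] unfolding d_def diff_zero by linarith
  then have "bary m t r y * u r = inner (u r *\<^sub>R gb m t r) y + d r * u r" for r
    by (simp add: algebra_simps)
  then show ?thesis by (simp add: sum.distrib inner_sum_left flip: d_def)
qed

lemma phi_FE_space:
  assumes m: "m > 0" and k: "k \<in> nodes m"
  shows "phi m k \<in> FE_space \<Omega> (tri m ` tris m)"
proof -
  have "phi m k y = inner (\<Sum>r<3. of_bool (vtx t r = k) *\<^sub>R gb m t r) y + (\<Sum>r<3. bary m t r 0 * of_bool (vtx t r = k))"
    if "t \<in> tris m" "y \<in> convex hull (tri m t)" for t y
    by (rule trans[OF phi_tri[OF m tris_sign[OF that(1)] that(2)] combo_inner])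
  then have "\<exists>g d. \<forall>y\<in>convex hull (tri m t). phi m k y = inner g y + d" if "t \<in> tris m" for t
    using that by blast
  then show ?thesis unfolding FE_space_def frontier_Omega
    using phi_continuous phi_outside[OF m k] by auto
qed

abbreviation hatf :: "nat \<Rightarrow> int \<times> int \<Rightarrow> R2 \<Rightarrow> real" where
  "hatf m k \<equiv> hat \<Omega> (tri m ` tris m) (nd m k)"

text \<open>\<open>phi\<close> witnesses that the choice made in \<open>hat\<close> is
  possible.\<close>

lemma hatf_props:
  assumes m: "m > 0" and k: "k \<in> nodes m"
  shows "hatf m k \<in> FE_space \<Omega> (tri m ` tris m)" "\<And>k'. k' \<in> nodes m \<Longrightarrow> hatf m k (nd m k') = of_bool (k' = k)"
proof -
  have "\<exists>v. v \<in> FE_space \<Omega> (tri m ` tris m) \<and>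
     (\<forall>q\<in>internal_nodes \<Omega> (tri m ` tris m). v q = (if q = nd m k then 1 else 0))"
    using phi_FE_space[OF m k] phi_node[OF m, of k]
    by (intro exI[of _ "phi m k"]) (auto simp: tri_nodes_internal[OF m] nd_inj[OF m])
  from someI_ex[OF this]
  have *: "hatf m k \<in> FE_space \<Omega> (tri m ` tris m) \<and>
     (\<forall>q\<in>internal_nodes \<Omega> (tri m ` tris m). hatf m k q = (if q = nd m k then 1 else 0))"
    unfolding hat_def .
  then show "hatf m k \<in> FE_space \<Omega> (tri m ` tris m)" by blast
  show "hatf m k (nd m k') = of_bool (k' = k)" if "k' \<in> nodes m" for k'
    using * that by (auto simp: tri_nodes_internal[OF m] nd_inj[OF m])
qed

text \<open>\<open>hat\<close> is a mere choice, but on a closed triangle it is affine with known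
  vertex values: a mesh vertex that is not an internal node lies on the frontier, where the
  functions of the space vanish.\<close>

lemma hatf_tri:
  assumes m: "m > 0" and k: "k \<in> nodes m" and t: "t \<in> tris m" and y: "y \<in> convex hull (tri m t)"
  shows "hatf m k y = (\<Sum>r<3. bary m t r y * of_bool (vtx t r = k))"
proof -
  note s = tris_sign[OF t]
  have FE: "hatf m k \<in> FE_space \<Omega> (tri m ` tris m)" by (rule hatf_props[OF m k])
  then obtain g d where gd: "\<And>z. z \<in> convex hull (tri m t) \<Longrightarrow> hatf m k z = inner g z + d"
    unfolding FE_space_def using t by blast
  have v: "hatf m k (nd m (vtx t r)) = of_bool (vtx t r = k)" if r: "r < 3" for r
  proof (cases "vtx t r \<in> nodes m")
    case True
    then show ?thesis using hatf_props(2)[OF m k] by simp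
  next
    case False
    then have "nd m (vtx t r) \<in> frontier \<Omega>"
      unfolding frontier_Omega using vtx_cnodes[OF t r] by (simp add: nd_Omega[OF m] nd_closure[OF m])
    then show ?thesis using FE False k by (auto simp: FE_space_def)
  qed
  have in_hull: "nd m (vtx t r) \<in> convex hull (tri m t)" if "r < 3" for r
    using that by (intro hull_inc) (auto simp: tri_def less3 numeral_2_eq_2)
  have "hatf m k y = inner g y + d" by (rule gd[OF y])
  also have "\<dots> = (\<Sum>r<3. bary m t r y * (inner g (nd m (vtx t r)) + d))"
    using sum_bary[of m t y] arg_cong[OF bary_expand[OF m s, of y], of "inner g"]
    by (simp add: distrib_left sum.distrib inner_sum_right flip: sum_distrib_right)
  also have "\<dots> = (\<Sum>r<3. bary m t r y * of_bool (vtx t r = k))"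
    using gd[OF in_hull] v by (intro sum.cong) auto
  finally show ?thesis .
qed

lemma grad_affine:
  assumes S: "open S" "y \<in> S" and f: "\<And>z. z \<in> S \<Longrightarrow> f z = inner g z + d"
  shows "grad f y = g"
proof -
  have "((\<lambda>z. inner g z + d) has_derivative inner g) (at y)"
    by (auto intro!: derivative_eq_intros)
  then have "(f has_derivative inner g) (at y)"
    by (rule has_derivative_transform_within_open[OF _ S]) (simp add: f)
  then have "frechet_derivative f (at y) = inner g" by (metis frechet_derivative_at)
  then show ?thesis by (simp add: grad_def euclidean_representation)
qed

lemma bary_continuous: "continuous_on A (bary m t r)"
proof -
  define d where "d = bary m t r 0"
  have "bary m t r = (\<lambda>y. inner (gb m t r) y + d)"
  proof
    fix y show "bary m t r y = inner (gb m t r) y + d"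
      using bary_inner[of m t r y 0] unfolding d_def diff_zero by linarith
  qed
  moreover have "continuous_on A (\<lambda>y. inner (gb m t r) y + d)" by (intro continuous_intros)
  ultimately show ?thesis by (simp only:)
qed

definition tint :: "nat \<Rightarrow> (int \<times> int) \<times> int \<Rightarrow> R2 set" where
  "tint m t = {y. \<forall>r<3. 0 < bary m t r y}"

lemma open_tint: "open (tint m t)"
proof -
  have "tint m t = (\<Inter>r\<in>{..<3}. {y. 0 < bary m t r y})" by (auto simp: tint_def)
  then show ?thesis
    by (auto intro!: open_INT open_Collect_less bary_continuous)
qed

lemma tint_hull: "m > 0 \<Longrightarrow> snd t = 1 \<or> snd t = -1 \<Longrightarrow> tint m t \<subseteq> convex hull (tri m t)"
  by (auto simp: tint_def hull_iff less_imp_le)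

lemma hull_off_grid: "m > 0 \<Longrightarrow> snd t = 1 \<or> snd t = -1 \<Longrightarrow> convex hull (tri m t) - grid m \<subseteq> tint m t"
  unfolding tint_def using off_grid_bary_pos by blast

lemma grad_hatf:
  assumes m: "m > 0" and k: "k \<in> nodes m" and t: "t \<in> tris m" and y: "y \<in> tint m t"
  shows "grad (hatf m k) y = gr m t k"
proof (rule grad_affine[OF open_tint y])
  fix z assume "z \<in> tint m t"
  then have "z \<in> convex hull (tri m t)" using tint_hull[OF m tris_sign[OF t]] by blast
  from trans[OF hatf_tri[OF m k t this] combo_inner]
  show "hatf m k z = inner (gr m t k) z + (\<Sum>r<3. bary m t r 0 * of_bool (vtx t r = k))"
    unfolding gr_def .
qed

lemma tri_grad_hatf:
  assumes m: "m > 0" and k: "k \<in> nodes m" and t: "t \<in> tris m"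
  shows "tri_grad (tri m t) (hatf m k) = gr m t k"
proof -
  have "cen (tri m t) \<in> tint m t" by (simp add: tint_def bary_cen[OF m tris_sign[OF t]])
  then show ?thesis unfolding tri_grad_def cen_def[symmetric] by (rule grad_hatf[OF m k t])
qed

lemma closure_diff_grid:
  assumes m: "m > 0"
  shows "closure \<Omega> - \<Omega> \<subseteq> grid m"
proof
  fix y assume "y \<in> closure \<Omega> - \<Omega>"
  then have "sc y = of_int a1 \<or> sc y = of_int a2 \<or> tc y = of_int b1 \<or> tc y = of_int b2 \<or> sc y + tc y = of_int g1 \<or> sc y + tc y = of_int g2"
    unfolding Diff_iff closure_iff Omega_iff by linarith
  then show "y \<in> grid m" unfolding grid_def distrib_left[symmetric] by (auto intro!: Ints_mult)
qed

text \<open>Off the grid the indicator of the domain is the sum of the indicators of the closed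
  triangles.\<close>

lemma has_integral_tris:
  fixes f :: "R2 \<Rightarrow> real"
  assumes m: "m > 0" and I: "\<And>t. t \<in> tris m \<Longrightarrow> (f has_integral I t) (convex hull (tri m t))"
  shows "(f has_integral (\<Sum>t\<in>tris m. I t)) \<Omega>"
proof -
  have "((\<lambda>y. \<Sum>t\<in>tris m. if y \<in> convex hull (tri m t) then f y else 0) has_integral (\<Sum>t\<in>tris m. I t)) UNIV"
    using I by (intro has_integral_sum finite_tris) (simp add: has_integral_restrict_UNIV)
  then have "((\<lambda>y. if y \<in> \<Omega> then f y else 0) has_integral (\<Sum>t\<in>tris m. I t)) UNIV"
  proof (rule has_integral_spike[OF negligible_grid[OF m], rotated])
    fix y assume "y \<in> UNIV - grid m"
    then have y: "y \<notin> grid m" by simp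
    show "(if y \<in> \<Omega> then f y else 0) = (\<Sum>t\<in>tris m. if y \<in> convex hull (tri m t) then f y else 0)"
    proof (cases "y \<in> \<Omega>")
      case True
      then obtain t where t: "t \<in> tris m" "y \<in> convex hull (tri m t)"
        using off_grid_cover[OF m _ y] closure_subset by blast
      then have "y \<in> convex hull (tri m t') \<longleftrightarrow> t' = t" if "t' \<in> tris m" for t'
        using off_grid_unique[OF m _ _ _ _ y] that by blast
      then have "(\<Sum>t\<in>tris m. if y \<in> convex hull (tri m t) then f y else 0) = (\<Sum>t'\<in>tris m. if t' = t then f y else 0)"
        by (intro sum.cong) auto
      then show ?thesis using t(1) True finite_tris by simp
    next
      case False
      have "y \<notin> closure \<Omega>" using closure_diff_grid[OF m] y False by blast
      then have "y \<notin> convex hull (tri m t)" if "t \<in> tris m" for t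
        using hull_subset_closure[OF m tris_sign[OF that]] that by blast
      then show ?thesis using False by (simp add: sum.neutral)
    qed
  qed
  then show ?thesis by (simp add: has_integral_restrict_UNIV)
qed

definition area :: real where "area = measure lebesgue (convex hull {0, uu, vv})"

text \<open>Every mesh triangle is a translate of one reference triangle scaled by 1/m or
  -1/m.\<close>

lemma measure_tri:
  assumes m: "m > 0" and s: "snd t = 1 \<or> snd t = -1"
  shows "measure lebesgue (convex hull (tri m t)) = area / (real m)\<^sup>2"
proof -
  have "tri m t = (\<lambda>y. nd m (fst t) + (of_int (snd t) / m) *\<^sub>R y) ` {0, uu, vv}"
    by (auto simp: tri_def vtx_def nd_def add_divide_distrib scaleR_add_left)
  then have "convex hull (tri m t) = (\<lambda>y. (of_int (snd t) / m) *\<^sub>R y + nd m (fst t)) ` (convex hull {0, uu, vv})"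
    by (simp only: convex_hull_affinity add.commute)
  then show ?thesis
    using measure_lebesgue_affine[of "of_int (snd t) / real m" "nd m (fst t)" "convex hull {0, uu, vv}"] s
    by (auto simp: area_def power_divide power2_eq_square)
qed

lemma compact_hull: "compact (convex hull (tri m t))"
  by (intro compact_convex_hull finite_imp_compact) (simp add: tri_def)

text \<open>The reference triangle contains a nonempty open set; its area is never computed.\<close>

lemma area_pos: "area > 0"
proof -
  have t: "snd ((0::int, 0::int), 1::int) = 1 \<or> snd ((0::int, 0::int), 1::int) = -1" by simp
  let ?t = "((0::int, 0::int), 1::int)"
  have "0 < bary 1 ?t r (cen (tri 1 ?t))" if "r < 3" for r
    using bary_cen[of 1 ?t r] t that by simp
  then have "cen (tri 1 ?t) \<in> tint 1 ?t" unfolding tint_def by blast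
  then have "\<not> negligible (tint 1 ?t)" by (intro open_not_negligible open_tint) auto
  moreover have "tint 1 ?t \<subseteq> convex hull (tri 1 ?t)" by (rule tint_hull) simp_all
  ultimately have "\<not> negligible (convex hull (tri 1 ?t))" using negligible_subset by metis
  then have "measure lebesgue (convex hull (tri 1 ?t)) \<noteq> 0"
    using negligible_iff_measure0[OF lmeasurable_compact[OF compact_hull]] by blast
  then have "area \<noteq> 0" using measure_tri[OF _ t, of 1] by simp
  then show ?thesis using measure_nonneg[of lebesgue "convex hull {0, uu, vv}"] unfolding area_def by linarith
qed

end

section \<open>Integral means over compact sets\<close>

lemma integrable_on_compact_continuous:
  fixes f :: "R2 \<Rightarrow> 'b::euclidean_space"
  assumes "compact K" "continuous_on K f"
  shows "f integrable_on K"
  using borel_integrable_compact[OF assms] set_borel_integral_eq_integral(1)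
  by (auto simp: set_integrable_def)

text \<open>Compares triangle means with nodal values; with \<open>v = 0\<close> it bounds
  them.\<close>

lemma mean_close:
  fixes f :: "R2 \<Rightarrow> 'b::euclidean_space"
  assumes K: "compact K" "measure lebesgue K > 0" and f: "continuous_on K f" and e: "\<And>y. y \<in> K \<Longrightarrow> norm (f y - v) \<le> e"
  shows "norm ((1 / measure lebesgue K) *\<^sub>R integral K f - v) \<le> e"
proof -
  have c: "integral K (\<lambda>y. 1 :: real) = measure lebesgue K"
    using lmeasure_integral[OF lmeasurable_compact[OF K(1)]] by simp
  have i1: "(\<lambda>y. 1::real) integrable_on K" by (rule integrable_on_compact_continuous[OF K(1)]) simp
  have "integral K (\<lambda>y. v) = measure lebesgue K *\<^sub>R v"
    using integral_unique[OF has_integral_scaleR_left[OF integrable_integral[OF i1], of v]] c by simp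
  then have "integral K (\<lambda>y. f y - v) = integral K f - measure lebesgue K *\<^sub>R v"
    using integral_diff[OF integrable_on_compact_continuous[OF K(1) f] integrable_on_compact_continuous[OF K(1), of "\<lambda>_. v"]] by simp
  moreover have "norm (integral K (\<lambda>y. f y - v)) \<le> integral K (\<lambda>y. e)"
    using f e by (intro integral_norm_bound_integral integrable_on_compact_continuous K continuous_intros) auto
  moreover have "integral K (\<lambda>y. e) = measure lebesgue K * e"
    using integral_unique[OF has_integral_scaleR_left[OF integrable_integral[OF i1], of e]] c by simp
  ultimately have "norm (integral K f - measure lebesgue K *\<^sub>R v) \<le> measure lebesgue K * e" by simp
  moreover have "(1 / measure lebesgue K) *\<^sub>R integral K f - v = (1 / measure lebesgue K) *\<^sub>R (integral K f - measure lebesgue K *\<^sub>R v)"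
    using K(2) by (simp add: scaleR_diff_right)
  ultimately show ?thesis using K(2) by (simp add: pos_divide_le_eq mult.commute)
qed

section \<open>Local forms in nodal differences and the lattice energy\<close>

context lattice_domain
begin

definition DU :: "(int \<times> int \<Rightarrow> complex) \<Rightarrow> (int \<times> int) \<times> int \<Rightarrow> complex" where
  "DU z t = z (vtx t 1) - z (vtx t 0)"
definition DV :: "(int \<times> int \<Rightarrow> complex) \<Rightarrow> (int \<times> int) \<times> int \<Rightarrow> complex" where
  "DV z t = z (vtx t 2) - z (vtx t 0)"

definition Gf :: "(int \<times> int \<Rightarrow> complex) \<Rightarrow> (int \<times> int) \<times> int \<Rightarrow> real" where
  "Gf z t = (cmod (DU z t))\<^sup>2 + (cmod (DV z t))\<^sup>2"
definition Vf :: "(int \<times> int \<Rightarrow> complex) \<Rightarrow> (int \<times> int) \<times> int \<Rightarrow> real" where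
  "Vf z t = (\<Sum>r<3. (cmod (z (vtx t r)))\<^sup>2)"

text \<open>The coefficients come from |x p + w q|^2 by writing the mixed product 2 x w as x^2 + w^2
  - (x - w)^2, so that every edge of the triangle receives its own weight.\<close>

definition ku :: real where "ku = inner p p + inner p q"
definition kv :: real where "kv = inner q q + inner p q"
definition kd :: real where "kd = - inner p q"

text \<open>\<open>m\<^sup>2\<close> times \<open>Qf z t\<close> is the squared gradient, on the triangle \<open>t\<close>, of the function with nodal values \<open>z\<close>; the
  three coefficients are nonnegative because the triangle is not obtuse.\<close>

definition Qf :: "(int \<times> int \<Rightarrow> complex) \<Rightarrow> (int \<times> int) \<times> int \<Rightarrow> real" where
  "Qf z t = ku * (cmod (DU z t))\<^sup>2 + kv * (cmod (DV z t))\<^sup>2 + kd * (cmod (DU z t - DV z t))\<^sup>2"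

text \<open>Contribution of one triangle to the convection form, divided by \<open>area\<close>:
  \<open>b t r\<close> stands for the mean of the field times the barycentric coordinate
  \<open>r\<close>. The gradients are of order m and the triangle has area of order 1/m^2, which
  leaves 1/m.\<close>

definition Pf :: "nat \<Rightarrow> ((int \<times> int) \<times> int \<Rightarrow> nat \<Rightarrow> R2) \<Rightarrow> (int \<times> int \<Rightarrow> complex) \<Rightarrow> (int \<times> int) \<times> int \<Rightarrow> complex" where
  "Pf m b z t = - complex_of_real (of_int (snd t) / real m) *
     ((\<Sum>r<3. complex_of_real (inner (b t r) p) * z (vtx t r)) * cnj (DU z t) +
      (\<Sum>r<3. complex_of_real (inner (b t r) q) * z (vtx t r)) * cnj (DV z t))"

definition supp :: "nat \<Rightarrow> (int \<times> int \<Rightarrow> complex) \<Rightarrow> bool" where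
  "supp m z \<longleftrightarrow> (\<forall>k. k \<notin> nodes m \<longrightarrow> z k = 0)"

lemma k_pos: "ku > 0" "kv > 0" "kd \<ge> 0"
  using acute by (simp_all add: ku_def kv_def kd_def)

lemma nodes_inner_box: "nodes m \<subseteq> inner_box m"
proof
  fix k assume "k \<in> nodes m"
  from nodes_bounds[OF this] show "k \<in> inner_box m"
    unfolding inner_box_def mem_Times_iff greaterThanLessThan_iff abs_less_iff by linarith
qed

lemma cnodes_box: "cnodes m \<subseteq> box m"
proof
  fix k assume "k \<in> cnodes m"
  from cnodes_bounds[OF this] show "k \<in> box m"
    unfolding box_def mem_Times_iff atLeastAtMost_iff abs_le_iff by linarith
qed

lemma supp_inner_box: "supp m z \<Longrightarrow> k \<notin> inner_box m \<Longrightarrow> z k = 0"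
  using nodes_inner_box[of m] unfolding supp_def by blast

lemma Gf_nonneg: "Gf z t \<ge> 0" and Qf_nonneg: "Qf z t \<ge> 0"
  using k_pos by (auto simp: Gf_def Vf_def Qf_def intro!: sum_nonneg add_nonneg_nonneg mult_nonneg_nonneg)

lemma diff_le_Gf: "(cmod (DU z t - DV z t))\<^sup>2 \<le> 2 * Gf z t"
  using cmod_add_sq[of "DU z t" "- DV z t"] by (simp add: Gf_def)

lemma Qf_le: "Qf z t \<le> (ku + kv + kd) * (2 * Gf z t)"
proof -
  have "ku * (cmod (DU z t))\<^sup>2 \<le> ku * (2 * Gf z t)" "kv * (cmod (DV z t))\<^sup>2 \<le> kv * (2 * Gf z t)"
    "kd * (cmod (DU z t - DV z t))\<^sup>2 \<le> kd * (2 * Gf z t)"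
    using k_pos diff_le_Gf[of z t] by (auto intro!: mult_left_mono simp: Gf_def)
  then show ?thesis by (simp add: Qf_def algebra_simps)
qed

lemma Gf_le: "min ku kv * Gf z t \<le> Qf z t"
proof -
  have "min ku kv * (cmod (DU z t))\<^sup>2 \<le> ku * (cmod (DU z t))\<^sup>2" "min ku kv * (cmod (DV z t))\<^sup>2 \<le> kv * (cmod (DV z t))\<^sup>2"
    by (auto intro!: mult_right_mono)
  moreover have "0 \<le> kd * (cmod (DU z t - DV z t))\<^sup>2" using k_pos by simp
  ultimately show ?thesis by (simp add: Qf_def Gf_def distrib_left)
qed

text \<open>With orientation and vertex position fixed, the vertex determines the triangle, so no
  lattice point is counted twice.\<close>

lemma sum_vtx_sign_le:
  fixes f :: "int \<times> int \<Rightarrow> real"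
  assumes f: "\<And>k. f k \<ge> 0" and r: "r < 3"
  shows "(\<Sum>t\<in>{t \<in> tris m. snd t = \<sigma>}. f (vtx t r)) \<le> (\<Sum>k\<in>box m. f k)"
proof -
  have inj: "inj_on (\<lambda>t. vtx t r) {t \<in> tris m. snd t = \<sigma>}"
    by (auto simp: inj_on_def vtx_def prod_eq_iff split: if_splits)
  have "(\<Sum>t\<in>{t \<in> tris m. snd t = \<sigma>}. f (vtx t r)) = (\<Sum>k\<in>(\<lambda>t. vtx t r) ` {t \<in> tris m. snd t = \<sigma>}. f k)"
    by (simp add: sum.reindex[OF inj])
  also have "\<dots> \<le> (\<Sum>k\<in>box m. f k)"
  proof (intro sum_mono2)
    show "(\<lambda>t. vtx t r) ` {t \<in> tris m. snd t = \<sigma>} \<subseteq> box m"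
      using subsetD[OF cnodes_box vtx_cnodes[OF _ r]] by blast
  qed (auto simp: f)
  finally show ?thesis .
qed

lemma sum_tris_split:
  fixes F :: "(int \<times> int) \<times> int \<Rightarrow> real"
  shows "(\<Sum>t\<in>tris m. F t) = (\<Sum>t\<in>{t \<in> tris m. snd t = 1}. F t) + (\<Sum>t\<in>{t \<in> tris m. snd t = -1}. F t)"
proof -
  have "tris m = {t \<in> tris m. snd t = 1} \<union> {t \<in> tris m. snd t = -1}" using tris_sign by auto
  then show ?thesis using finite_tris[of m] by (subst sum.union_disjoint[symmetric]) auto
qed

lemma sum_Vf: "(\<Sum>t\<in>tris m. Vf z t) \<le> 6 * sq_norm m z"
proof -
  have *: "(\<Sum>t\<in>tris m. (cmod (z (vtx t r)))\<^sup>2) \<le> 2 * sq_norm m z" if "r < 3" for r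
    using sum_vtx_sign_le[of "\<lambda>k. (cmod (z k))\<^sup>2" r m 1] sum_vtx_sign_le[of "\<lambda>k. (cmod (z k))\<^sup>2" r m "-1"] that
    unfolding sum_tris_split[of _ m] sq_norm_def by auto
  have "(\<Sum>t\<in>tris m. Vf z t) = (\<Sum>r<3. \<Sum>t\<in>tris m. (cmod (z (vtx t r)))\<^sup>2)"
    unfolding Vf_def by (rule sum.swap)
  also have "\<dots> \<le> (\<Sum>r<3::nat. 2 * sq_norm m z)" using * by (intro sum_mono) auto
  finally show ?thesis by simp
qed

text \<open>Each lattice edge in direction \<open>uu\<close> or \<open>vv\<close> belongs to at most
  one triangle of each orientation.\<close>

lemma sum_Gf_le: "(\<Sum>t\<in>tris m. Gf z t) \<le> 2 * dir_energy m z"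
proof -
  define gx where "gx k = (cmod (z (k + (1, 0)) - z k))\<^sup>2" for k
  define gy where "gy k = (cmod (z (k + (0, 1)) - z k))\<^sup>2" for k
  have "(\<Sum>t\<in>{t \<in> tris m. snd t = 1}. Gf z t) = (\<Sum>t\<in>{t \<in> tris m. snd t = 1}. gx (vtx t 0) + gy (vtx t 0))"
    by (intro sum.cong) (auto simp: Gf_def DU_def DV_def gx_def gy_def vtx_def)
  moreover have "(\<Sum>t\<in>{t \<in> tris m. snd t = -1}. Gf z t) = (\<Sum>t\<in>{t \<in> tris m. snd t = -1}. gx (vtx t 1) + gy (vtx t 2))"
    by (intro sum.cong) (auto simp: Gf_def DU_def DV_def gx_def gy_def vtx_def norm_minus_commute add.assoc)
  moreover have "(\<Sum>t\<in>{t \<in> tris m. snd t = \<sigma>}. gx (vtx t r)) \<le> (\<Sum>k\<in>box m. gx k)"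
    "(\<Sum>t\<in>{t \<in> tris m. snd t = \<sigma>}. gy (vtx t r)) \<le> (\<Sum>k\<in>box m. gy k)" if "r < 3" for r \<sigma>
    using that by (auto intro!: sum_vtx_sign_le simp: gx_def gy_def)
  note this[of 0 1] this[of 1 "-1"] this[of 2 "-1"]
  moreover have "dir_energy m z = (\<Sum>k\<in>box m. gx k) + (\<Sum>k\<in>box m. gy k)"
    by (simp add: dir_energy_def gx_def gy_def sum.distrib)
  ultimately show ?thesis unfolding sum_tris_split[of _ m] by (simp add: sum.distrib)
qed

text \<open>The triangles of sign 1 alone carry the whole energy: one that is missing from the mesh
  has no internal node among its vertices, so \<open>z\<close> vanishes on it.\<close>

lemma sum_Gf_ge: assumes z: "supp m z" shows "dir_energy m z \<le> (\<Sum>t\<in>tris m. Gf z t)"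
proof -
  have zero: "Gf z (k, 1) = 0" if "(k, 1) \<notin> tris m" for k
  proof -
    have "vtx (k, 1) r \<notin> nodes m" if "r < 3" for r
      using tris_node[of "(k, 1)" r m] that \<open>(k, 1) \<notin> tris m\<close> by auto
    then have "z (vtx (k, 1) r) = 0" if "r < 3" for r using z that unfolding supp_def by blast
    then show ?thesis by (simp add: Gf_def DU_def DV_def)
  qed
  have "dir_energy m z = (\<Sum>k\<in>box m. Gf z (k, 1))"
    by (simp add: dir_energy_def Gf_def DU_def DV_def vtx_def)
  also have "\<dots> = (\<Sum>k\<in>{k \<in> box m. (k, 1) \<in> tris m}. Gf z (k, 1))"
    by (rule sum.mono_neutral_right) (auto simp: zero)
  also have "\<dots> = (\<Sum>t\<in>(\<lambda>k. (k, 1)) ` {k \<in> box m. (k, 1) \<in> tris m}. Gf z t)"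
    by (subst sum.reindex) (auto simp: inj_on_def)
  also have "\<dots> \<le> (\<Sum>t\<in>tris m. Gf z t)"
    by (intro sum_mono2 finite_tris) (auto simp: Gf_nonneg)
  finally show ?thesis .
qed

lemma poincare: "m \<ge> 1 \<Longrightarrow> supp m z \<Longrightarrow> sq_norm m z / (real m)\<^sup>2 \<le> 9 * dir_energy m z"
  using sq_norm_le_dir_energy[of m z] supp_inner_box[of m z] by (simp add: divide_le_eq mult_ac)

end

section \<open>Perturbation estimates on one triangle\<close>

lemma young: "x * y \<le> \<delta> / 2 * y\<^sup>2 + x\<^sup>2 / (2 * \<delta>)" if "\<delta> > 0" for x y \<delta> :: real
proof -
  have "0 \<le> (\<delta> * y - x)\<^sup>2 / (2 * \<delta>)" using that by simp
  also have "\<dots> = \<delta> / 2 * y\<^sup>2 + x\<^sup>2 / (2 * \<delta>) - x * y"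
    using that by (simp add: power2_eq_square field_simps)
  finally show ?thesis by simp
qed

text \<open>The difference d1 z1 - d0 z0 is split as d1 (z1 - z0) + (d1 - d0) z0. The square of the
  first term is compared directly; Young's inequality on the cross term leaves a small multiple of
  the edge energy and a multiple of e^2 |z0|^2, where e will be of order 1/m.\<close>

lemma edge_estimate:
  fixes z0 z1 :: complex and d0 d1 \<alpha> e B \<delta> :: real
  assumes a: "\<bar>d1\<^sup>2 - \<alpha>\<bar> \<le> e" and d: "\<bar>d1 - d0\<bar> \<le> e" and B: "0 \<le> d1" "d1 \<le> B" and \<delta>: "\<delta> > 0"
  shows "\<bar>(cmod (d1 * z1 - d0 * z0))\<^sup>2 - \<alpha> * (cmod (z1 - z0))\<^sup>2\<bar> \<le>
     (e + \<delta>) * (cmod (z1 - z0))\<^sup>2 + (B\<^sup>2 / \<delta> + 1) * e\<^sup>2 * (cmod z0)\<^sup>2"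
proof -
  define x where "x = complex_of_real d1 * (z1 - z0)"
  define y where "y = complex_of_real (d1 - d0) * z0"
  have xy: "d1 * z1 - d0 * z0 = x + y" by (simp add: x_def y_def algebra_simps)
  have e0: "e \<ge> 0" using d by linarith
  have nx: "cmod x \<le> B * cmod (z1 - z0)" using B by (simp add: x_def norm_mult mult_right_mono)
  have nx2: "(cmod x)\<^sup>2 = d1\<^sup>2 * (cmod (z1 - z0))\<^sup>2" using B by (simp add: x_def norm_mult power_mult_distrib)
  have ny: "cmod y \<le> e * cmod z0" using d by (simp add: y_def norm_mult mult_right_mono flip: of_real_diff)
  have "\<bar>cmod (x + y) - cmod x\<bar> \<le> cmod y" using norm_triangle_ineq3[of "x + y" x] by simp
  moreover have "cmod (x + y) + cmod x \<le> 2 * cmod x + cmod y" using norm_triangle_ineq[of x y] by simp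
  ultimately have "\<bar>cmod (x + y) - cmod x\<bar> * (cmod (x + y) + cmod x) \<le> cmod y * (2 * cmod x + cmod y)"
    by (intro mult_mono) auto
  then have "\<bar>(cmod (x + y))\<^sup>2 - (cmod x)\<^sup>2\<bar> \<le> cmod y * (2 * cmod x + cmod y)"
    by (simp add: square_diff_square_factored power2_eq_square abs_mult mult.commute flip: power2_eq_square)
      (simp add: power2_eq_square square_diff_square_factored abs_mult mult.commute)
  also have "\<dots> = 2 * (cmod y * cmod x) + (cmod y)\<^sup>2" by (simp add: power2_eq_square algebra_simps)
  also have "2 * (cmod y * cmod x) \<le> 2 * ((e * cmod z0) * (B * cmod (z1 - z0)))"
    using nx ny e0 by (intro mult_left_mono mult_mono) auto
  also have "\<dots> = 2 * ((B * (e * cmod z0)) * cmod (z1 - z0))" by simp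
  also have "\<dots> \<le> 2 * (\<delta> / 2 * (cmod (z1 - z0))\<^sup>2 + (B * (e * cmod z0))\<^sup>2 / (2 * \<delta>))"
    by (intro mult_left_mono young \<delta>) auto
  also have "(cmod y)\<^sup>2 \<le> (e * cmod z0)\<^sup>2" using ny by (intro power_mono) auto
  finally have 1: "\<bar>(cmod (x + y))\<^sup>2 - (cmod x)\<^sup>2\<bar> \<le>
      2 * (\<delta> / 2 * (cmod (z1 - z0))\<^sup>2 + (B * (e * cmod z0))\<^sup>2 / (2 * \<delta>)) + (e * cmod z0)\<^sup>2" by simp
  have "(cmod x)\<^sup>2 - \<alpha> * (cmod (z1 - z0))\<^sup>2 = (d1\<^sup>2 - \<alpha>) * (cmod (z1 - z0))\<^sup>2"
    by (simp add: nx2 algebra_simps)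
  then have 2: "\<bar>(cmod x)\<^sup>2 - \<alpha> * (cmod (z1 - z0))\<^sup>2\<bar> \<le> e * (cmod (z1 - z0))\<^sup>2"
    using a by (simp add: abs_mult mult_right_mono)
  have "2 * (\<delta> / 2 * (cmod (z1 - z0))\<^sup>2 + (B * (e * cmod z0))\<^sup>2 / (2 * \<delta>)) + (e * cmod z0)\<^sup>2 =
      \<delta> * (cmod (z1 - z0))\<^sup>2 + (B\<^sup>2 / \<delta> + 1) * e\<^sup>2 * (cmod z0)\<^sup>2"
    using \<delta> by (simp add: power_mult_distrib field_simps)
  then show ?thesis using 1 2 unfolding xy by (simp add: distrib_right)
qed

context lattice_domain
begin

text \<open>The three edge errors add up because the coefficients of \<open>Qf\<close> are
  nonnegative; the third edge costs the factor 2 in front of \<open>Gf\<close>.\<close>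

lemma Q_estimate:
  assumes a: "\<And>r. r < 3 \<Longrightarrow> \<bar>(d (vtx t r))\<^sup>2 - \<alpha>\<bar> \<le> e"
    and d: "\<And>r r'. r < 3 \<Longrightarrow> r' < 3 \<Longrightarrow> \<bar>d (vtx t r) - d (vtx t r')\<bar> \<le> e"
    and B: "\<And>r. r < 3 \<Longrightarrow> 0 \<le> d (vtx t r) \<and> d (vtx t r) \<le> B" and \<delta>: "\<delta> > 0"
  shows "\<bar>Qf (\<lambda>k. complex_of_real (d k) * z k) t - \<alpha> * Qf z t\<bar> \<le>
     (ku + kv + kd) * ((e + \<delta>) * (2 * Gf z t) + (B\<^sup>2 / \<delta> + 1) * e\<^sup>2 * Vf z t)"
proof -
  define E where "E = (e + \<delta>) * (2 * Gf z t) + (B\<^sup>2 / \<delta> + 1) * e\<^sup>2 * Vf z t"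
  have e0: "e \<ge> 0" using d[of 0 0] by simp
  have edge: "\<bar>(cmod (complex_of_real (d (vtx t r)) * z (vtx t r) - complex_of_real (d (vtx t r')) * z (vtx t r')))\<^sup>2
      - \<alpha> * (cmod (z (vtx t r) - z (vtx t r')))\<^sup>2\<bar> \<le> E"
    if r: "r < 3" "r' < 3" and g: "(cmod (z (vtx t r) - z (vtx t r')))\<^sup>2 \<le> 2 * Gf z t" for r r'
  proof -
    have "(cmod (z (vtx t r')))\<^sup>2 \<le> Vf z t" unfolding Vf_def using r by (intro member_le_sum) auto
    then have "(e + \<delta>) * (cmod (z (vtx t r) - z (vtx t r')))\<^sup>2 + (B\<^sup>2 / \<delta> + 1) * e\<^sup>2 * (cmod (z (vtx t r')))\<^sup>2 \<le> E"
      unfolding E_def using g e0 \<delta> by (intro add_mono mult_left_mono) auto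
    then show ?thesis
      using edge_estimate[OF a[OF r(1)] d[OF r] _ _ \<delta>, of B "z (vtx t r)" "z (vtx t r')"] B[OF r(1)] by linarith
  qed
  have "(cmod (z (vtx t 1) - z (vtx t 0)))\<^sup>2 \<le> 2 * Gf z t" "(cmod (z (vtx t 2) - z (vtx t 0)))\<^sup>2 \<le> 2 * Gf z t"
    "(cmod (z (vtx t 1) - z (vtx t 2)))\<^sup>2 \<le> 2 * Gf z t"
    using diff_le_Gf[of z t] by (simp_all add: Gf_def DU_def DV_def)
  note E = edge[OF _ _ this(1)] edge[OF _ _ this(2)] edge[OF _ _ this(3)]
  have w: "\<bar>k * x - \<alpha> * (k * y)\<bar> \<le> k * E" if "k \<ge> 0" "\<bar>x - \<alpha> * y\<bar> \<le> E" for k x y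
  proof -
    have "k * x - \<alpha> * (k * y) = k * (x - \<alpha> * y)" by (simp add: algebra_simps)
    then show ?thesis using that by (simp add: abs_mult mult_left_mono)
  qed
  let ?w = "\<lambda>k. complex_of_real (d k) * z k"
  have "\<bar>ku * (cmod (DU ?w t))\<^sup>2 - \<alpha> * (ku * (cmod (DU z t))\<^sup>2)\<bar> \<le> ku * E"
    "\<bar>kv * (cmod (DV ?w t))\<^sup>2 - \<alpha> * (kv * (cmod (DV z t))\<^sup>2)\<bar> \<le> kv * E"
    "\<bar>kd * (cmod (DU ?w t - DV ?w t))\<^sup>2 - \<alpha> * (kd * (cmod (DU z t - DV z t))\<^sup>2)\<bar> \<le> kd * E"
    using E k_pos by (auto intro!: w simp: DU_def DV_def)
  then have "\<bar>Qf ?w t - \<alpha> * Qf z t\<bar> \<le> ku * E + kv * E + kd * E"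
    unfolding Qf_def distrib_left by linarith
  then show ?thesis by (simp add: E_def distrib_right)
qed

text \<open>Common part of the two estimates that follow; they differ in how \<open>x\<close> bounds
  the weighted combination of the vertex values.\<close>

lemma Pf_raw:
  assumes s: "snd t = 1 \<or> snd t = -1"
    and w: "\<And>v. cmod (\<Sum>r<3. complex_of_real (inner (b t r) v) * z (vtx t r)) \<le> norm v * x"
  shows "cmod (Pf m b z t) \<le> (1 / m) * (norm p + norm q) * (x * (cmod (DU z t) + cmod (DV z t)))"
proof -
  have x0: "0 \<le> norm p * x" "0 \<le> norm q * x" using w[of p] w[of q] by (meson norm_ge_zero order_trans)+
  have "cmod (Pf m b z t) = (1 / m) * cmod ((\<Sum>r<3. complex_of_real (inner (b t r) p) * z (vtx t r)) * cnj (DU z t) +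
      (\<Sum>r<3. complex_of_real (inner (b t r) q) * z (vtx t r)) * cnj (DV z t))"
    using s by (auto simp: Pf_def norm_mult norm_divide)
  also have "\<dots> \<le> (1 / m) * (norm p * x * cmod (DU z t) + norm q * x * cmod (DV z t))"
    using w[of p] w[of q]
    by (intro mult_left_mono order_trans[OF norm_triangle_ineq] add_mono) (auto simp: norm_mult mult_right_mono)
  also have "\<dots> \<le> (1 / m) * ((norm p * x + norm q * x) * (cmod (DU z t) + cmod (DV z t)))"
  proof (intro mult_left_mono)
    have "0 \<le> norm p * x * cmod (DV z t)" "0 \<le> norm q * x * cmod (DU z t)"
      by (rule mult_nonneg_nonneg[OF x0(1) norm_ge_zero], rule mult_nonneg_nonneg[OF x0(2) norm_ge_zero])
    then show "norm p * x * cmod (DU z t) + norm q * x * cmod (DV z t) \<le> (norm p * x + norm q * x) * (cmod (DU z t) + cmod (DV z t))"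
      by (simp add: distrib_left distrib_right)
  qed simp
  finally show ?thesis by (simp add: algebra_simps)
qed

lemma DUV_sq: "(cmod (DU z t) + cmod (DV z t))\<^sup>2 \<le> 2 * Gf z t"
  using sum_squares_bound[of "cmod (DU z t)" "cmod (DV z t)"] by (simp add: Gf_def power2_sum)

text \<open>Young's inequality separates values from differences; the prefactor 1/m goes to the
  values and yields Vf/m^2.\<close>

lemma Pf_estimate:
  assumes s: "snd t = 1 \<or> snd t = -1" and b: "\<And>r. r < 3 \<Longrightarrow> norm (b t r) \<le> B" and \<delta>: "\<delta> > 0"
  shows "cmod (Pf m b z t) \<le> \<delta> * Gf z t + 3 * (B * (norm p + norm q))\<^sup>2 / (2 * \<delta>) * (Vf z t / (real m)\<^sup>2)"
proof -
  define S where "S = (\<Sum>r<3. cmod (z (vtx t r)))"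
  define N where "N = norm p + norm q"
  have B0: "B \<ge> 0" using order_trans[OF norm_ge_zero b[of 0]] by simp
  have "cmod (\<Sum>r<3. complex_of_real (inner (b t r) v) * z (vtx t r)) \<le> norm v * (B * S)" for v
  proof -
    have "cmod (\<Sum>r<3. complex_of_real (inner (b t r) v) * z (vtx t r)) \<le> (\<Sum>r<3. norm v * B * cmod (z (vtx t r)))"
    proof (rule order_trans[OF norm_sum], rule sum_mono)
      fix r :: nat assume "r \<in> {..<3}"
      then have "\<bar>inner (b t r) v\<bar> \<le> B * norm v"
        using b[of r] by (intro order_trans[OF Cauchy_Schwarz_ineq2] mult_right_mono) auto
      then have "\<bar>inner (b t r) v\<bar> * cmod (z (vtx t r)) \<le> (B * norm v) * cmod (z (vtx t r))"
        by (rule mult_right_mono) simp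
      then show "cmod (complex_of_real (inner (b t r) v) * z (vtx t r)) \<le> norm v * B * cmod (z (vtx t r))"
        by (simp add: norm_mult mult_ac)
    qed
    then show ?thesis by (simp add: S_def sum_distrib_left mult.assoc)
  qed
  from Pf_raw[where b=b and z=z and t=t and m=m and x="B * S", OF s this]
  have "cmod (Pf m b z t) \<le> (B * N * S / m) * (cmod (DU z t) + cmod (DV z t))"
    by (simp add: N_def mult_ac)
  also have "\<dots> \<le> \<delta> / 2 * (cmod (DU z t) + cmod (DV z t))\<^sup>2 + (B * N * S / m)\<^sup>2 / (2 * \<delta>)" by (rule young[OF \<delta>])
  also have "\<dots> \<le> \<delta> / 2 * (2 * Gf z t) + (B * N / m)\<^sup>2 * (3 * Vf z t) / (2 * \<delta>)"
  proof (intro add_mono mult_left_mono divide_right_mono DUV_sq)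
    have "S\<^sup>2 \<le> 3 * Vf z t"
      using Cauchy_Schwarz_ineq_sum[of "\<lambda>_. 1" "\<lambda>r. cmod (z (vtx t r))" "{..<3::nat}"] by (simp add: S_def Vf_def)
    then have "(B * N / m)\<^sup>2 * S\<^sup>2 \<le> (B * N / m)\<^sup>2 * (3 * Vf z t)" by (intro mult_left_mono) auto
    then show "(B * N * S / m)\<^sup>2 \<le> (B * N / m)\<^sup>2 * (3 * Vf z t)"
      by (simp add: power_mult_distrib power_divide)
  qed (use \<delta> in auto)
  also have "\<dots> = \<delta> * Gf z t + 3 * (B * N)\<^sup>2 / (2 * \<delta>) * (Vf z t / (real m)\<^sup>2)"
    by (simp add: power_divide mult_ac)
  finally show ?thesis by (simp add: N_def)
qed

text \<open>When the \<open>b t r\<close> nearly cancel, only differences of nodal values remain, which gains a factor \<open>1 / m\<close>.\<close>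

lemma Pf_cancel_estimate:
  assumes s: "snd t = 1 \<or> snd t = -1" and b: "\<And>r. r < 3 \<Longrightarrow> norm (b t r) \<le> B"
    and sb: "norm (\<Sum>r<3. b t r) \<le> B / m"
  shows "cmod (Pf m b z t) \<le> (1 / m) * (norm p + norm q) * B * (3 * Gf z t + Vf z t / (real m)\<^sup>2)"
proof -
  define y where "y = cmod (DU z t) + cmod (DV z t)"
  define x where "x = cmod (z (vtx t 0)) / m"
  have B0: "B \<ge> 0" using order_trans[OF norm_ge_zero b[of 0]] by simp
  have "cmod (\<Sum>r<3. complex_of_real (inner (b t r) v) * z (vtx t r)) \<le> norm v * (B * (x + y))" for v
  proof -
    have "(\<Sum>r<3. complex_of_real (inner (b t r) v) * z (vtx t r)) =
        complex_of_real (inner (\<Sum>r<3. b t r) v) * z (vtx t 0) + complex_of_real (inner (b t 1) v) * DU z t + complex_of_real (inner (b t 2) v) * DV z t"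
      by (simp add: sum3 inner_add_left DU_def DV_def algebra_simps)
    also have "cmod \<dots> \<le> \<bar>inner (\<Sum>r<3. b t r) v\<bar> * cmod (z (vtx t 0)) + \<bar>inner (b t 1) v\<bar> * cmod (DU z t) + \<bar>inner (b t 2) v\<bar> * cmod (DV z t)"
      by (intro order_trans[OF norm_triangle_ineq] add_mono) (auto simp: norm_mult)
    also have "\<dots> \<le> (B / m * norm v) * cmod (z (vtx t 0)) + (B * norm v) * cmod (DU z t) + (B * norm v) * cmod (DV z t)"
      using b[of 1] b[of 2] sb
      by (intro add_mono mult_right_mono order_trans[OF Cauchy_Schwarz_ineq2] norm_ge_zero) auto
    finally show ?thesis by (simp add: x_def y_def algebra_simps)
  qed
  from Pf_raw[where b=b and z=z and t=t and m=m and x="B * (x + y)", OF s this]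
  have "cmod (Pf m b z t) \<le> (1 / m) * (norm p + norm q) * (B * ((x + y) * y))"
    by (simp add: y_def mult_ac)
  also have "(1 / m) * (norm p + norm q) * (B * ((x + y) * y)) \<le> (1 / m) * (norm p + norm q) * (B * (3 * Gf z t + Vf z t / (real m)\<^sup>2))"
  proof (intro mult_left_mono B0)
    have "x * y \<le> y\<^sup>2 / 2 + x\<^sup>2 / 2" using young[of 1 x y] by simp
    moreover have "(x + y) * y = x * y + y\<^sup>2" by (simp add: power2_eq_square algebra_simps)
    moreover have "x\<^sup>2 \<le> Vf z t / (real m)\<^sup>2"
      unfolding x_def power_divide Vf_def by (intro divide_right_mono member_le_sum) auto
    moreover have "0 \<le> x\<^sup>2" by simp
    ultimately show "(x + y) * y \<le> 3 * Gf z t + Vf z t / (real m)\<^sup>2"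
      using DUV_sq[of z t, folded y_def] by linarith
  qed simp
  finally show ?thesis by (simp add: mult.assoc)
qed

text \<open>The triangle data of one mesh level: \<open>\<alpha>\<close> stands for the means of \<open>a\<close>, and \<open>d\<close> for the square roots of the entries
  of \<open>D\<^sub>n(a)\<close>.\<close>

definition diag_data :: "nat \<Rightarrow> real \<Rightarrow> real \<Rightarrow> real \<Rightarrow> ((int \<times> int) \<times> int \<Rightarrow> real) \<Rightarrow> (int \<times> int \<Rightarrow> real) \<Rightarrow> bool" where
  "diag_data m C l B \<alpha> d \<longleftrightarrow> (\<forall>t\<in>tris m. \<forall>r<3. \<bar>(d (vtx t r))\<^sup>2 - \<alpha> t\<bar> \<le> C / m \<and>
     (\<forall>r'<3. \<bar>d (vtx t r) - d (vtx t r')\<bar> \<le> C / m) \<and> l \<le> d (vtx t r) \<and> d (vtx t r) \<le> B)"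

section \<open>The forms of one mesh level and their bounds\<close>

definition wt :: "(int \<times> int \<Rightarrow> real) \<Rightarrow> (int \<times> int \<Rightarrow> complex) \<Rightarrow> int \<times> int \<Rightarrow> complex" where
  "wt d z k = complex_of_real (d k) * z k"

lemma supp_wt: "supp m z \<Longrightarrow> supp m (wt d z)" by (simp add: supp_def wt_def)

text \<open>Up to the factor \<open>area\<close>, the forms of the diffusion matrix, the convection matrix and the preconditioner.\<close>

definition FT :: "nat \<Rightarrow> ((int \<times> int) \<times> int \<Rightarrow> real) \<Rightarrow> (int \<times> int \<Rightarrow> complex) \<Rightarrow> real" where
  "FT m \<alpha> z = (\<Sum>t\<in>tris m. \<alpha> t * Qf z t)"
definition FC :: "nat \<Rightarrow> ((int \<times> int) \<times> int \<Rightarrow> nat \<Rightarrow> R2) \<Rightarrow> (int \<times> int \<Rightarrow> complex) \<Rightarrow> complex" where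
  "FC m b z = (\<Sum>t\<in>tris m. Pf m b z t)"
definition FP :: "nat \<Rightarrow> (int \<times> int \<Rightarrow> real) \<Rightarrow> (int \<times> int \<Rightarrow> complex) \<Rightarrow> real" where
  "FP m d z = (\<Sum>t\<in>tris m. Qf (wt d z) t)"

text \<open>The triangle estimate is used with e = C/m; the square of this variation produces the
  1/m^2 beside \<open>sq_norm\<close>.\<close>

lemma FT_FP_diff:
  assumes dd: "diag_data m C l B \<alpha> d" and l: "l \<ge> 0" and \<delta>: "\<delta> > 0" and C: "C \<ge> 0"
  shows "\<bar>FP m d z - FT m \<alpha> z\<bar> \<le> (ku + kv + kd) *
    (4 * (C / m + \<delta>) * dir_energy m z + 6 * (B\<^sup>2 / \<delta> + 1) * C\<^sup>2 * (sq_norm m z / (real m)\<^sup>2))"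
proof -
  let ?K = "ku + kv + kd"
  have K: "?K \<ge> 0" using k_pos by simp
  have e1: "2 * x * (2 * y) = 4 * x * y" and e2: "x * (C / m)\<^sup>2 * (6 * y) = 6 * x * C\<^sup>2 * (y / (real m)\<^sup>2)" for x y :: real
    by (simp_all add: power_divide)
  have "\<bar>Qf (wt d z) t - \<alpha> t * Qf z t\<bar> \<le> ?K * ((C / m + \<delta>) * (2 * Gf z t) + (B\<^sup>2 / \<delta> + 1) * (C / m)\<^sup>2 * Vf z t)"
    if "t \<in> tris m" for t
    unfolding wt_def[abs_def] using dd that l unfolding diag_data_def
    by (intro Q_estimate \<delta>) (auto intro: order_trans[OF l])
  then have "\<bar>FP m d z - FT m \<alpha> z\<bar> \<le> (\<Sum>t\<in>tris m. ?K * ((C / m + \<delta>) * (2 * Gf z t) + (B\<^sup>2 / \<delta> + 1) * (C / m)\<^sup>2 * Vf z t))"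
    unfolding FP_def FT_def sum_subtractf[symmetric] by (intro order_trans[OF sum_abs] sum_mono) auto
  also have "\<dots> = ?K * (2 * (C / m + \<delta>) * (\<Sum>t\<in>tris m. Gf z t) + (B\<^sup>2 / \<delta> + 1) * (C / m)\<^sup>2 * (\<Sum>t\<in>tris m. Vf z t))"
    by (simp only: sum_distrib_left[symmetric] sum.distrib) (simp add: mult_ac)
  also have "\<dots> \<le> ?K * (2 * (C / m + \<delta>) * (2 * dir_energy m z) + (B\<^sup>2 / \<delta> + 1) * (C / m)\<^sup>2 * (6 * sq_norm m z))"
    using C \<delta> by (intro mult_left_mono[OF _ K] add_mono mult_left_mono sum_Gf_le sum_Vf) auto
  finally show ?thesis unfolding e1 e2 .
qed

text \<open>Convection is of lower order: it is a small multiple of the energy at the price of a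
  large multiple of the scaled mean square.\<close>

lemma FC_bound:
  assumes b: "\<And>t r. t \<in> tris m \<Longrightarrow> r < 3 \<Longrightarrow> norm (b t r) \<le> B" and \<delta>: "\<delta> > 0"
  shows "cmod (FC m b z) \<le> 2 * \<delta> * dir_energy m z + 9 * (B * (norm p + norm q))\<^sup>2 / \<delta> * (sq_norm m z / (real m)\<^sup>2)"
proof -
  let ?c = "3 * (B * (norm p + norm q))\<^sup>2 / (2 * \<delta>)"
  have "cmod (FC m b z) \<le> (\<Sum>t\<in>tris m. \<delta> * Gf z t + ?c * (Vf z t / (real m)\<^sup>2))"
    unfolding FC_def by (intro order_trans[OF norm_sum] sum_mono Pf_estimate \<delta>) (auto simp: b tris_sign)
  also have "\<dots> = \<delta> * (\<Sum>t\<in>tris m. Gf z t) + ?c * ((\<Sum>t\<in>tris m. Vf z t) / (real m)\<^sup>2)"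
    by (simp only: sum.distrib sum_distrib_left sum_divide_distrib)
  also have "\<dots> \<le> \<delta> * (2 * dir_energy m z) + ?c * ((6 * sq_norm m z) / (real m)\<^sup>2)"
    using \<delta> by (intro add_mono mult_left_mono divide_right_mono sum_Gf_le sum_Vf) auto
  finally show ?thesis by (simp add: mult_ac)
qed

text \<open>Here smallness comes from 1/m, and Poincare absorbs the mean square: 60 = 3 * 2 + 6 * 9.
  It is meant for the difference between quadrature data and exact data.\<close>

lemma FC_cancel_bound:
  assumes m: "m \<ge> 1" and z: "supp m z" and b: "\<And>t r. t \<in> tris m \<Longrightarrow> r < 3 \<Longrightarrow> norm (b t r) \<le> B"
    and sb: "\<And>t. t \<in> tris m \<Longrightarrow> norm (\<Sum>r<3. b t r) \<le> B / m" and B: "B \<ge> 0"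
  shows "cmod (FC m b z) \<le> (1 / m) * (norm p + norm q) * B * (60 * dir_energy m z)"
proof -
  let ?c = "(1 / m) * (norm p + norm q) * B"
  have c: "?c \<ge> 0" using B by simp
  have "cmod (FC m b z) \<le> (\<Sum>t\<in>tris m. ?c * (3 * Gf z t + Vf z t / (real m)\<^sup>2))"
    unfolding FC_def by (rule order_trans[OF norm_sum], intro sum_mono Pf_cancel_estimate b sb tris_sign)
  also have "\<dots> = ?c * (3 * (\<Sum>t\<in>tris m. Gf z t) + (\<Sum>t\<in>tris m. Vf z t) / (real m)\<^sup>2)"
    by (simp only: sum.distrib sum_distrib_left[symmetric] sum_divide_distrib[symmetric])
  also have "\<dots> \<le> ?c * (3 * (2 * dir_energy m z) + (6 * sq_norm m z) / (real m)\<^sup>2)"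
    by (intro mult_left_mono[OF _ c] add_mono mult_left_mono divide_right_mono sum_Gf_le sum_Vf) auto
  also have "\<dots> \<le> ?c * (60 * dir_energy m z)"
    using poincare[OF m z] by (intro mult_left_mono[OF _ c]) simp
  finally show ?thesis .
qed

text \<open>The preconditioner is compared with the diffusion form at \<delta> = 1, and Poincare
  absorbs the mean square.\<close>

lemma FP_upper:
  assumes m: "m \<ge> 1" and z: "supp m z" and dd: "diag_data m C l B \<alpha> d" and l: "l \<ge> 0" and C: "C \<ge> 0"
  shows "FP m d z \<le> (ku + kv + kd) * (4 * (B\<^sup>2 + C) + 4 * (C + 1) + 54 * (B\<^sup>2 + 1) * C\<^sup>2) * dir_energy m z"
    and "FT m \<alpha> z \<le> (ku + kv + kd) * (4 * (B\<^sup>2 + C)) * dir_energy m z"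
proof -
  let ?K = "ku + kv + kd"
  have K: "?K \<ge> 0" using k_pos by simp
  have Cm: "C / m \<le> C" using m C by (simp add: divide_le_eq mult_le_cancel_left1)
  have "\<alpha> t * Qf z t \<le> (B\<^sup>2 + C) * (?K * (2 * Gf z t))" if t: "t \<in> tris m" for t
  proof -
    have r: "(0::nat) < 3" by simp
    have h: "\<bar>(d (vtx t 0))\<^sup>2 - \<alpha> t\<bar> \<le> C / m" "l \<le> d (vtx t 0)" "d (vtx t 0) \<le> B"
      using dd t r unfolding diag_data_def by blast+
    have "(d (vtx t 0))\<^sup>2 \<le> B\<^sup>2" using h l by (intro power_mono) auto
    then have "\<alpha> t \<le> B\<^sup>2 + C" using h(1) Cm by linarith
    then show ?thesis using C by (intro mult_mono Qf_le Qf_nonneg) auto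
  qed
  then have "FT m \<alpha> z \<le> (\<Sum>t\<in>tris m. (B\<^sup>2 + C) * (?K * (2 * Gf z t)))" unfolding FT_def by (intro sum_mono) auto
  also have "\<dots> = (B\<^sup>2 + C) * (?K * (2 * (\<Sum>t\<in>tris m. Gf z t)))" by (simp only: sum_distrib_left)
  also have "\<dots> \<le> (B\<^sup>2 + C) * (?K * (2 * (2 * dir_energy m z)))"
    using C K by (intro mult_left_mono sum_Gf_le) auto
  finally show 1: "FT m \<alpha> z \<le> ?K * (4 * (B\<^sup>2 + C)) * dir_energy m z" by (simp add: algebra_simps)
  have "FP m d z - FT m \<alpha> z \<le> ?K * (4 * (C / m + 1) * dir_energy m z + 6 * (B\<^sup>2 / 1 + 1) * C\<^sup>2 * (sq_norm m z / (real m)\<^sup>2))"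
    using FT_FP_diff[where \<delta>=1 and z=z, OF dd l _ C] by linarith
  also have "\<dots> \<le> ?K * (4 * (C + 1) * dir_energy m z + 6 * (B\<^sup>2 / 1 + 1) * C\<^sup>2 * (9 * dir_energy m z))"
    using Cm by (intro mult_left_mono[OF _ K] add_mono mult_right_mono mult_left_mono poincare m z dir_energy_nonneg) auto
  finally show "FP m d z \<le> ?K * (4 * (B\<^sup>2 + C) + 4 * (C + 1) + 54 * (B\<^sup>2 + 1) * C\<^sup>2) * dir_energy m z"
    using 1 by (simp add: algebra_simps)
qed

text \<open>With w = d z, a difference of z is a difference of w over d plus a multiple of w of
  order 1/m. Poincare applies to w, which is supported on the internal nodes too; the constants are
  4 = 2 * 2 and 216 = 4 * 6 * 9.\<close>

lemma FP_lower:
  assumes m: "m \<ge> 1" and z: "supp m z" and dd: "diag_data m C l B \<alpha> d" and l: "l > 0" and C: "C \<ge> 0"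
  shows "min ku kv * dir_energy m z \<le> (4 / l\<^sup>2 + 216 * (C / l\<^sup>2)\<^sup>2) * FP m d z"
proof -
  define w where "w = wt d z"
  have w: "supp m w" unfolding w_def by (rule supp_wt[OF z])
  have G: "Gf z t \<le> 2 / l\<^sup>2 * Gf w t + 4 * (C / l\<^sup>2)\<^sup>2 * (Vf w t / (real m)\<^sup>2)" if t: "t \<in> tris m" for t
  proof -
    have e: "(cmod (z (vtx t r) - z (vtx t 0)))\<^sup>2 \<le>
        2 / l\<^sup>2 * (cmod (w (vtx t r) - w (vtx t 0)))\<^sup>2 + 2 * (C / l\<^sup>2)\<^sup>2 * (Vf w t / (real m)\<^sup>2)" if r: "r < 3" for r
    proof -
      have r0: "(0::nat) < 3" by simp
      have h: "\<bar>d (vtx t 0) - d (vtx t r)\<bar> \<le> C / m" "l \<le> d (vtx t 0)" "l \<le> d (vtx t r)"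
        using dd t r r0 unfolding diag_data_def by blast+
      define d0 where "d0 = d (vtx t 0)"
      define d1 where "d1 = d (vtx t r)"
      have pos: "d0 > 0" "d1 > 0" "l \<le> d0" "l \<le> d1" "\<bar>d0 - d1\<bar> \<le> C / m" using h l by (auto simp: d0_def d1_def)
      have zw: "z (vtx t 0) = w (vtx t 0) / d0" "z (vtx t r) = w (vtx t r) / d1"
        using pos by (auto simp: w_def wt_def d0_def d1_def)
      have "z (vtx t r) - z (vtx t 0) = (w (vtx t r) - w (vtx t 0)) / d1 + complex_of_real ((d0 - d1) / (d0 * d1)) * w (vtx t 0)"
        unfolding zw using pos by (simp add: field_simps)
      then have "(cmod (z (vtx t r) - z (vtx t 0)))\<^sup>2 \<le> 2 * (cmod ((w (vtx t r) - w (vtx t 0)) / d1))\<^sup>2 +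
          2 * (cmod (complex_of_real ((d0 - d1) / (d0 * d1)) * w (vtx t 0)))\<^sup>2"
        by (metis cmod_add_sq)
      also have "(cmod ((w (vtx t r) - w (vtx t 0)) / d1))\<^sup>2 \<le> (cmod (w (vtx t r) - w (vtx t 0)))\<^sup>2 / l\<^sup>2"
        using pos l by (simp add: norm_divide power_divide) (intro divide_left_mono power_mono; simp)
      also have "(cmod (complex_of_real ((d0 - d1) / (d0 * d1)) * w (vtx t 0)))\<^sup>2 \<le> (C / m / l\<^sup>2 * cmod (w (vtx t 0)))\<^sup>2"
      proof (rule power_mono)
        have "l * l \<le> d0 * d1" using pos l by (intro mult_mono) auto
        then have "\<bar>d0 - d1\<bar> / (d0 * d1) \<le> C / m / l\<^sup>2"
          using pos l C by (intro frac_le) (auto simp: power2_eq_square)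
        then have "\<bar>(d0 - d1) / (d0 * d1)\<bar> \<le> C / m / l\<^sup>2" using pos by (simp add: abs_mult)
        then show "cmod (complex_of_real ((d0 - d1) / (d0 * d1)) * w (vtx t 0)) \<le> C / m / l\<^sup>2 * cmod (w (vtx t 0))"
          unfolding norm_mult norm_of_real by (intro mult_right_mono) auto
      qed simp
      also have "(C / m / l\<^sup>2 * cmod (w (vtx t 0)))\<^sup>2 = (C / l\<^sup>2)\<^sup>2 * ((cmod (w (vtx t 0)))\<^sup>2 / (real m)\<^sup>2)"
        by (simp add: power_mult_distrib power_divide)
      also have "\<dots> \<le> (C / l\<^sup>2)\<^sup>2 * (Vf w t / (real m)\<^sup>2)"
        unfolding Vf_def by (intro mult_left_mono divide_right_mono member_le_sum) auto
      finally show ?thesis by simp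
    qed
    have "(1::nat) < 3" "(2::nat) < 3" by simp_all
    from e[OF this(1)] e[OF this(2)] show ?thesis by (simp add: Gf_def DU_def DV_def distrib_left)
  qed
  have "dir_energy m z \<le> (\<Sum>t\<in>tris m. Gf z t)" by (rule sum_Gf_ge[OF z])
  also have "\<dots> \<le> (\<Sum>t\<in>tris m. 2 / l\<^sup>2 * Gf w t + 4 * (C / l\<^sup>2)\<^sup>2 * (Vf w t / (real m)\<^sup>2))" by (intro sum_mono G)
  also have "\<dots> = 2 / l\<^sup>2 * (\<Sum>t\<in>tris m. Gf w t) + 4 * (C / l\<^sup>2)\<^sup>2 * ((\<Sum>t\<in>tris m. Vf w t) / (real m)\<^sup>2)"
    by (simp only: sum.distrib sum_distrib_left sum_divide_distrib)
  also have "\<dots> \<le> 2 / l\<^sup>2 * (2 * dir_energy m w) + 4 * (C / l\<^sup>2)\<^sup>2 * (6 * sq_norm m w / (real m)\<^sup>2)"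
    by (intro add_mono mult_left_mono divide_right_mono sum_Gf_le sum_Vf) auto
  also have "\<dots> \<le> 2 / l\<^sup>2 * (2 * dir_energy m w) + 4 * (C / l\<^sup>2)\<^sup>2 * (54 * dir_energy m w)"
    using poincare[OF m w] by (intro add_mono mult_left_mono) auto
  finally have "dir_energy m z \<le> (4 / l\<^sup>2 + 216 * (C / l\<^sup>2)\<^sup>2) * dir_energy m w"
    by (simp add: algebra_simps)
  then have "min ku kv * dir_energy m z \<le> min ku kv * ((4 / l\<^sup>2 + 216 * (C / l\<^sup>2)\<^sup>2) * dir_energy m w)"
    using k_pos by (intro mult_left_mono) auto
  also have "\<dots> = (4 / l\<^sup>2 + 216 * (C / l\<^sup>2)\<^sup>2) * (min ku kv * dir_energy m w)" by (simp only: mult_ac)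
  also have "\<dots> \<le> (4 / l\<^sup>2 + 216 * (C / l\<^sup>2)\<^sup>2) * FP m d z"
  proof (intro mult_left_mono)
    have "min ku kv * dir_energy m w \<le> min ku kv * (\<Sum>t\<in>tris m. Gf w t)"
      using k_pos by (intro mult_left_mono sum_Gf_ge w) auto
    also have "\<dots> \<le> FP m d z"
      unfolding FP_def sum_distrib_left w_def by (intro sum_mono Gf_le)
    finally show "min ku kv * dir_energy m w \<le> FP m d z" .
  qed simp
  finally show ?thesis .
qed

lemma FT_lower:
  assumes z: "supp m z" and a: "\<And>t. t \<in> tris m \<Longrightarrow> \<alpha> t \<ge> l" and l: "l \<ge> 0"
  shows "l * (min ku kv * dir_energy m z) \<le> FT m \<alpha> z"
proof -
  have "min ku kv * dir_energy m z \<le> min ku kv * (\<Sum>t\<in>tris m. Gf z t)"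
    using k_pos by (intro mult_left_mono sum_Gf_ge z) auto
  also have "\<dots> \<le> (\<Sum>t\<in>tris m. Qf z t)" unfolding sum_distrib_left by (intro sum_mono Gf_le)
  finally have "l * (min ku kv * dir_energy m z) \<le> l * (\<Sum>t\<in>tris m. Qf z t)" using l by (rule mult_left_mono)
  also have "\<dots> \<le> FT m \<alpha> z" unfolding FT_def sum_distrib_left by (intro sum_mono mult_right_mono a Qf_nonneg)
  finally show ?thesis .
qed

end

section \<open>Matrices assembled from triangle data\<close>

lemma sesq_rank_one:
  fixes u v :: "nat \<Rightarrow> real"
  shows "(\<Sum>i<n. \<Sum>j<n. cnj (X i) * complex_of_real (u i * v j) * X j) =
     cnj (\<Sum>i<n. complex_of_real (u i) * X i) * (\<Sum>j<n. complex_of_real (v j) * X j)"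
  unfolding cnj_sum sum_product by (simp add: mult_ac)

context lattice_domain
begin

text \<open>The nodal values as a function on the whole lattice, extended by zero.\<close>

definition zf :: "nat \<Rightarrow> (nat \<Rightarrow> int \<times> int) \<Rightarrow> (nat \<Rightarrow> complex) \<Rightarrow> int \<times> int \<Rightarrow> complex" where
  "zf n \<kappa> X k = (\<Sum>i<n. complex_of_real (of_bool (k = \<kappa> i)) * X i)"

definition du :: "(int \<times> int) \<times> int \<Rightarrow> int \<times> int \<Rightarrow> real" where
  "du t k = of_bool (vtx t 1 = k) - of_bool (vtx t 0 = k)"
definition dv :: "(int \<times> int) \<times> int \<Rightarrow> int \<times> int \<Rightarrow> real" where
  "dv t k = of_bool (vtx t 2 = k) - of_bool (vtx t 0 = k)"

lemma gr_eq: "gr m t k = (of_int (snd t) * real m) *\<^sub>R (du t k *\<^sub>R p + dv t k *\<^sub>R q)"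
  by (simp add: gr_def gb_def sum3 du_def dv_def algebra_simps)

lemma DU_zf: "DU (zf n \<kappa> X) t = (\<Sum>i<n. complex_of_real (du t (\<kappa> i)) * X i)"
  and DV_zf: "DV (zf n \<kappa> X) t = (\<Sum>i<n. complex_of_real (dv t (\<kappa> i)) * X i)"
  by (simp_all add: DU_def DV_def zf_def du_def dv_def left_diff_distrib sum_subtractf)

lemma gr_inner:
  assumes "snd t = 1 \<or> snd t = -1"
  shows "inner (gr m t k) (gr m t k') = (real m)\<^sup>2 *
    (ku * (du t k' * du t k) + kv * (dv t k' * dv t k) + kd * ((du t k' - dv t k') * (du t k - dv t k)))"
proof -
  have "inner (gr m t k) (gr m t k') = (real m)\<^sup>2 * inner (du t k *\<^sub>R p + dv t k *\<^sub>R q) (du t k' *\<^sub>R p + dv t k' *\<^sub>R q)"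
    using assms by (auto simp: gr_eq power2_eq_square)
  also have "inner (du t k *\<^sub>R p + dv t k *\<^sub>R q) (du t k' *\<^sub>R p + dv t k' *\<^sub>R q) =
      ku * (du t k' * du t k) + kv * (dv t k' * dv t k) + kd * ((du t k' - dv t k') * (du t k - dv t k))"
    by (simp add: ku_def kv_def kd_def inner_add_left inner_add_right inner_commute[of q p] algebra_simps)
  finally show ?thesis .
qed

text \<open>A common shape for exact integration and quadrature: only the numbers \<alpha> attached
  to the triangles differ.\<close>

definition theta_mat :: "nat \<Rightarrow> nat \<Rightarrow> (nat \<Rightarrow> int \<times> int) \<Rightarrow> ((int \<times> int) \<times> int \<Rightarrow> real) \<Rightarrow> real mat" where
  "theta_mat m n \<kappa> \<alpha> = Matrix.mat n n (\<lambda>(i, j). area / (real m)\<^sup>2 *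
     (\<Sum>t\<in>tris m. \<alpha> t * inner (gr m t (\<kappa> j)) (gr m t (\<kappa> i))))"

definition psi_mat :: "nat \<Rightarrow> nat \<Rightarrow> (nat \<Rightarrow> int \<times> int) \<Rightarrow> ((int \<times> int) \<times> int \<Rightarrow> nat \<Rightarrow> R2) \<Rightarrow> real mat" where
  "psi_mat m n \<kappa> b = Matrix.mat n n (\<lambda>(i, j). - (area / (real m)\<^sup>2 *
     (\<Sum>t\<in>tris m. \<Sum>r<3. of_bool (vtx t r = \<kappa> j) * inner (b t r) (gr m t (\<kappa> i)))))"

text \<open>Each triangle contributes three matrices of rank one; the m^2 of the gradient products
  cancels the 1/m^2 of the triangle area.\<close>

lemma sesq_theta:
  assumes m: "m > 0"
  shows "sesq n (theta_mat m n \<kappa> \<alpha>) X X = complex_of_real (area * FT m \<alpha> (zf n \<kappa> X))"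
proof -
  let ?z = "zf n \<kappa> X"
  have e: "theta_mat m n \<kappa> \<alpha> $$ (i, j) = (\<Sum>t\<in>tris m. area * \<alpha> t *
      (ku * (du t (\<kappa> i) * du t (\<kappa> j)) + kv * (dv t (\<kappa> i) * dv t (\<kappa> j)) +
       kd * ((du t (\<kappa> i) - dv t (\<kappa> i)) * (du t (\<kappa> j) - dv t (\<kappa> j)))))" if "i < n" "j < n" for i j
    using that m by (simp add: theta_mat_def sum_distrib_left gr_inner[OF tris_sign] mult.assoc cong: sum.cong)
  have "sesq n (theta_mat m n \<kappa> \<alpha>) X X = (\<Sum>i<n. \<Sum>j<n. \<Sum>t\<in>tris m. complex_of_real (area * \<alpha> t) *
      (ku * (cnj (X i) * complex_of_real (du t (\<kappa> i) * du t (\<kappa> j)) * X j) +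
       kv * (cnj (X i) * complex_of_real (dv t (\<kappa> i) * dv t (\<kappa> j)) * X j) +
       kd * (cnj (X i) * complex_of_real ((du t (\<kappa> i) - dv t (\<kappa> i)) * (du t (\<kappa> j) - dv t (\<kappa> j))) * X j)))"
    unfolding sesq_def
    by (intro sum.cong refl) (simp add: e of_real_sum sum_distrib_left sum_distrib_right, intro sum.cong refl, simp add: algebra_simps)
  also have "\<dots> = (\<Sum>t\<in>tris m. \<Sum>i<n. \<Sum>j<n. complex_of_real (area * \<alpha> t) *
      (ku * (cnj (X i) * complex_of_real (du t (\<kappa> i) * du t (\<kappa> j)) * X j) +
       kv * (cnj (X i) * complex_of_real (dv t (\<kappa> i) * dv t (\<kappa> j)) * X j) +
       kd * (cnj (X i) * complex_of_real ((du t (\<kappa> i) - dv t (\<kappa> i)) * (du t (\<kappa> j) - dv t (\<kappa> j))) * X j)))"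
    (is "(\<Sum>i<n. \<Sum>j<n. \<Sum>t\<in>tris m. ?F i j t) = _")
  proof -
    have "(\<Sum>i<n. \<Sum>j<n. \<Sum>t\<in>tris m. ?F i j t) = (\<Sum>i<n. \<Sum>t\<in>tris m. \<Sum>j<n. ?F i j t)"
      by (intro sum.cong refl sum.swap)
    also have "\<dots> = (\<Sum>t\<in>tris m. \<Sum>i<n. \<Sum>j<n. ?F i j t)" by (rule sum.swap)
    finally show ?thesis .
  qed
  also have "\<dots> = (\<Sum>t\<in>tris m. complex_of_real (area * \<alpha> t) *
      (ku * (\<Sum>i<n. \<Sum>j<n. cnj (X i) * complex_of_real (du t (\<kappa> i) * du t (\<kappa> j)) * X j) +
       kv * (\<Sum>i<n. \<Sum>j<n. cnj (X i) * complex_of_real (dv t (\<kappa> i) * dv t (\<kappa> j)) * X j) +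
       kd * (\<Sum>i<n. \<Sum>j<n. cnj (X i) * complex_of_real ((du t (\<kappa> i) - dv t (\<kappa> i)) * (du t (\<kappa> j) - dv t (\<kappa> j))) * X j)))"
    by (simp only: sum_distrib_left distrib_left sum.distrib)
  also have "\<dots> = (\<Sum>t\<in>tris m. complex_of_real (area * \<alpha> t) *
      (ku * (cnj (DU ?z t) * DU ?z t) + kv * (cnj (DV ?z t) * DV ?z t) + kd * (cnj (DU ?z t - DV ?z t) * (DU ?z t - DV ?z t))))"
    unfolding sesq_rank_one DU_zf DV_zf by (simp only: of_real_diff left_diff_distrib sum_subtractf)
  also have "\<dots> = complex_of_real (area * FT m \<alpha> ?z)"
  proof -
    have "cnj w * w = complex_of_real ((cmod w)\<^sup>2)" for w by (metis complex_norm_square mult.commute)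
    then show ?thesis by (simp add: FT_def Qf_def sum_distrib_left of_real_sum mult.assoc del: complex_cnj_diff)
  qed
  finally show ?thesis .
qed

lemma sesq_psi:
  assumes m: "m > 0"
  shows "sesq n (psi_mat m n \<kappa> b) X X = complex_of_real area * FC m b (zf n \<kappa> X)"
proof -
  let ?z = "zf n \<kappa> X"
  define s where "s t = - area / m * of_int (snd t)" for t :: "(int \<times> int) \<times> int"
  define wp where "wp t j = (\<Sum>r<3. of_bool (vtx t r = \<kappa> j) * inner (b t r) p)" for t and j :: nat
  define wq where "wq t j = (\<Sum>r<3. of_bool (vtx t r = \<kappa> j) * inner (b t r) q)" for t and j :: nat
  have e: "psi_mat m n \<kappa> b $$ (i, j) = (\<Sum>t\<in>tris m. s t * (du t (\<kappa> i) * wp t j + dv t (\<kappa> i) * wq t j))"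
    if "i < n" "j < n" for i j
  proof -
    have h: "(\<Sum>r<3. of_bool (vtx t r = \<kappa> j) * inner (b t r) (gr m t (\<kappa> i))) =
        of_int (snd t) * m * (du t (\<kappa> i) * wp t j + dv t (\<kappa> i) * wq t j)" for t i j
      by (simp add: gr_eq sum3 wp_def wq_def inner_add_right algebra_simps)
    show ?thesis using that m unfolding psi_mat_def h
      by (simp add: s_def sum_distrib_left power2_eq_square mult.assoc flip: sum_negf)
  qed
  have wz: "(\<Sum>j<n. complex_of_real (wp t j) * X j) = (\<Sum>r<3. complex_of_real (inner (b t r) p) * ?z (vtx t r))"
    "(\<Sum>j<n. complex_of_real (wq t j) * X j) = (\<Sum>r<3. complex_of_real (inner (b t r) q) * ?z (vtx t r))" for t
    by (simp_all add: wp_def wq_def zf_def sum3 algebra_simps sum.distrib sum_distrib_left)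
  have "sesq n (psi_mat m n \<kappa> b) X X = (\<Sum>i<n. \<Sum>j<n. \<Sum>t\<in>tris m. complex_of_real (s t) *
      (cnj (X i) * complex_of_real (du t (\<kappa> i) * wp t j) * X j + cnj (X i) * complex_of_real (dv t (\<kappa> i) * wq t j) * X j))"
    unfolding sesq_def
    by (intro sum.cong refl) (simp add: e of_real_sum sum_distrib_left sum_distrib_right, intro sum.cong refl, simp add: algebra_simps)
  also have "\<dots> = (\<Sum>i<n. \<Sum>t\<in>tris m. \<Sum>j<n. complex_of_real (s t) *
      (cnj (X i) * complex_of_real (du t (\<kappa> i) * wp t j) * X j + cnj (X i) * complex_of_real (dv t (\<kappa> i) * wq t j) * X j))"
    by (intro sum.cong refl sum.swap)
  also have "\<dots> = (\<Sum>t\<in>tris m. \<Sum>i<n. \<Sum>j<n. complex_of_real (s t) *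
      (cnj (X i) * complex_of_real (du t (\<kappa> i) * wp t j) * X j + cnj (X i) * complex_of_real (dv t (\<kappa> i) * wq t j) * X j))"
    by (rule sum.swap)
  also have "\<dots> = (\<Sum>t\<in>tris m. complex_of_real (s t) *
      ((\<Sum>i<n. \<Sum>j<n. cnj (X i) * complex_of_real (du t (\<kappa> i) * wp t j) * X j) +
       (\<Sum>i<n. \<Sum>j<n. cnj (X i) * complex_of_real (dv t (\<kappa> i) * wq t j) * X j)))"
    by (simp only: sum_distrib_left distrib_left sum.distrib)
  also have "\<dots> = (\<Sum>t\<in>tris m. complex_of_real area * Pf m b ?z t)"
    unfolding sesq_rank_one wz DU_zf[symmetric] DV_zf[symmetric]
    by (intro sum.cong refl) (simp add: Pf_def s_def algebra_simps)
  finally show ?thesis by (simp add: FC_def sum_distrib_left)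
qed

lemma supp_zf: "(\<And>i. i < n \<Longrightarrow> \<kappa> i \<in> nodes m) \<Longrightarrow> supp m (zf n \<kappa> X)"
  unfolding supp_def zf_def by (intro allI impI sum.neutral ballI) auto

lemma zf_at: "inj_on \<kappa> {..<n} \<Longrightarrow> i < n \<Longrightarrow> zf n \<kappa> X (\<kappa> i) = X i"
proof -
  assume "inj_on \<kappa> {..<n}" "i < n"
  then have "zf n \<kappa> X (\<kappa> i) = (\<Sum>j<n. if j = i then X j else 0)"
    unfolding zf_def by (intro sum.cong) (auto dest: inj_onD)
  then show ?thesis using \<open>i < n\<close> by simp
qed

text \<open>The diagonal entries of \<open>D\<^sub>n(a)\<close>, as weighted means of \<open>\<alpha>\<close> over the triangles around a node.\<close>

definition wmean :: "nat \<Rightarrow> ((int \<times> int) \<times> int \<Rightarrow> real) \<Rightarrow> int \<times> int \<Rightarrow> real" where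
  "wmean m \<alpha> k = (\<Sum>t\<in>tris m. \<alpha> t * inner (gr m t k) (gr m t k)) / (\<Sum>t\<in>tris m. inner (gr m t k) (gr m t k))"

lemma gr_nonzero: "gr m t k \<noteq> 0 \<Longrightarrow> \<exists>r<3. vtx t r = k"
  unfolding gr_def using sum.neutral[of "{..<3::nat}" "\<lambda>r. of_bool (vtx t r = k) *\<^sub>R gb m t r"] by fastforce

lemma gr_sum_pos:
  assumes m: "m > 0" and k: "k \<in> nodes m"
  shows "(\<Sum>t\<in>tris m. inner (gr m t k) (gr m t k)) > 0"
proof (rule sum_pos2[OF finite_tris])
  show "(k, 1) \<in> tris m" by (rule tris_node[of _ 0]) (use k in \<open>auto simp: vtx_def\<close>)
  have "inner (gr m (k, 1) k) (gr m (k, 1) k) = (real m)\<^sup>2 * (ku + kv)"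
    by (simp add: gr_inner du_def dv_def vtx_def prod_eq_iff)
  then show "0 < inner (gr m (k, 1) k) (gr m (k, 1) k)" using m k_pos by simp
qed simp

text \<open>Only triangles with vertex \<open>k\<close> carry weight, so closeness on these is
  enough.\<close>

lemma wmean_close:
  assumes m: "m > 0" and k: "k \<in> nodes m"
    and a: "\<And>t r. t \<in> tris m \<Longrightarrow> r < 3 \<Longrightarrow> vtx t r = k \<Longrightarrow> \<bar>\<alpha> t - v\<bar> \<le> e"
  shows "\<bar>wmean m \<alpha> k - v\<bar> \<le> e"
proof -
  define w where "w t = inner (gr m t k) (gr m t k)" for t
  have W: "(\<Sum>t\<in>tris m. w t) > 0" unfolding w_def by (rule gr_sum_pos[OF m k])
  have "\<bar>(\<Sum>t\<in>tris m. \<alpha> t * w t) - v * (\<Sum>t\<in>tris m. w t)\<bar> = \<bar>\<Sum>t\<in>tris m. (\<alpha> t - v) * w t\<bar>"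
    by (simp add: left_diff_distrib sum_subtractf sum_distrib_left)
  also have "\<dots> \<le> (\<Sum>t\<in>tris m. e * w t)"
  proof (rule order_trans[OF sum_abs], rule sum_mono)
    fix t assume t: "t \<in> tris m"
    show "\<bar>(\<alpha> t - v) * w t\<bar> \<le> e * w t"
    proof (cases "gr m t k = 0")
      case False
      then obtain r where "r < 3" "vtx t r = k" using gr_nonzero by blast
      then show ?thesis using a[OF t] by (simp add: w_def abs_mult mult_right_mono)
    qed (simp add: w_def)
  qed
  also have "\<dots> = e * (\<Sum>t\<in>tris m. w t)" by (simp add: sum_distrib_left)
  finally have 1: "\<bar>(\<Sum>t\<in>tris m. \<alpha> t * w t) - v * (\<Sum>t\<in>tris m. w t)\<bar> \<le> e * (\<Sum>t\<in>tris m. w t)" .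
  have "(wmean m \<alpha> k - v) * (\<Sum>t\<in>tris m. w t) = (\<Sum>t\<in>tris m. \<alpha> t * w t) - v * (\<Sum>t\<in>tris m. w t)"
    using W unfolding wmean_def w_def by (simp add: left_diff_distrib)
  then have "\<bar>wmean m \<alpha> k - v\<bar> * (\<Sum>t\<in>tris m. w t) = \<bar>(\<Sum>t\<in>tris m. \<alpha> t * w t) - v * (\<Sum>t\<in>tris m. w t)\<bar>"
    using W by (metis abs_mult abs_of_pos)
  then have "\<bar>wmean m \<alpha> k - v\<bar> * (\<Sum>t\<in>tris m. w t) \<le> e * (\<Sum>t\<in>tris m. w t)" using 1 by linarith
  then show ?thesis by (rule mult_right_le_imp_le[OF _ W])
qed

lemma minv_mat_diag:
  assumes f: "\<And>i. i < n \<Longrightarrow> f i \<noteq> (0::real)"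
  shows "minv (mat_diag n f) = mat_diag n (\<lambda>i. inverse (f i))"
proof -
  let ?D = "mat_diag n f" and ?E = "mat_diag n (\<lambda>i. inverse (f i))"
  have DE: "?D * ?E = 1\<^sub>m n" "?E * ?D = 1\<^sub>m n"
    unfolding mat_diag_diag using f by (auto intro!: eq_matI simp: mat_diag_def)
  have c: "?D \<in> carrier_mat n n" "?E \<in> carrier_mat n n" by (auto simp: mat_diag_def)
  have "det ?D * det ?E = 1" using det_mult[OF c] DE by simp
  then have "det ?D \<noteq> 0" by auto
  note i = minv_inverse[OF c(1) this]
  have "minv ?D = minv ?D * (?D * ?E)" unfolding DE(1) right_mult_one_mat[OF i(2)] ..
  also have "\<dots> = (minv ?D * ?D) * ?E" by (rule assoc_mult_mat[OF i(2) c(1,2), symmetric])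
  also have "\<dots> = ?E" unfolding i(4) by (rule left_mult_one_mat[OF c(2)])
  finally show ?thesis .
qed

lemma precond_entry:
  assumes A: "A \<in> carrier_mat n n" "B \<in> carrier_mat n n" and B: "\<And>i. i < n \<Longrightarrow> B $$ (i, i) \<noteq> 0"
  shows "precond A B = Matrix.mat n n (\<lambda>(i, j). sqrt (A $$ (i,i) / B $$ (i,i)) * B $$ (i, j) * sqrt (A $$ (j,j) / B $$ (j,j)))"
proof -
  have d: "diag_part A * minv (diag_part B) = mat_diag n (\<lambda>i. A $$ (i,i) / B $$ (i,i))"
    using A B by (simp add: diag_part_def minv_mat_diag mat_diag_diag divide_inverse)
  have R: "diag_sqrt (mat_diag n (\<lambda>i. A $$ (i,i) / B $$ (i,i))) = mat_diag n (\<lambda>i. sqrt (A $$ (i,i) / B $$ (i,i)))"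
    unfolding diag_sqrt_def by (intro eq_matI) (auto simp: mat_diag_def)
  show ?thesis unfolding precond_def d Let_def R
    using A by (intro eq_matI) (auto simp: mat_diag_mult_left mat_diag_mult_right[of _ n n] mat_diag_def
        scalar_prod_def if_distrib if_distribR sum.delta cong: if_cong)
qed

lemma theta_carrier: "theta_mat m n \<kappa> \<alpha> \<in> carrier_mat n n" and psi_carrier: "psi_mat m n \<kappa> b \<in> carrier_mat n n"
  by (simp_all add: theta_mat_def psi_mat_def)

lemma theta_diag_pos:
  assumes m: "m > 0" and \<kappa>: "\<kappa> i \<in> nodes m" and i: "i < n"
  shows "theta_mat m n \<kappa> (\<lambda>_. 1) $$ (i, i) > 0"
  using gr_sum_pos[OF m \<kappa>] area_pos m i by (simp add: theta_mat_def)

text \<open>In the quotient of the diagonals the common factor cancels and \<open>wmean\<close>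
  remains. The outer diagonal factors then move onto the vector, so P has the form of Theta(1)
  evaluated at \<open>wt d\<close>.\<close>

lemma precond_theta:
  assumes m: "m > 0" and \<kappa>: "\<And>i. i < n \<Longrightarrow> \<kappa> i \<in> nodes m"
    and d: "\<And>i. i < n \<Longrightarrow> d (\<kappa> i) = sqrt (wmean m \<alpha> (\<kappa> i))"
  shows "precond (theta_mat m n \<kappa> \<alpha>) (theta_mat m n \<kappa> (\<lambda>_. 1)) \<in> carrier_mat n n"
    and "\<And>i j. i < n \<Longrightarrow> j < n \<Longrightarrow> precond (theta_mat m n \<kappa> \<alpha>) (theta_mat m n \<kappa> (\<lambda>_. 1)) $$ (i, j) =
       precond (theta_mat m n \<kappa> \<alpha>) (theta_mat m n \<kappa> (\<lambda>_. 1)) $$ (j, i)"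
    and "sesq n (precond (theta_mat m n \<kappa> \<alpha>) (theta_mat m n \<kappa> (\<lambda>_. 1))) X X = complex_of_real (area * FP m d (zf n \<kappa> X))"
proof -
  let ?A = "theta_mat m n \<kappa> \<alpha>" and ?B = "theta_mat m n \<kappa> (\<lambda>_. 1)"
  have P: "precond ?A ?B = Matrix.mat n n (\<lambda>(i, j). sqrt (?A $$ (i,i) / ?B $$ (i,i)) * ?B $$ (i, j) * sqrt (?A $$ (j,j) / ?B $$ (j,j)))"
    by (rule precond_entry[OF theta_carrier theta_carrier]) (use theta_diag_pos[OF m \<kappa>] in fastforce)
  have D: "sqrt (?A $$ (i,i) / ?B $$ (i,i)) = d (\<kappa> i)" if "i < n" for i
    using that d[OF that] area_pos m by (simp add: theta_mat_def wmean_def)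
  have E: "precond ?A ?B $$ (i, j) = d (\<kappa> i) * ?B $$ (i, j) * d (\<kappa> j)" if "i < n" "j < n" for i j
    unfolding P using that by (simp add: D)
  show "precond ?A ?B \<in> carrier_mat n n" unfolding P by simp
  show "precond ?A ?B $$ (i, j) = precond ?A ?B $$ (j, i)" if "i < n" "j < n" for i j
    using E[OF that] E[OF that(2,1)] that by (simp add: theta_mat_def inner_commute mult_ac)
  have zf: "zf n \<kappa> (\<lambda>i. complex_of_real (d (\<kappa> i)) * X i) = wt d (zf n \<kappa> X)"
    unfolding zf_def wt_def sum_distrib_left fun_eq_iff by (intro allI sum.cong refl) auto
  have "sesq n (precond ?A ?B) X X = sesq n ?B (\<lambda>i. complex_of_real (d (\<kappa> i)) * X i) (\<lambda>i. complex_of_real (d (\<kappa> i)) * X i)"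
    unfolding sesq_def by (intro sum.cong refl) (simp add: E mult_ac)
  also have "\<dots> = complex_of_real (area * FP m d (zf n \<kappa> X))"
    by (simp add: sesq_theta[OF m] zf FT_def FP_def)
  finally show "sesq n (precond ?A ?B) X X = complex_of_real (area * FP m d (zf n \<kappa> X))" .
qed

end

section \<open>Triangle means by exact integration and by quadrature\<close>

lemma sum_list_abs_le:
  fixes f :: "'a \<Rightarrow> 'b::real_normed_vector"
  assumes "\<And>x. x \<in> set xs \<Longrightarrow> norm (f x) \<le> g x * e"
  shows "norm (\<Sum>x\<leftarrow>xs. f x) \<le> (\<Sum>x\<leftarrow>xs. g x) * (e::real)"
  using assms
proof (induction xs)
  case (Cons x xs)
  have "norm (f x + (\<Sum>x\<leftarrow>xs. f x)) \<le> g x * e + (\<Sum>x\<leftarrow>xs. g x) * e"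
    using Cons by (intro norm_triangle_mono) auto
  then show ?case by (simp add: distrib_right)
qed simp

context lattice_domain
begin

definition dia :: real where "dia = norm uu + norm vv"

lemma dia_nonneg: "dia \<ge> 0" by (simp add: dia_def)

lemma hull_diam:
  assumes m: "m > 0" and s: "snd t = 1 \<or> snd t = -1" and y: "y \<in> convex hull (tri m t)" and r: "r < 3"
  shows "norm (y - nd m (vtx t r)) \<le> dia / m"
proof -
  have nd1: "nd m (k + (i, j)) - nd m (k + (i', j')) = (of_int (i - i') / m) *\<^sub>R uu + (of_int (j - j') / m) *\<^sub>R vv" for k i j i' j'
    by (simp add: nd_def add_divide_distrib diff_divide_distrib scaleR_add_left scaleR_diff_left)
  have v: "vtx t r' = fst t + (if r' = 1 then (snd t, 0) else if r' = 0 then (0, 0) else (0, snd t))" for r'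
    by (simp add: vtx_def prod_eq_iff)
  have e: "norm (nd m (vtx t r) - nd m (vtx t r')) \<le> dia / m" if "r' < 3" for r'
  proof -
    have c: "norm ((of_int i / m) *\<^sub>R uu + (of_int j / m) *\<^sub>R vv) \<le> dia / m" if "\<bar>i\<bar> \<le> 1" "\<bar>j\<bar> \<le> 1" for i j
    proof -
      have "norm ((of_int i / m) *\<^sub>R uu + (of_int j / m) *\<^sub>R vv) \<le> \<bar>of_int i\<bar> / m * norm uu + \<bar>of_int j\<bar> / m * norm vv"
        by (rule order_trans[OF norm_triangle_ineq]) simp
      also have "\<dots> \<le> 1 / m * norm uu + 1 / m * norm vv"
      proof (intro add_mono mult_right_mono divide_right_mono)
        show "\<bar>real_of_int i\<bar> \<le> 1" "\<bar>real_of_int j\<bar> \<le> 1" using that by (metis of_int_1_le_iff of_int_abs of_int_le_1_iff)+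
      qed auto
      finally show ?thesis by (simp add: dia_def add_divide_distrib)
    qed
    show ?thesis using s unfolding v by (auto simp only: nd1 split: if_splits intro!: c)
  qed
  then have "tri m t \<subseteq> cball (nd m (vtx t r)) (dia / m)"
    using e[of 0] e[of 1] e[of 2] by (simp add: tri_def dist_norm)
  then have "convex hull (tri m t) \<subseteq> cball (nd m (vtx t r)) (dia / m)" by (rule hull_minimal) simp
  then show ?thesis using y by (auto simp: dist_norm norm_minus_commute)
qed

lemma bary_le1:
  assumes m: "m > 0" and s: "snd t = 1 \<or> snd t = -1" and y: "y \<in> convex hull (tri m t)" and r: "r < 3"
  shows "\<bar>bary m t r y\<bar> \<le> 1"
proof -
  have "0 \<le> bary m t 0 y" "0 \<le> bary m t 1 y" "0 \<le> bary m t 2 y" "bary m t 0 y + bary m t 1 y + bary m t 2 y = 1"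
    using y sum_bary[of m t y] unfolding hull_iff[OF m s] all3 sum3 by auto
  moreover have "r = 0 \<or> r = 1 \<or> r = 2" using r by auto
  ultimately show ?thesis by auto
qed

definition hm :: "nat \<Rightarrow> (int \<times> int) \<times> int \<Rightarrow> real" where "hm m t = measure lebesgue (convex hull (tri m t))"

definition ma :: "nat \<Rightarrow> (R2 \<Rightarrow> real) \<Rightarrow> (int \<times> int) \<times> int \<Rightarrow> real" where
  "ma m a t = (1 / hm m t) *\<^sub>R integral (convex hull (tri m t)) a"

text \<open>On a triangle the basis function of vertex \<open>r\<close> is the barycentric
  coordinate \<open>r\<close>, so these vector means are all that the convection matrix sees of
  \<beta>.\<close>

definition mb :: "nat \<Rightarrow> (R2 \<Rightarrow> R2) \<Rightarrow> (int \<times> int) \<times> int \<Rightarrow> nat \<Rightarrow> R2" where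
  "mb m \<beta> t r = (1 / hm m t) *\<^sub>R integral (convex hull (tri m t)) (\<lambda>y. bary m t r y *\<^sub>R \<beta> y)"

lemma hm_eq: "m > 0 \<Longrightarrow> t \<in> tris m \<Longrightarrow> hm m t = area / (real m)\<^sup>2"
  unfolding hm_def by (rule measure_tri[OF _ tris_sign])

lemma hm_pos: "m > 0 \<Longrightarrow> t \<in> tris m \<Longrightarrow> hm m t > 0"
  using area_pos by (simp add: hm_eq)

lemma hull_closure: "m > 0 \<Longrightarrow> t \<in> tris m \<Longrightarrow> convex hull (tri m t) \<subseteq> closure \<Omega>"
  using hull_subset_closure tris_sign by blast

lemma vtx_closure: "m > 0 \<Longrightarrow> t \<in> tris m \<Longrightarrow> r < 3 \<Longrightarrow> nd m (vtx t r) \<in> closure \<Omega>"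
  using nd_closure vtx_cnodes by blast

lemma int_bary:
  fixes \<beta> :: "R2 \<Rightarrow> R2"
  assumes m: "m > 0" and \<beta>: "continuous_on (closure \<Omega>) \<beta>" and t: "t \<in> tris m"
  shows "(\<lambda>y. bary m t r y *\<^sub>R \<beta> y) integrable_on convex hull (tri m t)"
  by (intro integrable_on_compact_continuous compact_hull continuous_intros bary_continuous
      continuous_on_subset[OF \<beta> hull_closure[OF m t]])

text \<open>The gradients are constant on each triangle off the null set of edges.\<close>

lemma stiff_has_integral:
  assumes m: "m > 0" and k: "k \<in> nodes m" "k' \<in> nodes m" and a: "continuous_on (closure \<Omega>) a"
  shows "((\<lambda>y. a y * inner (grad (hatf m k') y) (grad (hatf m k) y)) has_integral
    area / (real m)\<^sup>2 * (\<Sum>t\<in>tris m. ma m a t * inner (gr m t k') (gr m t k))) \<Omega>"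
proof -
  have "((\<lambda>y. a y * inner (grad (hatf m k') y) (grad (hatf m k) y)) has_integral
      integral (convex hull (tri m t)) a * inner (gr m t k') (gr m t k)) (convex hull (tri m t))" if t: "t \<in> tris m" for t
  proof (rule has_integral_spike[OF negligible_grid[OF m]])
    show "((\<lambda>y. a y * inner (gr m t k') (gr m t k)) has_integral
      integral (convex hull (tri m t)) a * inner (gr m t k') (gr m t k)) (convex hull (tri m t))"
      by (intro has_integral_mult_left integrable_integral integrable_on_compact_continuous compact_hull
          continuous_on_subset[OF a hull_closure[OF m t]])
    fix y assume "y \<in> convex hull (tri m t) - grid m"
    then have "y \<in> tint m t" using hull_off_grid[OF m tris_sign[OF t]] by blast
    then show "a y * inner (grad (hatf m k') y) (grad (hatf m k) y) = a y * inner (gr m t k') (gr m t k)"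
      using k t by (simp add: grad_hatf[OF m])
  qed
  from has_integral_tris[OF m this]
  have "((\<lambda>y. a y * inner (grad (hatf m k') y) (grad (hatf m k) y)) has_integral
    (\<Sum>t\<in>tris m. integral (convex hull (tri m t)) a * inner (gr m t k') (gr m t k))) \<Omega>" by simp
  also have "(\<Sum>t\<in>tris m. integral (convex hull (tri m t)) a * inner (gr m t k') (gr m t k)) =
      (\<Sum>t\<in>tris m. area / (real m)\<^sup>2 * (ma m a t * inner (gr m t k') (gr m t k)))"
  proof (rule sum.cong[OF refl])
    fix t assume t: "t \<in> tris m"
    have "integral (convex hull (tri m t)) a = area / (real m)\<^sup>2 * ma m a t"
      using hm_pos[OF m t] by (simp add: ma_def flip: hm_eq[OF m t])
    then show "integral (convex hull (tri m t)) a * inner (gr m t k') (gr m t k) =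
        area / (real m)\<^sup>2 * (ma m a t * inner (gr m t k') (gr m t k))" by (simp only: mult.assoc)
  qed
  finally show ?thesis by (simp only: sum_distrib_left)
qed

lemma conv_has_integral:
  assumes m: "m > 0" and k: "k \<in> nodes m" "k' \<in> nodes m" and \<beta>: "continuous_on (closure \<Omega>) \<beta>"
  shows "((\<lambda>y. inner (\<beta> y) (grad (hatf m k) y) * hatf m k' y) has_integral
    area / (real m)\<^sup>2 * (\<Sum>t\<in>tris m. \<Sum>r<3. of_bool (vtx t r = k') * inner (mb m \<beta> t r) (gr m t k))) \<Omega>"
proof -
  let ?I = "\<lambda>t r. integral (convex hull (tri m t)) (\<lambda>y. bary m t r y *\<^sub>R \<beta> y)"
  have "((\<lambda>y. inner (\<beta> y) (grad (hatf m k) y) * hatf m k' y) has_integral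
      (\<Sum>r<3. of_bool (vtx t r = k') * inner (?I t r) (gr m t k))) (convex hull (tri m t))" if t: "t \<in> tris m" for t
  proof (rule has_integral_spike[OF negligible_grid[OF m]])
    have "((\<lambda>y. inner (bary m t r y *\<^sub>R \<beta> y) (gr m t k)) has_integral inner (?I t r) (gr m t k)) (convex hull (tri m t))" for r
      using has_integral_linear[OF integrable_integral[OF int_bary[OF m \<beta> t, of r]] bounded_linear_inner_left[of "gr m t k"]]
      by (simp add: o_def)
    then show "((\<lambda>y. \<Sum>r<3. of_bool (vtx t r = k') * inner (bary m t r y *\<^sub>R \<beta> y) (gr m t k)) has_integral
      (\<Sum>r<3. of_bool (vtx t r = k') * inner (?I t r) (gr m t k))) (convex hull (tri m t))"
      by (intro has_integral_sum has_integral_mult_right) auto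
    fix y assume y: "y \<in> convex hull (tri m t) - grid m"
    then have "y \<in> tint m t" using hull_off_grid[OF m tris_sign[OF t]] by blast
    then have "grad (hatf m k) y = gr m t k" by (rule grad_hatf[OF m k(1) t])
    moreover have "hatf m k' y = (\<Sum>r<3. bary m t r y * of_bool (vtx t r = k'))"
      using y by (intro hatf_tri[OF m k(2) t]) auto
    ultimately show "inner (\<beta> y) (grad (hatf m k) y) * hatf m k' y =
        (\<Sum>r<3. of_bool (vtx t r = k') * inner (bary m t r y *\<^sub>R \<beta> y) (gr m t k))"
      by (simp add: sum_distrib_left mult_ac)
  qed
  from has_integral_tris[OF m this]
  have "((\<lambda>y. inner (\<beta> y) (grad (hatf m k) y) * hatf m k' y) has_integral
    (\<Sum>t\<in>tris m. \<Sum>r<3. of_bool (vtx t r = k') * inner (?I t r) (gr m t k))) \<Omega>" by simp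
  also have "(\<Sum>t\<in>tris m. \<Sum>r<3. of_bool (vtx t r = k') * inner (?I t r) (gr m t k)) =
      (\<Sum>t\<in>tris m. area / (real m)\<^sup>2 * (\<Sum>r<3. of_bool (vtx t r = k') * inner (mb m \<beta> t r) (gr m t k)))"
  proof (rule sum.cong[OF refl])
    fix t assume t: "t \<in> tris m"
    have "?I t r = (area / (real m)\<^sup>2) *\<^sub>R mb m \<beta> t r" for r
      using hm_pos[OF m t] by (simp add: mb_def flip: hm_eq[OF m t])
    then show "(\<Sum>r<3. of_bool (vtx t r = k') * inner (?I t r) (gr m t k)) =
        area / (real m)\<^sup>2 * (\<Sum>r<3. of_bool (vtx t r = k') * inner (mb m \<beta> t r) (gr m t k))"
      by (simp only: sum_distrib_left inner_scaleR_left mult.left_commute)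
  qed
  finally show ?thesis by (simp only: sum_distrib_left)
qed

lemma ma_close:
  assumes m: "m > 0" and t: "t \<in> tris m" and r: "r < 3" and a: "continuous_on (closure \<Omega>) a"
    and L: "\<And>y y'. y \<in> closure \<Omega> \<Longrightarrow> y' \<in> closure \<Omega> \<Longrightarrow> norm (a y - a y') \<le> L * norm (y - y')" and L0: "L \<ge> 0"
  shows "\<bar>ma m a t - a (nd m (vtx t r))\<bar> \<le> L * dia / m"
proof -
  have "norm (ma m a t - a (nd m (vtx t r))) \<le> L * (dia / m)"
    unfolding ma_def hm_def
  proof (rule mean_close[OF compact_hull])
    fix y assume y: "y \<in> convex hull (tri m t)"
    then have "norm (a y - a (nd m (vtx t r))) \<le> L * norm (y - nd m (vtx t r))"
      using hull_closure[OF m t] vtx_closure[OF m t r] by (intro L) auto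
    also have "\<dots> \<le> L * (dia / m)" by (intro mult_left_mono hull_diam[OF m tris_sign[OF t] y r] L0)
    finally show "norm (a y - a (nd m (vtx t r))) \<le> L * (dia / m)" .
  qed (use hm_pos[OF m t] continuous_on_subset[OF a hull_closure[OF m t]] in \<open>auto simp: hm_def\<close>)
  then show ?thesis by simp
qed

lemma ma_ge:
  assumes m: "m > 0" and t: "t \<in> tris m" and a: "continuous_on (closure \<Omega>) a"
    and ge: "\<And>y. y \<in> closure \<Omega> \<Longrightarrow> l \<le> a y"
  shows "l \<le> ma m a t"
proof -
  let ?K = "convex hull (tri m t)"
  have i: "a integrable_on ?K" "(\<lambda>y. 1::real) integrable_on ?K"
    by (intro integrable_on_compact_continuous compact_hull continuous_on_subset[OF a hull_closure[OF m t]] continuous_intros)+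
  have "integral ?K (\<lambda>y. l * 1) \<le> integral ?K a"
    using ge hull_closure[OF m t] i by (intro integral_le integrable_on_mult_right) auto
  moreover have "integral ?K (\<lambda>y. 1::real) = hm m t"
    unfolding hm_def using lmeasure_integral[OF lmeasurable_compact[OF compact_hull]] by simp
  ultimately have "l * hm m t \<le> integral ?K a" by (simp only: integral_mult_right)
  then show ?thesis using hm_pos[OF m t] by (simp add: ma_def pos_le_divide_eq)
qed

lemma mb_bound:
  assumes m: "m > 0" and t: "t \<in> tris m" and r: "r < 3" and \<beta>: "continuous_on (closure \<Omega>) \<beta>"
    and B: "\<And>y. y \<in> closure \<Omega> \<Longrightarrow> norm (\<beta> y) \<le> B"
  shows "norm (mb m \<beta> t r) \<le> B"
proof -
  have "norm (mb m \<beta> t r - 0) \<le> B"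
    unfolding mb_def hm_def
  proof (rule mean_close[OF compact_hull])
    fix y assume y: "y \<in> convex hull (tri m t)"
    then have "norm (bary m t r y *\<^sub>R \<beta> y) \<le> 1 * B"
      using B[of y] hull_closure[OF m t] bary_le1[OF m tris_sign[OF t] y r]
      unfolding norm_scaleR by (intro mult_mono) auto
    then show "norm (bary m t r y *\<^sub>R \<beta> y - 0) \<le> B" by simp
  qed (use hm_pos[OF m t] in \<open>auto simp: hm_def intro!: continuous_intros bary_continuous continuous_on_subset[OF \<beta> hull_closure[OF m t]]\<close>)
  then show ?thesis by simp
qed

text \<open>The barycentric coordinates add up to 1, so the three means add up to the mean of
  \<beta>.\<close>

lemma mb_sum:
  assumes m: "m > 0" and t: "t \<in> tris m" and \<beta>: "continuous_on (closure \<Omega>) \<beta>"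
    and L: "\<And>y y'. y \<in> closure \<Omega> \<Longrightarrow> y' \<in> closure \<Omega> \<Longrightarrow> norm (\<beta> y - \<beta> y') \<le> L * norm (y - y')" and L0: "L \<ge> 0"
  shows "norm ((\<Sum>r<3. mb m \<beta> t r) - \<beta> (nd m (vtx t 0))) \<le> L * dia / m"
proof -
  let ?K = "convex hull (tri m t)"
  have r0: "(0::nat) < 3" by simp
  have "(\<Sum>r<3. mb m \<beta> t r) = (1 / hm m t) *\<^sub>R integral ?K (\<lambda>y. \<Sum>r<3. bary m t r y *\<^sub>R \<beta> y)"
    unfolding mb_def scaleR_sum_right[symmetric] by (subst integral_sum) (auto intro: int_bary[OF m \<beta> t])
  also have "(\<lambda>y. \<Sum>r<3. bary m t r y *\<^sub>R \<beta> y) = \<beta>"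
    using sum_bary[of m t] by (simp add: fun_eq_iff flip: scaleR_sum_left)
  finally have e: "(\<Sum>r<3. mb m \<beta> t r) = (1 / hm m t) *\<^sub>R integral ?K \<beta>" .
  have "norm ((\<Sum>r<3. mb m \<beta> t r) - \<beta> (nd m (vtx t 0))) \<le> L * (dia / m)"
    unfolding e unfolding hm_def
  proof (rule mean_close[OF compact_hull])
    fix y assume y: "y \<in> convex hull (tri m t)"
    then have "norm (\<beta> y - \<beta> (nd m (vtx t 0))) \<le> L * norm (y - nd m (vtx t 0))"
      using hull_closure[OF m t] vtx_closure[OF m t r0] by (intro L) auto
    also have "\<dots> \<le> L * (dia / m)" by (intro mult_left_mono hull_diam[OF m tris_sign[OF t] y r0] L0)
    finally show "norm (\<beta> y - \<beta> (nd m (vtx t 0))) \<le> L * (dia / m)" .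
  qed (use hm_pos[OF m t] continuous_on_subset[OF \<beta> hull_closure[OF m t]] in \<open>auto simp: hm_def\<close>)
  then show ?thesis by simp
qed

definition qpt :: "nat \<Rightarrow> (R2 set \<Rightarrow> nat \<Rightarrow> R2) \<Rightarrow> (int \<times> int) \<times> int \<Rightarrow> R2 \<Rightarrow> R2" where
  "qpt m \<nu> t \<xi> = ref_map (\<nu> (tri m t)) \<xi>"

definition qa :: "quadrature \<Rightarrow> (R2 set \<Rightarrow> nat \<Rightarrow> R2) \<Rightarrow> nat \<Rightarrow> (R2 \<Rightarrow> real) \<Rightarrow> (int \<times> int) \<times> int \<Rightarrow> real" where
  "qa qf \<nu> m a t = (\<Sum>x\<leftarrow>qf. fst x * a (qpt m \<nu> t (snd x)))"

definition qb :: "quadrature \<Rightarrow> (R2 set \<Rightarrow> nat \<Rightarrow> R2) \<Rightarrow> nat \<Rightarrow> (R2 \<Rightarrow> R2) \<Rightarrow> (int \<times> int) \<times> int \<Rightarrow> nat \<Rightarrow> R2" where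
  "qb qf \<nu> m \<beta> t r = (\<Sum>x\<leftarrow>qf. (fst x * bary m t r (qpt m \<nu> t (snd x))) *\<^sub>R \<beta> (qpt m \<nu> t (snd x)))"

definition qW :: "quadrature \<Rightarrow> real" where "qW qf = (\<Sum>x\<leftarrow>qf. fst x)"
text \<open>Weights may be negative: their sum \<open>qW\<close> governs consistency, the sum of
  their absolute values the error bounds.\<close>

definition qN :: "quadrature \<Rightarrow> real" where "qN qf = (\<Sum>x\<leftarrow>qf. \<bar>fst x\<bar>)"

lemma qN_nonneg: "qN qf \<ge> 0" unfolding qN_def by (rule sum_list_nonneg) auto

text \<open>Whatever the local numbering, a transported node is a convex combination of the
  vertices.\<close>

lemma qpt_hull:
  assumes qf: "quadrature_formula qf" and \<nu>: "local_numbering (tri m ` tris m) \<nu>" and t: "t \<in> tris m" and x: "x \<in> set qf"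
  shows "qpt m \<nu> t (snd x) \<in> convex hull (tri m t)"
proof -
  let ?s = "\<nu> (tri m t)" and ?\<xi> = "snd x"
  have b: "bij_betw ?s {..<3} (tri m t)" using \<nu> t by (auto simp: local_numbering_def)
  have s: "?s r \<in> convex hull (tri m t)" if "r < 3" for r
    using bij_betwE[OF b] that by (auto intro: hull_inc)
  have xi: "0 \<le> fst ?\<xi>" "0 \<le> snd ?\<xi>" "fst ?\<xi> + snd ?\<xi> \<le> 1"
    using qf x unfolding quadrature_formula_def by (auto simp: case_prod_beta)
  have "qpt m \<nu> t ?\<xi> = (\<Sum>r<3. (if r = 0 then 1 - fst ?\<xi> - snd ?\<xi> else if r = 1 then fst ?\<xi> else snd ?\<xi>) *\<^sub>R ?s r)"
    by (simp add: qpt_def ref_map_def sum3 algebra_simps)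
  also have "\<dots> \<in> convex hull (tri m t)"
    using s xi by (intro convex_sum) (auto simp: sum3 convex_convex_hull)
  finally show ?thesis .
qed

text \<open>The comparison value contains \<open>qW qf\<close>, since exactness on constants is not
  known at this stage.\<close>

lemma qa_close:
  assumes m: "m > 0" and qf: "quadrature_formula qf" and \<nu>: "local_numbering (tri m ` tris m) \<nu>" and t: "t \<in> tris m" and r: "r < 3"
    and L: "\<And>y y'. y \<in> closure \<Omega> \<Longrightarrow> y' \<in> closure \<Omega> \<Longrightarrow> norm (a y - a y') \<le> L * norm (y - y')" and L0: "L \<ge> 0"
  shows "\<bar>qa qf \<nu> m a t - qW qf * a (nd m (vtx t r))\<bar> \<le> qN qf * L * dia / m"
proof -
  have "qa qf \<nu> m a t - qW qf * a (nd m (vtx t r)) = (\<Sum>x\<leftarrow>qf. fst x * (a (qpt m \<nu> t (snd x)) - a (nd m (vtx t r))))"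
    by (simp add: qa_def qW_def right_diff_distrib sum_list_subtractf sum_list_mult_const)
  also have "norm \<dots> \<le> qN qf * (L * (dia / m))"
    unfolding qN_def
  proof (rule sum_list_abs_le)
    fix x assume x: "x \<in> set qf"
    note y = qpt_hull[OF qf \<nu> t x]
    then have "norm (a (qpt m \<nu> t (snd x)) - a (nd m (vtx t r))) \<le> L * norm (qpt m \<nu> t (snd x) - nd m (vtx t r))"
      using hull_closure[OF m t] vtx_closure[OF m t r] by (intro L) auto
    also have "\<dots> \<le> L * (dia / m)" by (intro mult_left_mono hull_diam[OF m tris_sign[OF t] y r] L0)
    finally show "norm (fst x * (a (qpt m \<nu> t (snd x)) - a (nd m (vtx t r)))) \<le> \<bar>fst x\<bar> * (L * (dia / m))"
      using mult_left_mono[OF _ abs_ge_zero[of "fst x"]] by (simp only: real_norm_def abs_mult)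
  qed
  finally show ?thesis by (simp add: mult.assoc)
qed

lemma qb_bound:
  assumes m: "m > 0" and qf: "quadrature_formula qf" and \<nu>: "local_numbering (tri m ` tris m) \<nu>" and t: "t \<in> tris m" and r: "r < 3"
    and B: "\<And>y. y \<in> closure \<Omega> \<Longrightarrow> norm (\<beta> y) \<le> B"
  shows "norm (qb qf \<nu> m \<beta> t r) \<le> qN qf * B"
  unfolding qb_def qN_def
proof (rule sum_list_abs_le)
  fix x assume x: "x \<in> set qf"
  note y = qpt_hull[OF qf \<nu> t x]
  have "\<bar>bary m t r (qpt m \<nu> t (snd x))\<bar> * norm (\<beta> (qpt m \<nu> t (snd x))) \<le> 1 * B"
    using y B[of "qpt m \<nu> t (snd x)"] hull_closure[OF m t] bary_le1[OF m tris_sign[OF t] y r] by (intro mult_mono) auto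
  then show "norm ((fst x * bary m t r (qpt m \<nu> t (snd x))) *\<^sub>R \<beta> (qpt m \<nu> t (snd x))) \<le> \<bar>fst x\<bar> * B"
    by (simp add: abs_mult mult_left_mono mult.assoc)
qed

text \<open>As for the exact means, the barycentric coordinates add up to 1 at every quadrature
  node.\<close>

lemma qb_sum:
  assumes m: "m > 0" and qf: "quadrature_formula qf" and \<nu>: "local_numbering (tri m ` tris m) \<nu>" and t: "t \<in> tris m"
    and L: "\<And>y y'. y \<in> closure \<Omega> \<Longrightarrow> y' \<in> closure \<Omega> \<Longrightarrow> norm (\<beta> y - \<beta> y') \<le> L * norm (y - y')" and L0: "L \<ge> 0"
  shows "norm ((\<Sum>r<3. qb qf \<nu> m \<beta> t r) - qW qf *\<^sub>R \<beta> (nd m (vtx t 0))) \<le> qN qf * L * dia / m"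
proof -
  have r0: "(0::nat) < 3" by simp
  have e: "(\<Sum>x\<leftarrow>xs. (fst x * bary m t 0 (qpt m \<nu> t (snd x))) *\<^sub>R \<beta> (qpt m \<nu> t (snd x))) +
      (\<Sum>x\<leftarrow>xs. (fst x * bary m t 1 (qpt m \<nu> t (snd x))) *\<^sub>R \<beta> (qpt m \<nu> t (snd x))) +
      (\<Sum>x\<leftarrow>xs. (fst x * bary m t 2 (qpt m \<nu> t (snd x))) *\<^sub>R \<beta> (qpt m \<nu> t (snd x))) - (\<Sum>x\<leftarrow>xs. fst x) *\<^sub>R v =
      (\<Sum>x\<leftarrow>xs. fst x *\<^sub>R (\<beta> (qpt m \<nu> t (snd x)) - v))" for xs :: quadrature and v
  proof (induction xs)
    case (Cons x xs)
    have b: "bary m t 0 y = 1 - bary m t 1 y - bary m t 2 y" for y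
      using sum_bary[of m t y] by (simp add: sum3)
    show ?case using Cons unfolding b by (simp add: algebra_simps)
  qed simp
  have "(\<Sum>r<3. qb qf \<nu> m \<beta> t r) - qW qf *\<^sub>R \<beta> (nd m (vtx t 0)) = (\<Sum>x\<leftarrow>qf. fst x *\<^sub>R (\<beta> (qpt m \<nu> t (snd x)) - \<beta> (nd m (vtx t 0))))"
    unfolding sum3 qb_def qW_def by (rule e)
  also have "norm \<dots> \<le> qN qf * (L * (dia / m))"
    unfolding qN_def
  proof (rule sum_list_abs_le)
    fix x assume x: "x \<in> set qf"
    note y = qpt_hull[OF qf \<nu> t x]
    then have "norm (\<beta> (qpt m \<nu> t (snd x)) - \<beta> (nd m (vtx t 0))) \<le> L * norm (qpt m \<nu> t (snd x) - nd m (vtx t 0))"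
      using hull_closure[OF m t] vtx_closure[OF m t r0] by (intro L) auto
    also have "\<dots> \<le> L * (dia / m)" by (intro mult_left_mono hull_diam[OF m tris_sign[OF t] y r0] L0)
    finally show "norm (fst x *\<^sub>R (\<beta> (qpt m \<nu> t (snd x)) - \<beta> (nd m (vtx t 0)))) \<le> \<bar>fst x\<bar> * (L * (dia / m))"
      using mult_left_mono[OF _ abs_ge_zero[of "fst x"]] by (simp only: norm_scaleR)
  qed
  finally show ?thesis by (simp add: mult.assoc)
qed

text \<open>Brings the exact and the computed matrices to the same shape, so that one spectral
  argument covers both.\<close>

lemma matrices_eq:
  assumes m: "m > 0" and \<kappa>: "\<And>i. i < n \<Longrightarrow> \<kappa> i \<in> nodes m \<and> x i = nd m (\<kappa> i)"
    and n: "num_nodes \<Omega> (tri m ` tris m) = n"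
  shows "continuous_on (closure \<Omega>) a \<Longrightarrow> stiffness \<Omega> (tri m ` tris m) x a = theta_mat m n \<kappa> (ma m a)"
    and "continuous_on (closure \<Omega>) \<beta> \<Longrightarrow> convection \<Omega> (tri m ` tris m) x \<beta> = psi_mat m n \<kappa> (mb m \<beta>)"
    and "quadrature_formula qf \<Longrightarrow> local_numbering (tri m ` tris m) \<nu> \<Longrightarrow>
      stiffness_quad qf \<nu> \<Omega> (tri m ` tris m) x a = theta_mat m n \<kappa> (qa qf \<nu> m a)"
    and "quadrature_formula qf \<Longrightarrow> local_numbering (tri m ` tris m) \<nu> \<Longrightarrow>
      convection_quad qf \<nu> \<Omega> (tri m ` tris m) x \<beta> = psi_mat m n \<kappa> (qb qf \<nu> m \<beta>)"
proof -
  show "stiffness \<Omega> (tri m ` tris m) x a = theta_mat m n \<kappa> (ma m a)" if a: "continuous_on (closure \<Omega>) a"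
    unfolding stiffness_def theta_mat_def n
    by (rule cong_mat) (use \<kappa> integral_unique[OF stiff_has_integral[OF m _ _ a]] in auto)
  show "convection \<Omega> (tri m ` tris m) x \<beta> = psi_mat m n \<kappa> (mb m \<beta>)" if b: "continuous_on (closure \<Omega>) \<beta>"
    unfolding convection_def psi_mat_def n
    by (rule cong_mat) (use \<kappa> integral_unique[OF conv_has_integral[OF m _ _ b]] in auto)
  have meas: "quad_triangle qf \<nu> (tri m t) g = area / (real m)\<^sup>2 * (\<Sum>x\<leftarrow>qf. fst x * g (qpt m \<nu> t (snd x)))"
    if "t \<in> tris m" for t g
    unfolding quad_triangle_def measure_tri[OF m tris_sign[OF that]] qpt_def by (simp add: case_prod_unfold)
  show "stiffness_quad qf \<nu> \<Omega> (tri m ` tris m) x a = theta_mat m n \<kappa> (qa qf \<nu> m a)"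
    if qf: "quadrature_formula qf" "local_numbering (tri m ` tris m) \<nu>"
    unfolding stiffness_quad_def theta_mat_def n
  proof (rule cong_mat[OF refl refl], clarify)
    fix i j assume ij: "i < n" "j < n"
    have "(\<Sum>S\<in>tri m ` tris m. quad_triangle qf \<nu> S
        (\<lambda>y. a y * inner (tri_grad S (hat \<Omega> (tri m ` tris m) (x j))) (tri_grad S (hat \<Omega> (tri m ` tris m) (x i))))) =
      (\<Sum>t\<in>tris m. area / (real m)\<^sup>2 * (qa qf \<nu> m a t * inner (gr m t (\<kappa> j)) (gr m t (\<kappa> i))))"
      unfolding sum.reindex[OF inj_tri[OF m]] o_def
      using \<kappa>[OF ij(1)] \<kappa>[OF ij(2)]
      by (intro sum.cong refl) (simp add: meas tri_grad_hatf[OF m] qa_def sum_list_mult_const flip: mult.assoc)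
    then show "(\<Sum>S\<in>tri m ` tris m. quad_triangle qf \<nu> S
        (\<lambda>y. a y * inner (tri_grad S (hat \<Omega> (tri m ` tris m) (x j))) (tri_grad S (hat \<Omega> (tri m ` tris m) (x i))))) =
      area / (real m)\<^sup>2 * (\<Sum>t\<in>tris m. qa qf \<nu> m a t * inner (gr m t (\<kappa> j)) (gr m t (\<kappa> i)))"
      by (simp only: sum_distrib_left)
  qed
  show "convection_quad qf \<nu> \<Omega> (tri m ` tris m) x \<beta> = psi_mat m n \<kappa> (qb qf \<nu> m \<beta>)"
    if qf: "quadrature_formula qf" "local_numbering (tri m ` tris m) \<nu>"
    unfolding convection_quad_def psi_mat_def n
  proof (rule cong_mat[OF refl refl], clarify)
    fix i j assume ij: "i < n" "j < n"
    have "(\<Sum>S\<in>tri m ` tris m. quad_triangle qf \<nu> S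
        (\<lambda>y. inner (\<beta> y) (tri_grad S (hat \<Omega> (tri m ` tris m) (x i))) * hat \<Omega> (tri m ` tris m) (x j) y)) =
      (\<Sum>t\<in>tris m. area / (real m)\<^sup>2 * (\<Sum>r<3. of_bool (vtx t r = \<kappa> j) * inner (qb qf \<nu> m \<beta> t r) (gr m t (\<kappa> i))))"
      unfolding sum.reindex[OF inj_tri[OF m]] o_def
    proof (rule sum.cong[OF refl])
      fix t assume t: "t \<in> tris m"
      let ?g = "gr m t (\<kappa> i)"
      have "(\<Sum>x\<leftarrow>qf. fst x * (inner (\<beta> (qpt m \<nu> t (snd x))) ?g * hatf m (\<kappa> j) (qpt m \<nu> t (snd x)))) =
          (\<Sum>x\<leftarrow>qf. \<Sum>r<3. of_bool (vtx t r = \<kappa> j) * inner ((fst x * bary m t r (qpt m \<nu> t (snd x))) *\<^sub>R \<beta> (qpt m \<nu> t (snd x))) ?g)"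
      proof (rule arg_cong[where f=sum_list], rule map_cong[OF refl])
        fix x assume "x \<in> set qf"
        from hatf_tri[OF m _ t qpt_hull[OF qf t this]] \<kappa>[OF ij(2)]
        show "fst x * (inner (\<beta> (qpt m \<nu> t (snd x))) ?g * hatf m (\<kappa> j) (qpt m \<nu> t (snd x))) =
          (\<Sum>r<3. of_bool (vtx t r = \<kappa> j) * inner ((fst x * bary m t r (qpt m \<nu> t (snd x))) *\<^sub>R \<beta> (qpt m \<nu> t (snd x))) ?g)"
          by (simp add: sum3 algebra_simps)
      qed
      also have "\<dots> = (\<Sum>r<3. of_bool (vtx t r = \<kappa> j) * inner (qb qf \<nu> m \<beta> t r) ?g)"
        unfolding qb_def sum3 by (induction qf) (simp_all add: inner_add_left distrib_left)
      finally show "quad_triangle qf \<nu> (tri m t)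
          (\<lambda>y. inner (\<beta> y) (tri_grad (tri m t) (hat \<Omega> (tri m ` tris m) (x i))) * hat \<Omega> (tri m ` tris m) (x j) y) =
          area / (real m)\<^sup>2 * (\<Sum>r<3. of_bool (vtx t r = \<kappa> j) * inner (qb qf \<nu> m \<beta> t r) ?g)"
        using \<kappa>[OF ij(1)] \<kappa>[OF ij(2)] t by (simp only: meas tri_grad_hatf[OF m])
    qed
    then show "- (\<Sum>S\<in>tri m ` tris m. quad_triangle qf \<nu> S
        (\<lambda>y. inner (\<beta> y) (tri_grad S (hat \<Omega> (tri m ` tris m) (x i))) * hat \<Omega> (tri m ` tris m) (x j) y)) =
      - (area / (real m)\<^sup>2 * (\<Sum>t\<in>tris m. \<Sum>r<3. of_bool (vtx t r = \<kappa> j) * inner (qb qf \<nu> m \<beta> t r) (gr m t (\<kappa> i))))"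
      by (simp only: sum_distrib_left)
  qed
qed

end

section \<open>The sign of the convection form\<close>

lemma lborel_translation:
  fixes F :: "R2 \<Rightarrow> real"
  assumes F: "integrable lborel F"
  shows "integrable lborel (\<lambda>y. F (v + y))" "integral\<^sup>L lborel (\<lambda>y. F (v + y)) = integral\<^sup>L lborel F"
proof -
  have m: "(+) v \<in> lborel \<rightarrow>\<^sub>M borel" by simp
  have Fm: "F \<in> borel_measurable borel" using F borel_measurable_integrable by fastforce
  have "integrable (distr lborel borel ((+) v)) F" using F by (simp add: lborel_distr_plus)
  then show "integrable lborel (\<lambda>y. F (v + y))" by (subst (asm) integrable_distr_eq[OF m Fm])
  have "integral\<^sup>L lborel F = integral\<^sup>L (distr lborel borel ((+) v)) F" by (simp add: lborel_distr_plus)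
  also have "\<dots> = integral\<^sup>L lborel (\<lambda>y. F (v + y))" by (rule integral_distr[OF m Fm])
  finally show "integral\<^sup>L lborel (\<lambda>y. F (v + y)) = integral\<^sup>L lborel F" by simp
qed

text \<open>The divergence theorem for a Lipschitz function of bounded support: the integrals of its difference quotients
  vanish by translation invariance, and dominated convergence applies.\<close>

lemma integral_directional_derivative:
  fixes F G :: "R2 \<Rightarrow> real"
  assumes lip: "\<And>y z. \<bar>F y - F z\<bar> \<le> L * norm (y - z)" and L: "L \<ge> 0"
    and zero: "\<And>y. norm y > R \<Longrightarrow> F y = 0" and N: "negligible N" and v: "norm v = 1"
    and der: "\<And>y. y \<notin> N \<Longrightarrow> ((\<lambda>s. F (y + s *\<^sub>R v)) has_real_derivative G y) (at 0)"
  shows "(G has_integral 0) UNIV"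
proof -
  have cont: "continuous_on A F" for A
  proof (rule lipschitz_on_continuous_on)
    show "L-lipschitz_on A F" by (rule lipschitz_onI) (use lip L in \<open>auto simp: dist_norm\<close>)
  qed
  have iF: "integrable lborel F"
  proof -
    have "integrable lborel (\<lambda>y. indicator (cball 0 R) y *\<^sub>R F y)"
      by (rule borel_integrable_compact) (auto intro: cont)
    moreover have "(\<lambda>y. indicator (cball 0 R) y *\<^sub>R F y) = F"
      using zero by (auto simp: fun_eq_iff indicator_def)
    ultimately show ?thesis by simp
  qed
  define Q where "Q k y = real (Suc k) * (F ((1 / real (Suc k)) *\<^sub>R v + y) - F y)" for k y
  have iQ: "(Q k has_integral 0) UNIV" for k
  proof -
    let ?v = "(1 / real (Suc k)) *\<^sub>R v"
    note T = lborel_translation[OF iF, of ?v]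
    have "((\<lambda>y. real (Suc k) * (F (?v + y) - F y)) has_integral real (Suc k) * (integral\<^sup>L lborel F - integral\<^sup>L lborel F)) UNIV"
      using has_integral_integral_lborel[OF T(1)] has_integral_integral_lborel[OF iF] unfolding T(2)
      by (intro has_integral_mult_right has_integral_diff)
    then show ?thesis unfolding Q_def[abs_def] by simp
  qed
  \<comment> \<open>The steps have length at most 1, so the difference quotients vanish outside the
    ball of radius R + 1; inside, the Lipschitz constant dominates them.\<close>
  define H where "H y = (if y \<in> cball (0::R2) (R + 1) then L else 0)" for y
  have iH: "H integrable_on UNIV"
  proof -
    have "(\<lambda>y. L) integrable_on cball (0::R2) (R + 1)"
      by (intro integrable_on_compact_continuous continuous_intros compact_cball)
    then show ?thesis unfolding H_def[abs_def] integrable_restrict_UNIV .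
  qed
  have bd: "norm (Q k y) \<le> H y" for k y
  proof (cases "norm y \<le> R + 1")
    case True
    have "\<bar>F ((1 / real (Suc k)) *\<^sub>R v + y) - F y\<bar> \<le> L * (1 / real (Suc k))"
      using lip[of "(1 / real (Suc k)) *\<^sub>R v + y" y] v by simp
    then have "real (Suc k) * \<bar>F ((1 / real (Suc k)) *\<^sub>R v + y) - F y\<bar> \<le> real (Suc k) * (L * (1 / real (Suc k)))"
      by (intro mult_left_mono) auto
    then show ?thesis using True by (simp add: Q_def H_def abs_mult)
  next
    case False
    have "norm y \<le> norm ((1 / real (Suc k)) *\<^sub>R v + y) + norm ((1 / real (Suc k)) *\<^sub>R v)"
      using norm_triangle_ineq4[of "(1 / real (Suc k)) *\<^sub>R v + y" "(1 / real (Suc k)) *\<^sub>R v"] by simp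
    moreover have "norm ((1 / real (Suc k)) *\<^sub>R v) \<le> 1" using v by simp
    ultimately have "norm ((1 / real (Suc k)) *\<^sub>R v + y) > R" "norm y > R" using False by linarith+
    then show ?thesis using L by (simp add: Q_def H_def zero)
  qed
  have lim: "(\<lambda>k. Q k y) \<longlonglongrightarrow> G y" if y: "y \<notin> N" for y
  proof -
    have "((\<lambda>h. (F (y + h *\<^sub>R v) - F y) / h) \<longlongrightarrow> G y) (at 0)"
      using der[OF y] by (simp add: has_field_derivative_iff)
    moreover have "filterlim (\<lambda>k. 1 / real (Suc k)) (at 0) sequentially"
      unfolding filterlim_at using LIMSEQ_inverse_real_of_nat by (simp add: divide_inverse)
    ultimately have "(\<lambda>k. (F (y + (1 / real (Suc k)) *\<^sub>R v) - F y) / (1 / real (Suc k))) \<longlonglongrightarrow> G y"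
      by (rule filterlim_compose)
    then show ?thesis by (simp add: Q_def mult.commute add.commute)
  qed
  \<comment> \<open>Setting both functions to zero on \<open>N\<close> makes the convergence hold at
    every point.\<close>
  define Q' where "Q' k y = (if y \<in> N then 0 else Q k y)" for k y
  define G' where "G' y = (if y \<in> N then 0 else G y)" for y
  have iQ': "(Q' k has_integral 0) UNIV" for k
    by (rule has_integral_spike[OF N _ iQ[of k]]) (simp add: Q'_def)
  have bd': "norm (Q' k y) \<le> H y" for k y
    using bd[of k y] norm_ge_zero[of "Q k y"] by (simp add: Q'_def) linarith
  have lim': "(\<lambda>k. Q' k y) \<longlonglongrightarrow> G' y" for y
    using lim[of y] by (simp add: Q'_def G'_def)
  have "G' integrable_on UNIV" "(\<lambda>k. integral UNIV (Q' k)) \<longlonglongrightarrow> integral UNIV G'"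
    using iQ' by (auto intro!: dominated_convergence[OF _ iH bd' lim'] simp: integrable_on_def)
  moreover have "integral UNIV (Q' k) = 0" for k using iQ' by (rule integral_unique)
  ultimately have "(G' has_integral 0) UNIV"
    by (simp add: has_integral_iff LIMSEQ_const_iff)
  then show ?thesis by (rule has_integral_spike[OF N, rotated]) (simp add: G'_def)
qed

text \<open>Mean value inequality on the convex open set, where the derivative is bounded, then
  passage to the closure by continuity.\<close>

lemma C1_closure_lipschitz:
  assumes \<Omega>: "open \<Omega>" "convex \<Omega>" "compact (closure \<Omega>)" and f: "C1_closure \<Omega> f"
  shows "\<exists>L\<ge>0. \<forall>y\<in>closure \<Omega>. \<forall>z\<in>closure \<Omega>. norm (f y - f z) \<le> L * norm (y - z)"
proof -
  from f obtain f' where c: "continuous_on (closure \<Omega>) f"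
    and d: "\<And>x. x \<in> \<Omega> \<Longrightarrow> (f has_derivative blinfun_apply (f' x)) (at x)"
    and c': "continuous_on (closure \<Omega>) f'" unfolding C1_closure_def by auto
  have "bounded (f' ` closure \<Omega>)" by (intro compact_imp_bounded compact_continuous_image c' \<Omega>(3))
  then obtain B where B: "\<And>x. x \<in> closure \<Omega> \<Longrightarrow> norm (f' x) \<le> B" unfolding bounded_iff by auto
  define L where "L = max B 0"
  have "norm (f x - f y) \<le> L * norm (x - y)" if "x \<in> \<Omega>" "y \<in> \<Omega>" for x y
  proof (rule differentiable_bound[OF \<Omega>(2) _ _ that])
    fix z assume z: "z \<in> \<Omega>"
    then show "(f has_derivative blinfun_apply (f' z)) (at z within \<Omega>)" using d has_derivative_at_withinI by blast
    show "onorm (blinfun_apply (f' z)) \<le> L"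
      using B[of z] z closure_subset[of \<Omega>] unfolding norm_blinfun.rep_eq[symmetric] L_def by auto
  qed
  then have "L-lipschitz_on \<Omega> f" unfolding lipschitz_on_def dist_norm by (simp add: L_def)
  from lipschitz_on_closure[OF this c] have "L-lipschitz_on (closure \<Omega>) f" .
  then show ?thesis unfolding lipschitz_on_def dist_norm by auto
qed

context lattice_domain
begin

text \<open>For the real combination w of basis functions, the product of \<beta> and w^2, extended
  by zero, is Lipschitz on the whole plane, so no boundary integral appears. w is built from
  \<open>phi\<close>, which unlike \<open>hat\<close> is controlled outside the closure.
  \<open>I i j\<close> lacks the minus sign of the convection matrix, hence the reversed
  inequality.\<close>

lemma convection_form_nonneg:
  fixes X :: "nat \<Rightarrow> real"
  assumes m: "m > 0" and \<kappa>: "\<And>i. i < n \<Longrightarrow> \<kappa> i \<in> nodes m"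
    and \<beta>: "C1_closure \<Omega> \<beta>" and div: "\<And>y. y \<in> \<Omega> \<Longrightarrow> divergence \<beta> y \<ge> 0"
    and I: "\<And>i j. i < n \<Longrightarrow> j < n \<Longrightarrow> ((\<lambda>y. inner (\<beta> y) (grad (hatf m (\<kappa> i)) y) * hatf m (\<kappa> j) y) has_integral I i j) \<Omega>"
  shows "(\<Sum>i<n. \<Sum>j<n. X i * X j * I i j) \<le> 0"
proof -
  from \<beta> obtain \<beta>' where \<beta>c: "continuous_on (closure \<Omega>) \<beta>"
    and \<beta>d: "\<And>x. x \<in> \<Omega> \<Longrightarrow> (\<beta> has_derivative blinfun_apply (\<beta>' x)) (at x)" unfolding C1_closure_def by auto
  obtain L\<beta> where L\<beta>: "L\<beta> \<ge> 0" "\<And>y z. y \<in> closure \<Omega> \<Longrightarrow> z \<in> closure \<Omega> \<Longrightarrow> norm (\<beta> y - \<beta> z) \<le> L\<beta> * norm (y - z)"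
    using C1_closure_lipschitz[OF open_Omega convex_Omega compact_closure_Omega \<beta>] by blast
  have "bounded (\<beta> ` closure \<Omega>)" by (intro compact_imp_bounded compact_continuous_image \<beta>c compact_closure_Omega)
  then obtain B where B: "B > 0" "\<And>y. y \<in> closure \<Omega> \<Longrightarrow> norm (\<beta> y) \<le> B" unfolding bounded_pos by auto
  define w where "w y = (\<Sum>i<n. X i * phi m (\<kappa> i) y)" for y
  define S where "S = (\<Sum>i<n. \<bar>X i\<bar>)"
  define K where "K = S * (m * (norm p + norm q))"
  have S0: "S \<ge> 0" "K \<ge> 0" by (auto simp: S_def K_def intro!: sum_nonneg mult_nonneg_nonneg)
  have wlip: "\<bar>w y - w z\<bar> \<le> K * norm (y - z)" for y z
  proof -
    have "\<bar>w y - w z\<bar> = \<bar>\<Sum>i<n. X i * (phi m (\<kappa> i) y - phi m (\<kappa> i) z)\<bar>"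
      by (simp add: w_def right_diff_distrib sum_subtractf)
    also have "\<dots> \<le> (\<Sum>i<n. \<bar>X i\<bar> * (m * (norm p + norm q) * norm (y - z)))"
      by (intro order_trans[OF sum_abs] sum_mono) (simp only: abs_mult, intro mult_left_mono phi_lipschitz abs_ge_zero)
    finally show ?thesis by (simp add: K_def S_def sum_distrib_right mult.assoc)
  qed
  have wbd: "\<bar>w y\<bar> \<le> S" for y
  proof -
    have "\<bar>w y\<bar> \<le> (\<Sum>i<n. \<bar>X i\<bar> * 1)"
      unfolding w_def by (intro order_trans[OF sum_abs] sum_mono) (simp only: abs_mult, intro mult_left_mono, auto simp: phi_def)
    then show ?thesis by (simp add: S_def)
  qed
  have wzero: "w y = 0" if "y \<notin> \<Omega>" for y using phi_outside[OF m \<kappa> that] by (simp add: w_def)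
  define F where "F b y = (if y \<in> \<Omega> then inner (\<beta> y) b * (w y)\<^sup>2 else 0)" for b y
  have Flip: "\<bar>F b y - F b z\<bar> \<le> (L\<beta> * S\<^sup>2 + 2 * B * S * K) * norm (y - z)" if b: "norm b = 1" for b y z
  proof -
    have bb: "\<bar>inner x b\<bar> \<le> norm x" for x using Cauchy_Schwarz_ineq2[of x b] b by simp
    \<comment> \<open>Across the boundary, w(z) = 0 turns one factor w(y) into the difference w(y) -
      w(z).\<close>
    have outside: "\<bar>F b y - F b z\<bar> \<le> (L\<beta> * S\<^sup>2 + 2 * B * S * K) * norm (y - z)" if "y \<in> \<Omega>" "z \<notin> \<Omega>" for y z
    proof -
      have "\<bar>F b y - F b z\<bar> = \<bar>inner (\<beta> y) b\<bar> * (\<bar>w y\<bar> * \<bar>w y - w z\<bar>)"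
        using that wzero[of z] by (simp add: F_def abs_mult power2_eq_square)
      also have "\<dots> \<le> B * (S * (K * norm (y - z)))"
        using that closure_subset[of \<Omega>] wbd wlip S0 B order_trans[OF bb B(2)[of y]] by (intro mult_mono) auto
      also have "\<dots> \<le> (L\<beta> * S\<^sup>2 + 2 * B * S * K) * norm (y - z)"
      proof -
        have "0 \<le> B * S * K" "0 \<le> L\<beta> * S\<^sup>2" using B S0 L\<beta> by auto
        then have "B * S * K * norm (y - z) \<le> (L\<beta> * S\<^sup>2 + 2 * B * S * K) * norm (y - z)"
          by (intro mult_right_mono) (auto simp: mult_ac)
        then show ?thesis by (simp add: mult.assoc)
      qed
      finally show ?thesis .
    qed
    consider "y \<in> \<Omega>" "z \<in> \<Omega>" | "y \<in> \<Omega>" "z \<notin> \<Omega>" | "y \<notin> \<Omega>" "z \<in> \<Omega>" | "y \<notin> \<Omega>" "z \<notin> \<Omega>" by blast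
    then show ?thesis
    proof cases
      case 1
      then have cl: "y \<in> closure \<Omega>" "z \<in> closure \<Omega>" using closure_subset by auto
      have "F b y - F b z = inner (\<beta> y - \<beta> z) b * (w y)\<^sup>2 + inner (\<beta> z) b * ((w y + w z) * (w y - w z))"
        using 1 by (simp add: F_def inner_diff_left algebra_simps power2_eq_square)
      also have "\<bar>\<dots>\<bar> \<le> \<bar>inner (\<beta> y - \<beta> z) b\<bar> * \<bar>w y\<bar>\<^sup>2 + \<bar>inner (\<beta> z) b\<bar> * (\<bar>w y + w z\<bar> * \<bar>w y - w z\<bar>)"
        by (rule order_trans[OF abs_triangle_ineq]) (simp add: abs_mult)
      also have "\<dots> \<le> (L\<beta> * norm (y - z)) * S\<^sup>2 + B * ((2 * S) * (K * norm (y - z)))"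
      proof (intro add_mono mult_mono power_mono wlip wbd)
        show "\<bar>inner (\<beta> y - \<beta> z) b\<bar> \<le> L\<beta> * norm (y - z)" using bb L\<beta>(2)[OF cl] order_trans by blast
        show "\<bar>inner (\<beta> z) b\<bar> \<le> B" using bb B(2)[OF cl(2)] order_trans by blast
        show "\<bar>w y + w z\<bar> \<le> 2 * S" using wbd[of y] wbd[of z] by linarith
      qed (use S0 B L\<beta> in auto)
      finally show ?thesis by (simp add: algebra_simps)
    next
      case 3
      then show ?thesis using outside[of z y] by (simp add: abs_minus_commute norm_minus_commute)
    next
      case 4
      have "0 \<le> L\<beta> * S\<^sup>2 + 2 * B * S * K" using B S0 L\<beta> by auto
      then show ?thesis using 4 by (simp add: F_def)
    qed (rule outside)
  qed
  obtain R where R: "\<And>y. y \<in> \<Omega> \<Longrightarrow> norm y \<le> R" using bounded_Omega unfolding bounded_iff by auto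
  define g where "g t = (\<Sum>i<n. X i *\<^sub>R gr m t (\<kappa> i))" for t
  have wt: "w y = (\<Sum>j<n. X j * hatf m (\<kappa> j) y)" if "t \<in> tris m" "y \<in> convex hull (tri m t)" for t y
    unfolding w_def using \<kappa> that
    by (intro sum.cong refl) (simp add: phi_tri[OF m tris_sign] hatf_tri[OF m])
  have wder: "(w has_derivative inner (g t)) (at y)" if t: "t \<in> tris m" and y: "y \<in> tint m t" for t y
  proof -
    have aff: "w z = inner (g t) z + (\<Sum>i<n. X i * (\<Sum>r<3. bary m t r 0 * of_bool (vtx t r = \<kappa> i)))" if z: "z \<in> tint m t" for z
    proof -
      have "z \<in> convex hull (tri m t)" using tint_hull[OF m tris_sign[OF t]] z by blast
      from phi_tri[OF m tris_sign[OF t] this]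
      have "phi m k z = inner (gr m t k) z + (\<Sum>r<3. bary m t r 0 * of_bool (vtx t r = k))" for k
        unfolding gr_def using combo_inner[of m t z "\<lambda>r. of_bool (vtx t r = k)"] by simp
      then show ?thesis by (simp add: w_def g_def inner_sum_left distrib_left sum.distrib)
    qed
    have "((\<lambda>z. inner (g t) z + (\<Sum>i<n. X i * (\<Sum>r<3. bary m t r 0 * of_bool (vtx t r = \<kappa> i)))) has_derivative inner (g t)) (at y)"
      by (auto intro!: derivative_eq_intros)
    then show ?thesis by (rule has_derivative_transform_within_open[OF _ open_tint y]) (simp add: aff)
  qed
  \<comment> \<open>Off the grid the triangle containing a point of the domain is unique, so this is
    the gradient of \<open>w\<close>.\<close>
  define gy where "gy y = g (SOME t. t \<in> tris m \<and> y \<in> convex hull (tri m t))" for y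
  define G where "G b y = (if y \<in> \<Omega> then inner (\<beta>' y b) b * (w y)\<^sup>2 + inner (\<beta> y) b * (2 * w y * inner (gy y) b) else 0)" for b y
  have Gint: "(G b has_integral 0) UNIV" if b: "norm b = 1" for b
  proof (rule integral_directional_derivative[OF Flip[OF b] _ _ negligible_grid[OF m] b])
    show "0 \<le> L\<beta> * S\<^sup>2 + 2 * B * S * K" using B S0 L\<beta> by auto
    show "F b y = 0" if "R < norm y" for y using R[of y] that by (force simp: F_def)
    fix y assume y: "y \<notin> grid m"
    have line: "((\<lambda>s. y + s *\<^sub>R b) has_derivative (\<lambda>s. s *\<^sub>R b)) (at (0::real))"
      by (auto intro!: derivative_eq_intros)
    show "((\<lambda>s. F b (y + s *\<^sub>R b)) has_real_derivative G b y) (at 0)"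
    proof (cases "y \<in> \<Omega>")
      case True
      define t where "t = (SOME t. t \<in> tris m \<and> y \<in> convex hull (tri m t))"
      have "\<exists>t. t \<in> tris m \<and> y \<in> convex hull (tri m t)"
        using off_grid_cover[OF m _ y] True closure_subset[of \<Omega>] by blast
      from someI_ex[OF this] have t: "t \<in> tris m" "y \<in> convex hull (tri m t)" unfolding t_def by auto
      then have ti: "y \<in> tint m t" using hull_off_grid[OF m tris_sign[OF t(1)]] y by blast
      have gy: "gy y = g t" by (simp add: gy_def t_def)
      have "((\<lambda>z. inner (\<beta> z) b * (w z)\<^sup>2) has_derivative
          (\<lambda>h. inner (\<beta> y) b * (2 * w y * inner (g t) h) + inner (\<beta>' y h) b * (w y)\<^sup>2)) (at y)"
        by (auto intro!: derivative_eq_intros \<beta>d[OF True] wder[OF t(1) ti])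
      then have "(F b has_derivative
          (\<lambda>h. inner (\<beta> y) b * (2 * w y * inner (g t) h) + inner (\<beta>' y h) b * (w y)\<^sup>2)) (at y)"
        by (rule has_derivative_transform_within_open[OF _ open_Omega True]) (simp add: F_def)
      then have Fd: "(F b has_derivative
          (\<lambda>h. inner (\<beta> y) b * (2 * w y * inner (g t) h) + inner (\<beta>' y h) b * (w y)\<^sup>2)) (at (y + 0 *\<^sub>R b))" by simp
      show ?thesis
        unfolding has_field_derivative_def
        by (rule has_derivative_eq_rhs[OF has_derivative_compose[OF line Fd]])
          (auto simp: fun_eq_iff True G_def gy blinfun.scaleR_right algebra_simps)
    next
      case False
      then have cl: "y \<in> - closure \<Omega>"
        using False y open_Omega closure_diff_grid[OF m] by blast
      have "((\<lambda>z. 0) has_derivative (\<lambda>h. 0)) (at y)" by simp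
      then have "(F b has_derivative (\<lambda>h. 0)) (at y)"
        by (rule has_derivative_transform_within_open[OF _ _ cl]) (use closure_subset[of \<Omega>] in \<open>auto simp: F_def\<close>)
      then have Fd: "(F b has_derivative (\<lambda>h. 0)) (at (y + 0 *\<^sub>R b))" by simp
      show ?thesis
        unfolding has_field_derivative_def
        by (rule has_derivative_eq_rhs[OF has_derivative_compose[OF line Fd]]) (auto simp: fun_eq_iff False G_def)
    qed
  qed
  \<comment> \<open>Integrand of the convection form for the coefficients \<open>X\<close>; off the
    grid it equals w times the inner product of \<beta> with the gradient of w.\<close>
  define H where "H y = (\<Sum>i<n. \<Sum>j<n. X i * X j * (inner (\<beta> y) (grad (hatf m (\<kappa> i)) y) * hatf m (\<kappa> j) y))" for y
  have Hint: "(H has_integral (\<Sum>i<n. \<Sum>j<n. X i * X j * I i j)) \<Omega>"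
    unfolding H_def[abs_def] by (intro has_integral_sum has_integral_mult_right I) auto
  have "((\<lambda>y. \<Sum>b\<in>Basis. G b y) has_integral (\<Sum>b\<in>(Basis::R2 set). 0)) UNIV"
    by (intro has_integral_sum Gint) auto
  then have "((\<lambda>y. \<Sum>b\<in>Basis. G b y) has_integral 0) UNIV" by simp
  then have "((\<lambda>y. if y \<in> \<Omega> then divergence \<beta> y * (w y)\<^sup>2 + 2 * H y else 0) has_integral 0) UNIV"
  proof (rule has_integral_spike[OF negligible_grid[OF m], rotated])
    fix y assume "y \<in> UNIV - grid m"
    then have y: "y \<notin> grid m" by simp
    show "(if y \<in> \<Omega> then divergence \<beta> y * (w y)\<^sup>2 + 2 * H y else 0) = (\<Sum>b\<in>Basis. G b y)"
    proof (cases "y \<in> \<Omega>")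
      case True
      define t where "t = (SOME t. t \<in> tris m \<and> y \<in> convex hull (tri m t))"
      have "\<exists>t. t \<in> tris m \<and> y \<in> convex hull (tri m t)"
        using off_grid_cover[OF m _ y] True closure_subset[of \<Omega>] by blast
      from someI_ex[OF this] have t: "t \<in> tris m" "y \<in> convex hull (tri m t)" unfolding t_def by auto
      then have ti: "y \<in> tint m t" using hull_off_grid[OF m tris_sign[OF t(1)]] y by blast
      have gy: "gy y = g t" by (simp add: gy_def t_def)
      have "H y = (\<Sum>i<n. \<Sum>j<n. (X i * inner (\<beta> y) (gr m t (\<kappa> i))) * (X j * hatf m (\<kappa> j) y))"
        unfolding H_def using \<kappa> by (intro sum.cong refl) (simp add: grad_hatf[OF m _ t(1) ti])
      also have "\<dots> = inner (\<beta> y) (g t) * w y"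
        by (simp add: sum_product[symmetric] wt[OF t] g_def inner_sum_right)
      finally have H: "H y = inner (\<beta> y) (g t) * w y" .
      have fd: "frechet_derivative \<beta> (at y) = blinfun_apply (\<beta>' y)"
        using frechet_derivative_at[OF \<beta>d[OF True]] by simp
      have "(\<Sum>b\<in>Basis. G b y) = (\<Sum>b\<in>Basis. inner (\<beta>' y b) b) * (w y)\<^sup>2 + 2 * w y * (\<Sum>b\<in>Basis. inner (\<beta> y) b * inner (g t) b)"
        using True by (simp add: G_def gy sum.distrib sum_distrib_left sum_distrib_right mult_ac)
      also have "\<dots> = divergence \<beta> y * (w y)\<^sup>2 + 2 * H y"
        unfolding divergence_def fd H euclidean_inner[of "\<beta> y" "g t"] by simp
      finally show ?thesis using True by simp
    qed (simp add: G_def)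
  qed
  then have "((\<lambda>y. divergence \<beta> y * (w y)\<^sup>2 + 2 * H y) has_integral 0) \<Omega>"
    by (simp add: has_integral_restrict_UNIV)
  from has_integral_diff[OF this has_integral_mult_right[OF Hint, of 2]]
  have "((\<lambda>y. divergence \<beta> y * (w y)\<^sup>2) has_integral - (2 * (\<Sum>i<n. \<Sum>j<n. X i * X j * I i j))) \<Omega>" by simp
  then have "0 \<le> - (2 * (\<Sum>i<n. \<Sum>j<n. X i * X j * I i j))"
    by (rule has_integral_nonneg) (use div in auto)
  then show ?thesis by simp
qed

section \<open>Spectra from triangle data\<close>

lemma sum_coarse_zf:
  "(\<Sum>k\<in>coarse m N l. zf n \<kappa> X k) = (\<Sum>i<n. complex_of_real (of_bool (\<kappa> i \<in> coarse m N l)) * X i)"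
proof -
  have fin: "finite (coarse m N l)" by (simp add: coarse_def Let_def)
  have "(\<Sum>k\<in>coarse m N l. zf n \<kappa> X k) = (\<Sum>i<n. \<Sum>k\<in>coarse m N l. complex_of_real (of_bool (k = \<kappa> i)) * X i)"
    unfolding zf_def by (rule sum.swap)
  also have "\<dots> = (\<Sum>i<n. complex_of_real (of_bool (\<kappa> i \<in> coarse m N l)) * X i)"
  proof (rule sum.cong[OF refl])
    fix i
    have "(\<Sum>k\<in>coarse m N l. complex_of_real (of_bool (k = \<kappa> i)) * X i) = (\<Sum>k\<in>coarse m N l. if k = \<kappa> i then X i else 0)"
      by (intro sum.cong) auto
    then show "(\<Sum>k\<in>coarse m N l. complex_of_real (of_bool (k = \<kappa> i)) * X i) = complex_of_real (of_bool (\<kappa> i \<in> coarse m N l)) * X i"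
      using fin by simp
  qed
  finally show ?thesis .
qed

text \<open>A nonzero entry makes the mean square positive, and Poincare passes this on to the
  energy; definiteness of the preconditioner rests on it.\<close>

lemma zf_energy_pos:
  assumes m: "m \<ge> 1" and \<kappa>: "bij_betw \<kappa> {..<n} (nodes m)" and X: "i < n" "X i \<noteq> 0"
  shows "dir_energy m (zf n \<kappa> X) > 0"
proof -
  let ?z = "zf n \<kappa> X"
  have inj: "inj_on \<kappa> {..<n}" and im: "\<And>i. i < n \<Longrightarrow> \<kappa> i \<in> nodes m"
    using \<kappa> by (auto simp: bij_betw_def)
  have "0 < (cmod (?z (\<kappa> i)))\<^sup>2" using zf_at[OF inj X(1)] X(2) by simp
  also have "\<dots> \<le> sq_norm m ?z"
    unfolding sq_norm_def using im[OF X(1)] nodes_subset cnodes_box by (intro member_le_sum) auto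
  finally have "0 < sq_norm m ?z / (real m)\<^sup>2" using m by simp
  also have "\<dots> \<le> 9 * dir_energy m ?z" by (rule poincare[OF m supp_zf[OF im]])
  finally show ?thesis by simp
qed

text \<open>A form bounded by \<open>\<delta>\<close> times the energy plus a multiple of the mean square is, up to \<open>2 \<delta>\<close> times the energy, of a rank
  not depending on \<open>m\<close>: on coarse cells of a fixed relative size only the cell means matter.\<close>

lemma preconditioned_spectrum:
  fixes M :: "nat set" and n :: "nat \<Rightarrow> nat" and \<kappa> :: "nat \<Rightarrow> nat \<Rightarrow> int \<times> int"
    and \<alpha> :: "nat \<Rightarrow> (int \<times> int) \<times> int \<Rightarrow> real" and b :: "nat \<Rightarrow> (int \<times> int) \<times> int \<Rightarrow> nat \<Rightarrow> R2"
    and d :: "nat \<Rightarrow> int \<times> int \<Rightarrow> real"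
  assumes M: "\<And>m. m \<in> M \<Longrightarrow> m \<ge> 1" and \<kappa>: "\<And>m. m \<in> M \<Longrightarrow> bij_betw (\<kappa> m) {..<n m} (nodes m)"
    and d: "\<And>m k. m \<in> M \<Longrightarrow> k \<in> nodes m \<Longrightarrow> d m k = sqrt (wmean m (\<alpha> m) k)"
    and dd: "\<And>m. m \<in> M \<Longrightarrow> diag_data m C l B (\<alpha> m) (d m)" and l: "l > 0" and C: "C \<ge> 0"
    and bb: "\<And>m t r. m \<in> M \<Longrightarrow> t \<in> tris m \<Longrightarrow> r < 3 \<Longrightarrow> norm (b m t r) \<le> Bb"
    and low: "\<And>m X. m \<in> M \<Longrightarrow> c3 * dir_energy m (zf (n m) (\<kappa> m) X) \<le>
       FT m (\<alpha> m) (zf (n m) (\<kappa> m) X) + Re (FC m (b m) (zf (n m) (\<kappa> m) X))" and c3: "c3 > 0"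
  defines "P \<equiv> \<lambda>m. precond (theta_mat m (n m) (\<kappa> m) (\<alpha> m)) (theta_mat m (n m) (\<kappa> m) (\<lambda>_. 1))"
    and "A \<equiv> \<lambda>m. theta_mat m (n m) (\<kappa> m) (\<alpha> m) + psi_mat m (n m) (\<kappa> m) (b m)"
  shows "\<And>m. m \<in> M \<Longrightarrow> posdef (n m) (P m)"
    and "in_positive_rectangle M (\<lambda>m. cmat (minv (P m) * A m))"
    and "\<And>\<epsilon>. \<epsilon> > 0 \<Longrightarrow> \<exists>m1 D. \<forall>m\<in>M. m \<ge> m1 \<longrightarrow> real (num_eigenvalues_outside (cmat (minv (P m) * A m)) (ball 1 \<epsilon>)) \<le> D"
proof -
  define K where "K = ku + kv + kd"
  define c1 where "c1 = min ku kv / (4 / l\<^sup>2 + 216 * (C / l\<^sup>2)\<^sup>2)"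
  define C2 where "C2 = K * (4 * (B\<^sup>2 + C) + 4 * (C + 1) + 54 * (B\<^sup>2 + 1) * C\<^sup>2)"
  have K: "K > 0" using k_pos by (simp add: K_def)
  have Q: "4 / l\<^sup>2 + 216 * (C / l\<^sup>2)\<^sup>2 > 0" using l by (intro add_pos_nonneg) auto
  have c1: "c1 > 0" unfolding c1_def using Q k_pos by simp
  have C2: "C2 > 0" unfolding C2_def
  proof (rule mult_pos_pos[OF K])
    have 1: "0 < 4 * (B\<^sup>2 + C) + 4 * (C + 1)" using C by (intro add_nonneg_pos) auto
    have 2: "0 \<le> 54 * (B\<^sup>2 + 1) * C\<^sup>2" by simp
    show "0 < 4 * (B\<^sup>2 + C) + 4 * (C + 1) + 54 * (B\<^sup>2 + 1) * C\<^sup>2" by (rule add_pos_nonneg[OF 1 2])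
  qed
  define e where "e m X = dir_energy m (zf (n m) (\<kappa> m) X)" for m X
  define sn where "sn m X = sq_norm m (zf (n m) (\<kappa> m) X) / (real m)\<^sup>2" for m X
  define fP where "fP m X = FP m (d m) (zf (n m) (\<kappa> m) X)" for m X
  define fA where "fA m X = complex_of_real (FT m (\<alpha> m) (zf (n m) (\<kappa> m) X)) + FC m (b m) (zf (n m) (\<kappa> m) X)" for m X
  have e0: "e m X \<ge> 0" "sn m X \<ge> 0" for m X
    unfolding e_def sn_def using dir_energy_nonneg sq_norm_nonneg by auto
  have \<kappa>n: "\<kappa> m i \<in> nodes m" if "m \<in> M" "i < n m" for m i using \<kappa>[OF that(1)] that(2) by (auto simp: bij_betw_def)
  have sz: "supp m (zf (n m) (\<kappa> m) X)" if "m \<in> M" for m X by (rule supp_zf[OF \<kappa>n[OF that]])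
  have sn_e: "sn m X \<le> 9 * e m X" if "m \<in> M" for m X
    unfolding sn_def e_def by (rule poincare[OF M[OF that] sz[OF that]])
  have P_low: "c1 * e m X \<le> fP m X" if m: "m \<in> M" for m X
    using FP_lower[OF M[OF m] sz[OF m] dd[OF m] l C, of X] Q unfolding c1_def e_def fP_def
    by (simp add: pos_divide_le_eq mult.commute)
  have P_up: "fP m X \<le> C2 * e m X" if m: "m \<in> M" for m X
    using FP_upper(1)[OF M[OF m] sz[OF m] dd[OF m] less_imp_le[OF l] C, of X]
    unfolding C2_def K_def e_def fP_def .
  have A_low: "c3 * e m X \<le> Re (fA m X)" if m: "m \<in> M" for m X
    using low[OF m, of X] by (simp add: e_def fA_def)
  define N where "N = norm p + norm q"
  have AP: "cmod (fA m X - fP m X) \<le> (K * (4 * (C / m + \<delta>)) + 2 * \<delta>) * e m X +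
      (K * (6 * (B\<^sup>2 / \<delta> + 1) * C\<^sup>2) + 9 * (Bb * N)\<^sup>2 / \<delta>) * sn m X" if m: "m \<in> M" and \<delta>: "\<delta> > 0" for m X \<delta>
  proof -
    let ?z = "zf (n m) (\<kappa> m) X"
    let ?R1 = "K * (4 * (C / m + \<delta>) * e m X + 6 * (B\<^sup>2 / \<delta> + 1) * C\<^sup>2 * sn m X)"
    let ?R2 = "2 * \<delta> * e m X + 9 * (Bb * N)\<^sup>2 / \<delta> * sn m X"
    have "fA m X - fP m X = complex_of_real (FT m (\<alpha> m) ?z - FP m (d m) ?z) + FC m (b m) ?z"
      by (simp add: fA_def fP_def)
    then have "cmod (fA m X - fP m X) \<le> \<bar>FT m (\<alpha> m) ?z - FP m (d m) ?z\<bar> + cmod (FC m (b m) ?z)"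
      using norm_triangle_ineq[of "complex_of_real (FT m (\<alpha> m) ?z - FP m (d m) ?z)" "FC m (b m) ?z"]
      by (simp only: norm_of_real)
    moreover have "\<bar>FP m (d m) ?z - FT m (\<alpha> m) ?z\<bar> \<le> ?R1"
      using FT_FP_diff[OF dd[OF m] less_imp_le[OF l] \<delta> C, of ?z] by (simp only: K_def e_def sn_def)
    moreover have "cmod (FC m (b m) ?z) \<le> ?R2"
      using FC_bound[where b="b m" and B=Bb and z="?z" and m=m, OF bb[OF m] \<delta>] by (simp only: e_def sn_def N_def)
    ultimately have "cmod (fA m X - fP m X) \<le> ?R1 + ?R2" by linarith
    also have "\<dots> = (K * (4 * (C / m + \<delta>)) + 2 * \<delta>) * e m X +
      (K * (6 * (B\<^sup>2 / \<delta> + 1) * C\<^sup>2) + 9 * (Bb * N)\<^sup>2 / \<delta>) * sn m X"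
      by (simp add: distrib_left distrib_right mult.assoc)
    finally show ?thesis .
  qed
  \<comment> \<open>The estimate \<open>AP\<close> at \<delta> = 1, with C/m replaced by C and the
    mean square by 9 times the energy.\<close>
  define D0 where "D0 = K * (4 * (C + 1)) + 2 + (K * (6 * (B\<^sup>2 + 1) * C\<^sup>2) + 9 * (Bb * N)\<^sup>2) * 9"
  have A_up: "cmod (fA m X) \<le> (C2 + D0) * e m X" if m: "m \<in> M" for m X
  proof -
    have "C / m \<le> C" using M[OF m] C by (simp add: divide_le_eq mult_le_cancel_left1)
    then have "(K * (4 * (C / m + 1)) + 2 * 1) * e m X \<le> (K * (4 * (C + 1)) + 2) * e m X"
      using K e0 by (intro mult_right_mono add_mono mult_left_mono) auto
    moreover have "(K * (6 * (B\<^sup>2 / 1 + 1) * C\<^sup>2) + 9 * (Bb * N)\<^sup>2 / 1) * sn m X \<le>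
        (K * (6 * (B\<^sup>2 + 1) * C\<^sup>2) + 9 * (Bb * N)\<^sup>2) * (9 * e m X)"
      using sn_e[OF m, of X] K by (simp only: div_by_1) (intro mult_left_mono, auto)
    ultimately have "cmod (fA m X - fP m X) \<le> D0 * e m X"
      using AP[OF m, of 1 X] unfolding D0_def by (simp add: algebra_simps)
    moreover have "cmod (complex_of_real (fP m X)) \<le> C2 * e m X"
    proof -
      have "0 \<le> fP m X" using P_low[OF m, of X] c1 e0[of m X] by (meson less_imp_le mult_nonneg_nonneg order_trans)
      then show ?thesis using P_up[OF m, of X] by simp
    qed
    ultimately show ?thesis
      using norm_triangle_ineq[of "fA m X - fP m X" "complex_of_real (fP m X)"] by (simp add: distrib_right)
  qed
  have Ac: "A m \<in> carrier_mat (n m) (n m)" for m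
    unfolding A_def using theta_carrier psi_carrier by (intro add_carrier_mat)
  have sA: "sesq (n m) (A m) X X = complex_of_real area * fA m X" if m: "m \<in> M" for m X
    unfolding A_def sesq_add_mat[OF theta_carrier psi_carrier] fA_def
    using sesq_theta sesq_psi M[OF m] by (simp add: distrib_left)
  have sP: "sesq (n m) (P m) X X = complex_of_real (area * fP m X)" if m: "m \<in> M" for m X
    unfolding P_def fP_def using M[OF m] \<kappa>n[OF m] d[OF m] by (intro precond_theta(3)) auto
  have epos: "e m X > 0" if "m \<in> M" "i < n m" "X i \<noteq> 0" for m X i
    using zf_energy_pos[OF M[OF that(1)] \<kappa>[OF that(1)], of i X] that(2,3) by (simp add: e_def)
  show pd: "posdef (n m) (P m)" if m: "m \<in> M" for m
    unfolding posdef_def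
  proof (intro conjI allI impI)
    show "P m \<in> carrier_mat (n m) (n m)"
      unfolding P_def using M[OF m] \<kappa>n[OF m] d[OF m] by (intro precond_theta(1)[where d="d m"]) auto
    show "P m $$ (i, j) = P m $$ (j, i)" if "i < n m" "j < n m" for i j
      unfolding P_def using M[OF m] \<kappa>n[OF m] d[OF m] that by (intro precond_theta(2)[where d="d m"]) auto
    fix X :: "nat \<Rightarrow> complex" assume "\<exists>i<n m. X i \<noteq> 0"
    then have "0 < c1 * e m X" using epos[OF m] c1 by auto
    then show "0 < Re (sesq (n m) (P m) X X)" unfolding sP[OF m] using P_low[OF m, of X] area_pos by simp
  qed
  show "in_positive_rectangle M (\<lambda>m. cmat (minv (P m) * A m))"
    unfolding in_positive_rectangle_def
  proof (intro exI conjI ballI allI impI)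
    have D0: "D0 \<ge> 0" unfolding D0_def using K C by auto
    \<comment> \<open>The lower bound for Re z combines Re A >= c3 e with P <= C2 e; the bound
      \<open>?D\<close> for the modulus of z serves as upper bound for Re z and for Im z.\<close>
    let ?D = "(C2 + D0) / c1"
    show "0 < c3 / C2" using c3 C2 by simp
    show "0 < ?D" "0 \<le> ?D" using C2 D0 c1 by auto
    fix m z assume m: "m \<in> M" and ev: "eigenvalue (cmat (minv (P m) * A m)) z"
    from eigenvalue_precond[OF pd[OF m] Ac ev] obtain X i where X: "i < n m" "X i \<noteq> 0"
      and eq: "sesq (n m) (A m) X X = z * sesq (n m) (P m) X X" by auto
    have e: "e m X > 0" using epos[where m=m and i=i and X=X] m X by simp
    have fP: "fP m X > 0" using P_low[OF m, of X] c1 e by (meson less_le_trans mult_pos_pos)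
    have fA: "fA m X = z * complex_of_real (fP m X)"
      using eq area_pos unfolding sA[OF m] sP[OF m] by simp
    have "c3 / C2 * fP m X \<le> c3 * e m X"
      using P_up[OF m, of X] c3 C2 by (simp add: pos_divide_le_eq) (metis mult.commute mult.left_commute mult_left_mono less_imp_le)
    also have "\<dots> \<le> Re z * fP m X" using A_low[OF m, of X] by (simp add: fA)
    finally have 1: "c3 / C2 \<le> Re z" by (rule mult_right_le_imp_le[OF _ fP])
    have "cmod z * fP m X = cmod (fA m X)" using fP by (simp add: fA norm_mult)
    also have "\<dots> \<le> (C2 + D0) * e m X" by (rule A_up[OF m])
    also have "\<dots> \<le> ?D * fP m X"
    proof -
      have "(C2 + D0) / c1 * (c1 * e m X) \<le> (C2 + D0) / c1 * fP m X"
        using P_low[OF m, of X] C2 D0 c1 by (intro mult_left_mono) auto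
      then show ?thesis using c1 by simp
    qed
    finally have 2: "cmod z \<le> ?D" by (rule mult_right_le_imp_le[OF _ fP])
    show "Re z \<in> {c3 / C2..?D}" using 1 2 complex_Re_le_cmod[of z] by auto
    show "Im z \<in> {- ?D..?D}" using 2 abs_Im_le_cmod[of z] by (auto simp: abs_le_iff)
  qed
  fix \<epsilon> :: real assume \<epsilon>: "\<epsilon> > 0"
  \<comment> \<open>Since P >= c1 e, the allowance \<epsilon>/2 P covers 2 \<open>\<delta>'\<close>
    times the energy: one \<open>\<delta>'\<close> for the energy part of the form error once C/m <=
    \<delta>, the other for the remainder of the coarse Poincare inequality.\<close>
  define \<delta>' where "\<delta>' = \<epsilon> * c1 / 4"
  define \<delta> where "\<delta> = \<delta>' / (8 * K + 2)"
  have \<delta>': "\<delta>' > 0" using \<epsilon> c1 by (simp add: \<delta>'_def)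
  have \<delta>: "\<delta> > 0" "(8 * K + 2) * \<delta> = \<delta>'" using \<delta>' K by (auto simp: \<delta>_def)
  define C' where "C' = K * (6 * (B\<^sup>2 / \<delta> + 1) * C\<^sup>2) + 9 * (Bb * N)\<^sup>2 / \<delta>"
  have C': "C' \<ge> 0" unfolding C'_def using K \<delta> by auto
  \<comment> \<open>Taking the successor makes \<open>N0\<close> positive, and N0 <= N0^2 lets a
    linear bound serve for the square.\<close>
  obtain n0 :: nat where n0: "9 * C' / \<delta>' \<le> real n0" using real_arch_simple by blast
  define N0 where "N0 = Suc n0"
  have N0: "N0 > 0" "9 / (real N0)\<^sup>2 * C' \<le> \<delta>'"
  proof -
    have "9 * C' / \<delta>' \<le> real N0" using n0 by (simp add: N0_def)
    also have "\<dots> \<le> (real N0)\<^sup>2" by (simp add: N0_def power2_eq_square)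
    finally have "9 * C' \<le> \<delta>' * (real N0)\<^sup>2" using \<delta>' by (simp add: pos_divide_le_eq mult.commute)
    then show "9 / (real N0)\<^sup>2 * C' \<le> \<delta>'" by (simp add: divide_le_eq N0_def)
  qed (simp add: N0_def)
  obtain m2 :: nat where m2: "C / \<delta> \<le> real m2" using real_arch_simple by blast
  define L where "L = {..<N0} \<times> {..<N0}"
  have "real (num_eigenvalues_outside (cmat (minv (P m) * A m)) (ball 1 \<epsilon>)) \<le> 2 * card L * (81 * C' / c1) / \<epsilon>"
    if m: "m \<in> M" and mm: "m \<ge> max m2 N0" for m
  proof -
    \<comment> \<open>\<open>s\<close> moves the factor \<open>area * C'\<close> into the
      functionals, since the counting lemma sums their plain squares.\<close>
    define s where "s = sqrt (area * C')"
    define w where "w l' i = complex_of_real s * (complex_of_real (N0 / (real m)\<^sup>2) * complex_of_real (of_bool (\<kappa> m i \<in> coarse m N0 l')))"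
      for l' i
    define lf where "lf l' X = complex_of_real (N0 / (real m)\<^sup>2) * (\<Sum>k\<in>coarse m N0 l'. zf (n m) (\<kappa> m) X k)" for l' X
    have s2: "s\<^sup>2 = area * C'" using area_pos C' by (simp add: s_def)
    have wl: "(cmod (\<Sum>i<n m. w l' i * X i))\<^sup>2 = area * C' * (cmod (lf l' X))\<^sup>2" for l' X
    proof -
      have "(\<Sum>i<n m. w l' i * X i) = complex_of_real s * lf l' X"
        by (simp add: w_def lf_def sum_coarse_zf sum_distrib_left mult.assoc)
      then show ?thesis by (simp add: norm_mult power_mult_distrib s2)
    qed
    show ?thesis
    proof (rule num_eigenvalues_outside_le[OF pd[OF m] Ac \<epsilon>, where w=w])
      show "0 \<le> 81 * C' / c1" using C' c1 by simp
      fix X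
      have Cm: "C / m \<le> \<delta>"
      proof -
        have "C / \<delta> \<le> real m" using m2 mm by (meson max.bounded_iff of_nat_mono order_trans)
        then show ?thesis using \<delta>(1) M[OF m] by (simp add: pos_divide_le_eq divide_le_eq mult.commute)
      qed
      have "cmod (fA m X - fP m X) \<le> (K * (4 * (C / m + \<delta>)) + 2 * \<delta>) * e m X + C' * sn m X"
        unfolding C'_def by (rule AP[OF m \<delta>(1)])
      also have "\<dots> \<le> \<delta>' * e m X + C' * (9 / (real N0)\<^sup>2 * e m X + (\<Sum>l'\<in>L. (cmod (lf l' X))\<^sup>2))"
      proof (intro add_mono mult_right_mono mult_left_mono e0 C')
        have "K * (4 * (C / m + \<delta>)) \<le> K * (4 * (\<delta> + \<delta>))" using Cm K by (intro mult_left_mono) auto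
        then show "K * (4 * (C / m + \<delta>)) + 2 * \<delta> \<le> \<delta>'" unfolding \<delta>(2)[symmetric] by (simp add: algebra_simps)
        show "sn m X \<le> 9 / (real N0)\<^sup>2 * e m X + (\<Sum>l'\<in>L. (cmod (lf l' X))\<^sup>2)"
          unfolding sn_def e_def lf_def L_def using mm N0
          by (intro coarse_poincare supp_inner_box[OF sz[OF m]]) auto
      qed
      also have "\<dots> \<le> \<delta>' * e m X + (\<delta>' * e m X + C' * (\<Sum>l'\<in>L. (cmod (lf l' X))\<^sup>2))"
        using mult_right_mono[OF N0(2) e0(1)[of m X]] by (simp add: distrib_left mult_ac)
      also have "\<dots> \<le> \<epsilon> / 2 * fP m X + C' * (\<Sum>l'\<in>L. (cmod (lf l' X))\<^sup>2)"
      proof -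
        have "\<epsilon> / 2 * (c1 * e m X) \<le> \<epsilon> / 2 * fP m X" using \<epsilon> by (intro mult_left_mono P_low m) auto
        then show ?thesis by (simp add: \<delta>'_def)
      qed
      finally have "area * cmod (fA m X - fP m X) \<le> area * (\<epsilon> / 2 * fP m X + C' * (\<Sum>l'\<in>L. (cmod (lf l' X))\<^sup>2))"
        using area_pos by (intro mult_left_mono) auto
      moreover have "cmod (sesq (n m) (A m) X X - sesq (n m) (P m) X X) = area * cmod (fA m X - fP m X)"
        unfolding sA[OF m] sP[OF m] of_real_mult right_diff_distrib[symmetric] norm_mult using area_pos by simp
      ultimately show "cmod (sesq (n m) (A m) X X - sesq (n m) (P m) X X) \<le>
          \<epsilon> / 2 * Re (sesq (n m) (P m) X X) + (\<Sum>l'\<in>L. (cmod (\<Sum>i<n m. w l' i * X i))\<^sup>2)"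
        unfolding sP[OF m] wl by (simp add: distrib_left sum_distrib_left mult_ac)
      fix l' assume "l' \<in> L"
      have "(cmod (lf l' X))\<^sup>2 \<le> 81 * e m X"
        unfolding lf_def e_def using mm N0 by (intro coarse_bounded supp_inner_box[OF sz[OF m]]) auto
      also have "\<dots> \<le> 81 * (fP m X / c1)"
        using P_low[OF m, of X] c1 by (simp add: pos_le_divide_eq mult.commute)
      finally have "area * C' * (cmod (lf l' X))\<^sup>2 \<le> area * C' * (81 * (fP m X / c1))"
        using area_pos C' by (intro mult_left_mono) auto
      then show "(cmod (\<Sum>i<n m. w l' i * X i))\<^sup>2 \<le> 81 * C' / c1 * Re (sesq (n m) (P m) X X)"
        unfolding sP[OF m] wl by (simp add: mult_ac)
    qed
  qed
  then show "\<exists>m1 D. \<forall>m\<in>M. m \<ge> m1 \<longrightarrow> real (num_eigenvalues_outside (cmat (minv (P m) * A m)) (ball 1 \<epsilon>)) \<le> D"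
    by blast
qed

section \<open>Triangle data that meet the spectral hypotheses\<close>

lemma FC_diff: "FC m b z - FC m b' z = FC m (\<lambda>t r. b t r - b' t r) z"
proof -
  have "Pf m b z t - Pf m b' z t = Pf m (\<lambda>t r. b t r - b' t r) z t" for t
    by (simp add: Pf_def inner_diff_left sum3 algebra_simps)
  then show ?thesis by (simp add: FC_def sum_subtractf[symmetric])
qed

lemma theta_mat_cong: "(\<And>t. t \<in> tris m \<Longrightarrow> \<alpha> t = \<alpha>' t) \<Longrightarrow> theta_mat m n \<kappa> \<alpha> = theta_mat m n \<kappa> \<alpha>'"
  unfolding theta_mat_def by (intro cong_mat) (auto cong: sum.cong)

lemma wmean_ge:
  assumes m: "m > 0" and k: "k \<in> nodes m" and a: "\<And>t. t \<in> tris m \<Longrightarrow> v \<le> \<alpha> t"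
  shows "v \<le> wmean m \<alpha> k"
proof -
  have "v * (\<Sum>t\<in>tris m. inner (gr m t k) (gr m t k)) \<le> (\<Sum>t\<in>tris m. \<alpha> t * inner (gr m t k) (gr m t k))"
    unfolding sum_distrib_left by (intro sum_mono mult_right_mono a) auto
  then show ?thesis unfolding wmean_def using gr_sum_pos[OF m k] by (simp add: pos_le_divide_eq)
qed

text \<open>\<open>diag_data\<close> speaks of all mesh vertices, including those on the boundary,
  which index no matrix row; there the square root of \<open>a\<close> extends the function.\<close>

definition dfun :: "nat \<Rightarrow> (R2 \<Rightarrow> real) \<Rightarrow> ((int \<times> int) \<times> int \<Rightarrow> real) \<Rightarrow> int \<times> int \<Rightarrow> real" where
  "dfun m a \<alpha> k = sqrt (if k \<in> nodes m then wmean m \<alpha> k else a (nd m k))"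

text \<open>Node values average the data around the node, so they are within E/m of
  \<open>a\<close>, and within 2E/m of the data on each adjacent triangle. A difference of square
  roots is the difference of the radicands over a sum that is at least 2l, which yields
  2E/l.\<close>

lemma diag_data_dfun:
  assumes m: "m \<ge> 1" and E: "E \<ge> 0" and l: "l > 0"
    and a: "\<And>t r. t \<in> tris m \<Longrightarrow> r < 3 \<Longrightarrow> \<bar>\<alpha> t - a (nd m (vtx t r))\<bar> \<le> E / m"
    and al: "\<And>t. t \<in> tris m \<Longrightarrow> l\<^sup>2 \<le> \<alpha> t" and lo: "\<And>y. y \<in> closure \<Omega> \<Longrightarrow> l\<^sup>2 \<le> a y"
    and up: "\<And>y. y \<in> closure \<Omega> \<Longrightarrow> a y \<le> Am"
  shows "diag_data m (2 * E + 2 * E / l) l (sqrt (Am + E)) \<alpha> (dfun m a \<alpha>)"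
proof -
  have m0: "m > 0" using m by simp
  define W where "W k = (if k \<in> nodes m then wmean m \<alpha> k else a (nd m k))" for k
  have Wc: "\<bar>W k - a (nd m k)\<bar> \<le> E / m" for k
    unfolding W_def using a E by (auto intro!: wmean_close[OF m0])
  have Wl: "l\<^sup>2 \<le> W k" "W k \<le> Am + E" if k: "k \<in> cnodes m" for k
  proof -
    have c: "nd m k \<in> closure \<Omega>" using k nd_closure[OF m0] by blast
    show "l\<^sup>2 \<le> W k" using wmean_ge[OF m0, of k "l\<^sup>2" \<alpha>] al lo[OF c] by (auto simp: W_def)
    have "E / m \<le> E" using m E by (simp add: divide_le_eq mult_le_cancel_left1)
    then show "W k \<le> Am + E" using Wc[of k] up[OF c] by linarith
  qed
  have d: "dfun m a \<alpha> k = sqrt (W k)" for k by (simp add: dfun_def W_def)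
  have dl: "l \<le> dfun m a \<alpha> k" "dfun m a \<alpha> k \<le> sqrt (Am + E)" "(dfun m a \<alpha> k)\<^sup>2 = W k" if k: "k \<in> cnodes m" for k
  proof -
    show "l \<le> dfun m a \<alpha> k" unfolding d using Wl(1)[OF k] l by (simp add: real_le_rsqrt)
    show "dfun m a \<alpha> k \<le> sqrt (Am + E)" unfolding d using Wl(2)[OF k] by simp
    show "(dfun m a \<alpha> k)\<^sup>2 = W k"
      unfolding d using Wl(1)[OF k] by (simp add: order_trans[OF zero_le_power2[of l]])
  qed
  show ?thesis unfolding diag_data_def
  proof (intro ballI allI impI conjI)
    fix t and r :: nat assume t: "t \<in> tris m" and r: "r < 3"
    note vc = vtx_cnodes[OF t r]
    have 0: "\<bar>W (vtx t r) - \<alpha> t\<bar> \<le> 2 * (E / m)" if "r < 3" for r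
      using Wc[of "vtx t r"] a[OF t that] by linarith
    have El: "0 \<le> E / l / m" using E l by simp
    have e: "(2 * E + 2 * E / l) / m = 2 * (E / m) + 2 * (E / l / m)" by (simp add: add_divide_distrib)
    show "\<bar>(dfun m a \<alpha> (vtx t r))\<^sup>2 - \<alpha> t\<bar> \<le> (2 * E + 2 * E / l) / m"
      unfolding dl(3)[OF vc] e using 0[OF r] El by linarith
    show "l \<le> dfun m a \<alpha> (vtx t r)" "dfun m a \<alpha> (vtx t r) \<le> sqrt (Am + E)" using dl[OF vc] by auto
    fix r' :: nat assume r': "r' < 3"
    note vc' = vtx_cnodes[OF t r']
    let ?x = "dfun m a \<alpha> (vtx t r)" and ?y = "dfun m a \<alpha> (vtx t r')"
    have "\<bar>?x - ?y\<bar> * (2 * l) \<le> \<bar>?x - ?y\<bar> * (?x + ?y)"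
      using dl(1)[OF vc] dl(1)[OF vc'] by (intro mult_left_mono) auto
    also have "\<dots> = \<bar>W (vtx t r) - W (vtx t r')\<bar>"
      using dl(1)[OF vc] dl(1)[OF vc'] l unfolding dl(3)[OF vc, symmetric] dl(3)[OF vc', symmetric]
      by (simp add: power2_eq_square square_diff_square_factored abs_mult mult.commute)
    also have "\<dots> \<le> 4 * (E / m)" using 0[OF r] 0[OF r'] by linarith
    finally have "\<bar>?x - ?y\<bar> \<le> 4 * (E / m) / (2 * l)" using l by (subst pos_le_divide_eq) auto
    also have "\<dots> = 2 * (E / l / m)" by (simp add: mult.commute)
    finally have "\<bar>?x - ?y\<bar> \<le> 2 * (E / l / m)" .
    moreover have "0 \<le> E / m" using E by simp
    ultimately show "\<bar>?x - ?y\<bar> \<le> (2 * E + 2 * E / l) / m" unfolding e by linarith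
  qed
qed

text \<open>For a real matrix the real part of the form at X is the sum of the forms at Re X and Im
  X, and the real case applies to each.\<close>

lemma Re_FC_nonneg:
  assumes m: "m > 0" and \<kappa>: "\<And>i. i < n \<Longrightarrow> \<kappa> i \<in> nodes m" and \<beta>: "C1_closure \<Omega> \<beta>"
    and div: "\<And>y. y \<in> \<Omega> \<Longrightarrow> divergence \<beta> y \<ge> 0"
  shows "0 \<le> Re (FC m (mb m \<beta>) (zf n \<kappa> X))"
proof -
  have \<beta>c: "continuous_on (closure \<Omega>) \<beta>" using \<beta> by (simp add: C1_closure_def)
  define I where "I i j = area / (real m)\<^sup>2 * (\<Sum>t\<in>tris m. \<Sum>r<3. of_bool (vtx t r = \<kappa> j) * inner (mb m \<beta> t r) (gr m t (\<kappa> i)))" for i j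
  have nonpos: "(\<Sum>i<n. \<Sum>j<n. x i * x j * I i j) \<le> 0" for x :: "nat \<Rightarrow> real"
    unfolding I_def by (rule convection_form_nonneg[OF m \<kappa> \<beta> div conv_has_integral[OF m \<kappa> \<kappa> \<beta>c]])
  have "Re (sesq n (psi_mat m n \<kappa> (mb m \<beta>)) X X) =
      (\<Sum>i<n. \<Sum>j<n. - (Re (X i) * Re (X j) * I i j) - (Im (X i) * Im (X j) * I i j))"
    unfolding sesq_def Re_sum
  proof (intro sum.cong refl)
    fix i j assume "i \<in> {..<n}" "j \<in> {..<n}"
    then have e: "psi_mat m n \<kappa> (mb m \<beta>) $$ (i, j) = - I i j" by (simp add: psi_mat_def I_def)
    show "Re (cnj (X i) * complex_of_real (psi_mat m n \<kappa> (mb m \<beta>) $$ (i, j)) * X j) =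
      - (Re (X i) * Re (X j) * I i j) - (Im (X i) * Im (X j) * I i j)"
      unfolding e by (simp add: algebra_simps)
  qed
  also have "\<dots> = - (\<Sum>i<n. \<Sum>j<n. Re (X i) * Re (X j) * I i j) - (\<Sum>i<n. \<Sum>j<n. Im (X i) * Im (X j) * I i j)"
    by (simp add: sum_subtractf sum_negf)
  also have "\<dots> \<ge> 0" using nonpos[of "\<lambda>i. Re (X i)"] nonpos[of "\<lambda>i. Im (X i)"] by linarith
  finally show ?thesis unfolding sesq_psi[OF m] using area_pos by (simp add: zero_le_mult_iff)
qed

text \<open>An \<open>O(h\<^sup>2)\<close> quadrature error in the diffusion matrices forces the formula to be exact on constants: the weighted
  area enters every diagonal entry with a relative error \<open>O(h)\<close>.\<close>

lemma total_weight_1: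
  fixes W :: real
  assumes a0: "a0 > 0" "\<And>y. y \<in> closure \<Omega> \<Longrightarrow> a0 \<le> a y"
    and al: "\<And>m t r. m \<ge> 2 \<Longrightarrow> t \<in> tris m \<Longrightarrow> r < 3 \<Longrightarrow> \<bar>\<alpha> m t - a (nd m (vtx t r))\<bar> \<le> E / m"
    and al': "\<And>m t r. m \<ge> 2 \<Longrightarrow> t \<in> tris m \<Longrightarrow> r < 3 \<Longrightarrow> \<bar>\<alpha>' m t - W * a (nd m (vtx t r))\<bar> \<le> E' / m"
    and \<kappa>: "\<And>m. m \<ge> 2 \<Longrightarrow> bij_betw (\<kappa> m) {..<n m} (nodes m)"
    and err: "\<And>m i. m \<ge> 2 \<Longrightarrow> i < n m \<Longrightarrow>
       \<bar>theta_mat m (n m) (\<kappa> m) (\<alpha>' m) $$ (i, i) - theta_mat m (n m) (\<kappa> m) (\<alpha> m) $$ (i, i)\<bar> \<le> C0 / (real m)\<^sup>2"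
  shows "W = 1"
proof -
  define D where "D = \<bar>E\<bar> + \<bar>E'\<bar> + \<bar>C0\<bar> / (area * (ku + kv))"
  \<comment> \<open>The two weighted means at a node are within O(1/m) of \<open>a\<close> and of
    \<open>W * a\<close>, and the entry error keeps them within O(1/m) of each other; as
    \<open>a\<close> stays above \<open>a0\<close>, the defect of \<open>W\<close> is at most a
    constant over \<open>m\<close>.\<close>
  have main: "a0 * \<bar>W - 1\<bar> * m \<le> D" if m: "m \<ge> 2" for m :: nat
  proof -
    have m0: "m > 0" using m by simp
    obtain i j where "(i, j) \<in> nodes m" using node_exists[OF m] by (auto simp: nodes_def)
    then obtain s where s: "s < n m" "\<kappa> m s = (i, j)"
      using \<kappa>[OF m] unfolding bij_betw_def by (metis image_iff lessThan_iff)
    define k where "k = (i, j)"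
    have k: "k \<in> nodes m" using \<open>(i, j) \<in> nodes m\<close> by (simp add: k_def)
    define G where "G = (\<Sum>t\<in>tris m. inner (gr m t k) (gr m t k))"
    have G: "G \<ge> (real m)\<^sup>2 * (ku + kv)"
    proof -
      have "inner (gr m (k, 1) k) (gr m (k, 1) k) = (real m)\<^sup>2 * (ku + kv)"
        by (simp add: gr_inner du_def dv_def vtx_def prod_eq_iff)
      moreover have "(k, 1) \<in> tris m" by (rule tris_node[of _ 0]) (use k in \<open>auto simp: vtx_def\<close>)
      ultimately show ?thesis unfolding G_def using finite_tris[of m]
        by (metis (no_types, lifting) inner_ge_zero member_le_sum)
    qed
    have Gp: "G > 0" unfolding G_def by (rule gr_sum_pos[OF m0 k])
    have abs_le: "v \<le> x / m \<Longrightarrow> v \<le> \<bar>x\<bar> / m" for v x :: real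
      by (rule order_trans[OF _ divide_right_mono[OF abs_ge_self]]) auto
    have th: "theta_mat m (n m) (\<kappa> m) x $$ (s, s) = area / (real m)\<^sup>2 * (wmean m x k * G)" for x
      using s Gp unfolding G_def by (simp add: theta_mat_def wmean_def k_def)
    let ?d = "\<bar>wmean m (\<alpha>' m) k - wmean m (\<alpha> m) k\<bar>"
    \<comment> \<open>A diagonal entry is area/m^2 times the weighted mean times \<open>G\<close>,
      and \<open>G\<close> is at least m^2 (ku + kv); so an error in the entry bounds the difference
      of the weighted means.\<close>
    have "area * (ku + kv) * ?d = area / (real m)\<^sup>2 * (?d * ((real m)\<^sup>2 * (ku + kv)))" using m0 by simp
    also have "\<dots> \<le> area / (real m)\<^sup>2 * (?d * G)" using area_pos G by (intro mult_left_mono) auto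
    also have "\<dots> = \<bar>theta_mat m (n m) (\<kappa> m) (\<alpha>' m) $$ (s, s) - theta_mat m (n m) (\<kappa> m) (\<alpha> m) $$ (s, s)\<bar>"
      unfolding th right_diff_distrib[symmetric] left_diff_distrib[symmetric] abs_mult using area_pos Gp by simp
    also have "\<dots> \<le> \<bar>C0\<bar> / (real m)\<^sup>2" by (rule order_trans[OF err[OF m s(1)]]) (simp add: divide_right_mono)
    also have "\<dots> \<le> \<bar>C0\<bar> / m" using m0 by (intro divide_left_mono) (auto simp: power2_eq_square)
    finally have "?d \<le> \<bar>C0\<bar> / m / (area * (ku + kv))"
      using area_pos k_pos by (subst pos_le_divide_eq) (simp_all add: mult.commute)
    moreover have "\<bar>wmean m (\<alpha> m) k - a (nd m k)\<bar> \<le> \<bar>E\<bar> / m"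
      by (rule wmean_close[OF m0 k], rule abs_le, drule (1) al[OF m], simp)
    moreover have "\<bar>wmean m (\<alpha>' m) k - W * a (nd m k)\<bar> \<le> \<bar>E'\<bar> / m"
      by (rule wmean_close[OF m0 k], rule abs_le, drule (1) al'[OF m], simp)
    ultimately have "\<bar>W * a (nd m k) - a (nd m k)\<bar> \<le> \<bar>C0\<bar> / m / (area * (ku + kv)) + \<bar>E\<bar> / m + \<bar>E'\<bar> / m" by linarith
    also have "\<dots> = D / m" by (simp add: D_def add_divide_distrib)
    finally have Wa: "\<bar>W * a (nd m k) - a (nd m k)\<bar> \<le> D / m" .
    have "a (nd m k) * \<bar>W - 1\<bar> \<le> D / m"
    proof -
      have "a (nd m k) > 0" using a0(1) a0(2)[of "nd m k"] nd_closure[OF m0] nodes_subset k by fastforce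
      moreover have "W * a (nd m k) - a (nd m k) = a (nd m k) * (W - 1)" by (simp add: algebra_simps)
      ultimately show ?thesis using Wa by (simp add: abs_mult)
    qed
    moreover have "a0 * \<bar>W - 1\<bar> \<le> a (nd m k) * \<bar>W - 1\<bar>"
      using a0(2)[of "nd m k"] nd_closure[OF m0] nodes_subset k by (intro mult_right_mono) auto
    ultimately have "a0 * \<bar>W - 1\<bar> \<le> D / m" by linarith
    then show ?thesis using m0 by (simp add: pos_le_divide_eq)
  qed
  show ?thesis
  proof (rule ccontr)
    assume "W \<noteq> 1"
    then have p: "a0 * \<bar>W - 1\<bar> > 0" using a0 by simp
    obtain N :: nat where "D / (a0 * \<bar>W - 1\<bar>) < real N" using reals_Archimedean2 by blast
    then have "D < a0 * \<bar>W - 1\<bar> * real N" using p by (simp add: pos_divide_less_eq mult.commute)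
    also have "\<dots> \<le> a0 * \<bar>W - 1\<bar> * real (max N 2)" using p by (intro mult_left_mono) auto
    finally show False using main[of "max N 2"] by simp
  qed
qed

text \<open>The convection form may be negative up to half of the ellipticity bound of the diffusion
  form; this leaves room for quadrature errors.\<close>

lemma mean_data_spectrum:
  fixes M :: "nat set" and n :: "nat \<Rightarrow> nat" and \<kappa> :: "nat \<Rightarrow> nat \<Rightarrow> int \<times> int"
    and \<alpha> :: "nat \<Rightarrow> (int \<times> int) \<times> int \<Rightarrow> real" and b :: "nat \<Rightarrow> (int \<times> int) \<times> int \<Rightarrow> nat \<Rightarrow> R2"
  assumes M: "\<And>m. m \<in> M \<Longrightarrow> m \<ge> 1" and \<kappa>: "\<And>m. m \<in> M \<Longrightarrow> bij_betw (\<kappa> m) {..<n m} (nodes m)"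
    and l: "l > 0" and E: "E \<ge> 0"
    and lo: "\<And>y. y \<in> closure \<Omega> \<Longrightarrow> l\<^sup>2 \<le> a y" and up: "\<And>y. y \<in> closure \<Omega> \<Longrightarrow> a y \<le> Am"
    and al: "\<And>m t r. m \<in> M \<Longrightarrow> t \<in> tris m \<Longrightarrow> r < 3 \<Longrightarrow> \<bar>\<alpha> m t - a (nd m (vtx t r))\<bar> \<le> E / m"
    and alo: "\<And>m t. m \<in> M \<Longrightarrow> t \<in> tris m \<Longrightarrow> l\<^sup>2 \<le> \<alpha> m t"
    and bb: "\<And>m t r. m \<in> M \<Longrightarrow> t \<in> tris m \<Longrightarrow> r < 3 \<Longrightarrow> norm (b m t r) \<le> Bb"
    and low: "\<And>m X. m \<in> M \<Longrightarrow> - (l\<^sup>2 / 2 * (min ku kv * dir_energy m (zf (n m) (\<kappa> m) X))) \<le>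
       Re (FC m (b m) (zf (n m) (\<kappa> m) X))"
  defines "P \<equiv> \<lambda>m. precond (theta_mat m (n m) (\<kappa> m) (\<alpha> m)) (theta_mat m (n m) (\<kappa> m) (\<lambda>_. 1))"
    and "A \<equiv> \<lambda>m. theta_mat m (n m) (\<kappa> m) (\<alpha> m) + psi_mat m (n m) (\<kappa> m) (b m)"
  shows "\<And>m. m \<in> M \<Longrightarrow> invertible_mat (P m)"
    and "in_positive_rectangle M (\<lambda>m. cmat (minv (P m) * A m))"
    and "\<And>\<epsilon>. \<epsilon> > 0 \<Longrightarrow> \<exists>m1 D. \<forall>m\<in>M. m \<ge> m1 \<longrightarrow> real (num_eigenvalues_outside (cmat (minv (P m) * A m)) (ball 1 \<epsilon>)) \<le> D"
proof -
  have d: "dfun m a (\<alpha> m) k = sqrt (wmean m (\<alpha> m) k)" if "m \<in> M" "k \<in> nodes m" for m k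
    using that by (simp add: dfun_def)
  have dd: "diag_data m (2 * E + 2 * E / l) l (sqrt (Am + E)) (\<alpha> m) (dfun m a (\<alpha> m))" if "m \<in> M" for m
    using that by (intro diag_data_dfun M E l al alo lo up)
  have C: "2 * E + 2 * E / l \<ge> 0" using E l by simp
  have lw: "l\<^sup>2 / 2 * min ku kv * dir_energy m (zf (n m) (\<kappa> m) X) \<le>
      FT m (\<alpha> m) (zf (n m) (\<kappa> m) X) + Re (FC m (b m) (zf (n m) (\<kappa> m) X))" if m: "m \<in> M" for m X
  proof -
    have "\<kappa> m i \<in> nodes m" if "i < n m" for i using \<kappa>[OF m] that by (auto simp: bij_betw_def)
    then have "l\<^sup>2 * (min ku kv * dir_energy m (zf (n m) (\<kappa> m) X)) \<le> FT m (\<alpha> m) (zf (n m) (\<kappa> m) X)"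
      by (intro FT_lower supp_zf alo[OF m]) auto
    then show ?thesis using low[OF m, of X] by simp
  qed
  have c3: "l\<^sup>2 / 2 * min ku kv > 0" using l k_pos by simp
  note * = preconditioned_spectrum[where M=M and n=n and \<kappa>=\<kappa> and \<alpha>=\<alpha> and b=b and d="\<lambda>m. dfun m a (\<alpha> m)", OF M \<kappa> d dd l C bb lw c3]
  show "invertible_mat (P m)" if "m \<in> M" for m
    unfolding P_def using that by (intro posdef_inverse(1)[where n="n m"] *(1))
  show "in_positive_rectangle M (\<lambda>m. cmat (minv (P m) * A m))" unfolding P_def A_def by (rule *(2))
  show "\<exists>m1 D. \<forall>m\<in>M. m \<ge> m1 \<longrightarrow> real (num_eigenvalues_outside (cmat (minv (P m) * A m)) (ball 1 \<epsilon>)) \<le> D"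
    if "\<epsilon> > 0" for \<epsilon>
    unfolding P_def A_def using that by (intro *(3))
qed

end

section \<open>The square and the hexagon\<close>

text \<open>For \<sigma> = -1 the first basis vector points left and its coordinate runs over (-1,
  0). The third pair of bounds consists of the sums of the first two.\<close>

lemma lattice_domain_unit_square:
  assumes \<sigma>: "\<sigma> = 1 \<or> \<sigma> = - 1"
  shows "lattice_domain unit_square (0, 0) (\<sigma>, 0) (0, 1) (\<sigma>, 0) (0, 1)
    (if \<sigma> = 1 then 0 else - 1) (if \<sigma> = 1 then 1 else 0) 0 1 (if \<sigma> = 1 then 0 else - 1) (if \<sigma> = 1 then 2 else 1)"
    (is "lattice_domain _ _ _ _ _ _ ?a1 ?a2 _ _ ?g1 ?g2")
proof
  have cl: "closure unit_square = {0..1} \<times> {0..1}" by (simp add: unit_square_def closure_Times)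
  show "unit_square = {y. of_int ?a1 < inner (\<sigma>, 0) (y - (0, 0)) \<and> inner (\<sigma>, 0) (y - (0, 0)) < of_int ?a2 \<and>
      of_int 0 < inner (0, 1) (y - (0, 0)) \<and> inner (0, 1) (y - (0, 0)) < of_int 1 \<and>
      of_int ?g1 < inner (\<sigma>, 0) (y - (0, 0)) + inner (0, 1) (y - (0, 0)) \<and>
      inner (\<sigma>, 0) (y - (0, 0)) + inner (0, 1) (y - (0, 0)) < of_int ?g2}"
    using \<sigma> by (auto simp: unit_square_def)
  show "closure unit_square = {y. of_int ?a1 \<le> inner (\<sigma>, 0) (y - (0, 0)) \<and> inner (\<sigma>, 0) (y - (0, 0)) \<le> of_int ?a2 \<and>
      of_int 0 \<le> inner (0, 1) (y - (0, 0)) \<and> inner (0, 1) (y - (0, 0)) \<le> of_int 1 \<and>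
      of_int ?g1 \<le> inner (\<sigma>, 0) (y - (0, 0)) + inner (0, 1) (y - (0, 0)) \<and>
      inner (\<sigma>, 0) (y - (0, 0)) + inner (0, 1) (y - (0, 0)) \<le> of_int ?g2}"
    using \<sigma> unfolding cl by auto
  show "\<exists>i j. ?a1 * int m < i \<and> i < ?a2 * int m \<and> 0 * int m < j \<and> j < 1 * int m \<and>
      ?g1 * int m < i + j \<and> i + j < ?g2 * int m" if "m \<ge> 2" for m :: nat
    \<comment> \<open>A lattice point one step away from two sides; it is internal because
      \<open>m\<close> is at least 2.\<close>
    by (rule exI[of _ "if \<sigma> = 1 then 1 else - 1"], rule exI[of _ 1]) (use that \<sigma> in auto)
qed (use \<sigma> in auto)

lemma convex_add_combination:
  assumes "convex H" "c \<in> H" "c + e \<in> H" "c + f \<in> H" "0 \<le> \<alpha>" "0 \<le> \<beta>" "\<alpha> + \<beta> \<le> 1"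
  shows "c + \<alpha> *\<^sub>R e + \<beta> *\<^sub>R f \<in> H"
proof -
  have "(\<Sum>i<3. (if i = 0 then 1 - \<alpha> - \<beta> else if i = 1 then \<alpha> else \<beta>) *\<^sub>R (if i = 0 then c else if i = (1::nat) then c + e else c + f)) \<in> H"
    using assms by (intro convex_sum) (auto simp: numeral_3_eq_3 less_Suc_eq)
  then show ?thesis by (simp add: numeral_3_eq_3 algebra_simps)
qed

text \<open>The signs of \<open>s\<close>, \<open>t\<close> and \<open>s + t\<close> cut the hexagon
  into six triangles, each spanned by the centre and two neighbouring vertices.\<close>

lemma closed_hexagon_eq_hull:
  fixes c uu vv p q :: R2
  assumes dual: "inner p uu = 1" "inner p vv = 0" "inner q uu = 0" "inner q vv = 1"
    and expand: "\<And>y. y = inner p y *\<^sub>R uu + inner q y *\<^sub>R vv"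
  shows "convex hull {c + uu, c + vv, c + (vv - uu), c - uu, c - vv, c + (uu - vv)} =
    {y. \<bar>inner p (y - c)\<bar> \<le> 1 \<and> \<bar>inner q (y - c)\<bar> \<le> 1 \<and> \<bar>inner p (y - c) + inner q (y - c)\<bar> \<le> 1}"
    (is "convex hull ?V = ?C")
proof
  have C: "?C = {y. inner p y \<le> 1 + inner p c} \<inter> {y. inner p y \<ge> inner p c - 1} \<inter>
     {y. inner q y \<le> 1 + inner q c} \<inter> {y. inner q y \<ge> inner q c - 1} \<inter>
     {y. inner (p + q) y \<le> 1 + inner (p + q) c} \<inter> {y. inner (p + q) y \<ge> inner (p + q) c - 1}"
    by (auto simp: inner_diff_right inner_add_left)
  have "convex ?C" unfolding C by (intro convex_Int convex_halfspace_le convex_halfspace_ge)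
  moreover have "?V \<subseteq> ?C" by (auto simp: inner_diff_right inner_add_right dual)
  ultimately show "convex hull ?V \<subseteq> ?C" by (intro hull_minimal)
  show "?C \<subseteq> convex hull ?V"
  proof
    fix y assume "y \<in> ?C"
    define s where "s = inner p (y - c)"
    define t where "t = inner q (y - c)"
    have st: "\<bar>s\<bar> \<le> 1" "\<bar>t\<bar> \<le> 1" "\<bar>s + t\<bar> \<le> 1" using \<open>y \<in> ?C\<close> by (auto simp: s_def t_def)
    have y: "y = c + s *\<^sub>R uu + t *\<^sub>R vv" using expand[of "y - c"] by (simp add: s_def t_def algebra_simps)
    let ?H = "convex hull ?V"
    have V: "c + uu \<in> ?H" "c + vv \<in> ?H" "c + (vv - uu) \<in> ?H" "c + - uu \<in> ?H" "c + - vv \<in> ?H" "c + (uu - vv) \<in> ?H"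
      by (auto intro: hull_inc)
    \<comment> \<open>The centre is the midpoint of two opposite vertices.\<close>
    have "(1 / 2) *\<^sub>R (c + uu) + (1 / 2) *\<^sub>R (c + - uu) \<in> ?H" by (intro convexD convex_convex_hull V) auto
    then have c: "c \<in> ?H" by (simp add: algebra_simps flip: scaleR_add_left)
    note comb = convex_add_combination[OF convex_convex_hull c]
    consider "s \<ge> 0" "t \<ge> 0" | "s \<le> 0" "t \<le> 0" | "s \<ge> 0" "t \<le> 0" "s + t \<ge> 0" | "s \<ge> 0" "t \<le> 0" "s + t \<le> 0"
      | "s \<le> 0" "t \<ge> 0" "s + t \<ge> 0" | "s \<le> 0" "t \<ge> 0" "s + t \<le> 0" by linarith
    then show "y \<in> ?H"
    proof cases
      case 1 then show ?thesis using comb[OF V(1,2), of s t] st y by simp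
    next
      case 2 then show ?thesis using comb[OF V(4,5), of "- s" "- t"] st y by simp
    next
      case 3 then show ?thesis using comb[OF V(1,6), of "s + t" "- t"] st y by (simp add: algebra_simps)
    next
      case 4 then show ?thesis using comb[OF V(5,6), of "- (s + t)" s] st y by (simp add: algebra_simps)
    next
      case 5 then show ?thesis using comb[OF V(2,3), of "s + t" "- s"] st y by (simp add: algebra_simps)
    next
      case 6 then show ?thesis using comb[OF V(4,3), of "- (s + t)" t] st y by (simp add: algebra_simps)
    qed
  qed
qed

text \<open>\<open>p\<close> and \<open>q\<close> come from Cramer's rule. The angle of 60 degrees
  gives \<open>inner uu vv\<close> = L^2/2, so \<open>inner p q\<close> is negative and half the
  size of \<open>inner p p\<close> and \<open>inner q q\<close>: the triangles are acute.\<close>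

lemma lattice_domain_hexagon:
  fixes c :: R2
  assumes L: "L > 0"
  shows "\<exists>p q. lattice_domain (hexagon c \<theta> L) c (L *\<^sub>R direction \<theta>) (L *\<^sub>R direction (\<theta> + pi / 3)) p q (- 1) 1 (- 1) 1 (- 1) 1"
proof -
  define uu where "uu = L *\<^sub>R direction \<theta>"
  define vv where "vv = L *\<^sub>R direction (\<theta> + pi / 3)"
  define \<Delta> where "\<Delta> = fst uu * snd vv - snd uu * fst vv"
  have trig: "cos (\<theta> + pi / 3) = cos \<theta> / 2 - sqrt 3 / 2 * sin \<theta>" "sin (\<theta> + pi / 3) = sin \<theta> / 2 + sqrt 3 / 2 * cos \<theta>"
    by (simp_all add: cos_add sin_add cos_60 sin_60)
  have "\<Delta> = L * L * (sqrt 3 / 2) * ((cos \<theta>)\<^sup>2 + (sin \<theta>)\<^sup>2)"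
    unfolding \<Delta>_def uu_def vv_def direction_def trig
    by (simp add: power2_eq_square algebra_simps del: sin_cos_squared_add sin_cos_squared_add2 sin_cos_squared_add3)
  moreover have "L * L * (sqrt 3 / 2) * ((cos \<theta>)\<^sup>2 + (sin \<theta>)\<^sup>2) > 0" using L by simp
  ultimately have \<Delta>: "\<Delta> > 0" by simp
  define p where "p = (snd vv / \<Delta>, - fst vv / \<Delta>)"
  define q where "q = (- snd uu / \<Delta>, fst uu / \<Delta>)"
  have dual: "inner p uu = 1" "inner p vv = 0" "inner q uu = 0" "inner q vv = 1"
    using \<Delta> by (simp_all add: p_def q_def inner_prod_def field_simps) (simp_all add: \<Delta>_def algebra_simps)
  have expand: "y = inner p y *\<^sub>R uu + inner q y *\<^sub>R vv" for y
  proof -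
    have "\<Delta> *\<^sub>R y = (snd vv * fst y - fst vv * snd y) *\<^sub>R uu + (fst uu * snd y - snd uu * fst y) *\<^sub>R vv"
      by (simp add: prod_eq_iff \<Delta>_def algebra_simps)
    also have "\<dots> = \<Delta> *\<^sub>R (inner p y *\<^sub>R uu + inner q y *\<^sub>R vv)"
      using \<Delta> by (simp add: p_def q_def inner_prod_def scaleR_add_right right_diff_distrib distrib_left)
    finally show ?thesis using \<Delta> by simp
  qed
  have uv: "inner uu vv = L\<^sup>2 / 2" "inner uu uu = L\<^sup>2" "inner vv vv = L\<^sup>2"
  proof -
    have 1: "inner uu uu = L\<^sup>2 * ((cos \<theta>)\<^sup>2 + (sin \<theta>)\<^sup>2)" "inner vv vv = L\<^sup>2 * ((cos (\<theta> + pi / 3))\<^sup>2 + (sin (\<theta> + pi / 3))\<^sup>2)"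
      unfolding uu_def vv_def direction_def
      by (simp_all add: inner_prod_def power2_eq_square algebra_simps del: sin_cos_squared_add sin_cos_squared_add2 sin_cos_squared_add3)
    have 2: "inner uu vv = L\<^sup>2 / 2 * ((cos \<theta>)\<^sup>2 + (sin \<theta>)\<^sup>2)"
      unfolding uu_def vv_def direction_def trig
      by (simp add: inner_prod_def power2_eq_square algebra_simps del: sin_cos_squared_add sin_cos_squared_add2 sin_cos_squared_add3)
    show "inner uu vv = L\<^sup>2 / 2" "inner uu uu = L\<^sup>2" "inner vv vv = L\<^sup>2" using 1 2 by simp_all
  qed
  have pq: "inner p q = - (inner uu vv / \<Delta>\<^sup>2)" "inner p p = inner vv vv / \<Delta>\<^sup>2" "inner q q = inner uu uu / \<Delta>\<^sup>2"
    using \<Delta> by (simp_all add: p_def q_def inner_prod_def power2_eq_square field_simps)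
  let ?C = "{y. \<bar>inner p (y - c)\<bar> \<le> 1 \<and> \<bar>inner q (y - c)\<bar> \<le> 1 \<and> \<bar>inner p (y - c) + inner q (y - c)\<bar> \<le> 1}"
  \<comment> \<open>The vertices with indices 2 to 5, expressed in the two basis directions.\<close>
  have dir: "direction (\<theta> + 2 * pi / 3) = direction (\<theta> + pi / 3) - direction \<theta>" "direction (\<theta> + pi) = - direction \<theta>"
    "direction (\<theta> + 4 * pi / 3) = - direction (\<theta> + pi / 3)" "direction (\<theta> + 5 * pi / 3) = direction \<theta> - direction (\<theta> + pi / 3)"
  proof -
    have neg: "direction (\<phi> + pi) = - direction \<phi>" for \<phi> by (simp add: direction_def)
    have minus: "direction (\<theta> - pi / 3) = direction \<theta> - direction (\<theta> + pi / 3)"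
      unfolding direction_def trig by (simp add: cos_diff sin_diff cos_60 sin_60)
    show "direction (\<theta> + 2 * pi / 3) = direction (\<theta> + pi / 3) - direction \<theta>"
      using neg[of "\<theta> - pi / 3"] unfolding minus by (simp add: algebra_simps)
    show "direction (\<theta> + pi) = - direction \<theta>" by (rule neg)
    show "direction (\<theta> + 4 * pi / 3) = - direction (\<theta> + pi / 3)"
      using neg[of "\<theta> + pi / 3"] by (simp add: algebra_simps)
    have "\<theta> + 5 * pi / 3 = (\<theta> - pi / 3) + 2 * pi" by simp
    moreover have "direction (\<phi> + 2 * pi) = direction \<phi>" for \<phi> by (simp add: direction_def)
    ultimately show "direction (\<theta> + 5 * pi / 3) = direction \<theta> - direction (\<theta> + pi / 3)"
      by (simp only: minus)
  qed
  have six: "{..<6::nat} = {0, 1, 2, 3, 4, 5}" by auto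
  have "(\<lambda>k::nat. c + L *\<^sub>R direction (\<theta> + of_nat k * pi / 3)) ` {..<6} =
      {c + uu, c + vv, c + (vv - uu), c - uu, c - vv, c + (uu - vv)}"
    unfolding six uu_def vv_def by (simp add: dir scaleR_diff_right)
  then have H: "hexagon c \<theta> L = interior ?C"
    unfolding hexagon_def using closed_hexagon_eq_hull[OF dual expand, of c] by simp
  have C: "?C = {y. inner p y \<le> 1 + inner p c} \<inter> {y. inner p y \<ge> inner p c - 1} \<inter>
     {y. inner q y \<le> 1 + inner q c} \<inter> {y. inner q y \<ge> inner q c - 1} \<inter>
     {y. inner (p + q) y \<le> 1 + inner (p + q) c} \<inter> {y. inner (p + q) y \<ge> inner (p + q) c - 1}"
    by (auto simp: inner_diff_right inner_add_left)
  have nz: "p \<noteq> 0" "q \<noteq> 0" "p + q \<noteq> 0" using dual by (auto simp: eq_neg_iff_add_eq_0[symmetric])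
  have I: "interior ?C = {y. \<bar>inner p (y - c)\<bar> < 1 \<and> \<bar>inner q (y - c)\<bar> < 1 \<and> \<bar>inner p (y - c) + inner q (y - c)\<bar> < 1}"
    unfolding C by (simp only: interior_Int interior_halfspace_le[OF nz(1)] interior_halfspace_ge[OF nz(1)]
      interior_halfspace_le[OF nz(2)] interior_halfspace_ge[OF nz(2)] interior_halfspace_le[OF nz(3)] interior_halfspace_ge[OF nz(3)])
      (auto simp: inner_diff_right inner_add_left)
  have "convex ?C" "closed ?C"
    unfolding C by (intro convex_Int closed_Int convex_halfspace_le convex_halfspace_ge closed_halfspace_le closed_halfspace_ge)+
  moreover have "c \<in> interior ?C" unfolding I by simp
  \<comment> \<open>A closed convex set with an interior point is the closure of its
    interior.\<close>
  ultimately have cl: "closure (interior ?C) = ?C" using convex_closure_interior[of ?C] by auto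
  have "lattice_domain (hexagon c \<theta> L) c uu vv p q (- 1) 1 (- 1) 1 (- 1) 1"
  proof
    show "inner p q \<le> 0" "inner p p + inner p q > 0" "inner q q + inner p q > 0"
      unfolding pq uv using L \<Delta> by (simp_all add: field_simps)
    show "hexagon c \<theta> L = {y. of_int (- 1) < inner p (y - c) \<and> inner p (y - c) < of_int 1 \<and>
        of_int (- 1) < inner q (y - c) \<and> inner q (y - c) < of_int 1 \<and>
        of_int (- 1) < inner p (y - c) + inner q (y - c) \<and> inner p (y - c) + inner q (y - c) < of_int 1}"
      unfolding H I by auto
    show "closure (hexagon c \<theta> L) = {y. of_int (- 1) \<le> inner p (y - c) \<and> inner p (y - c) \<le> of_int 1 \<and>
        of_int (- 1) \<le> inner q (y - c) \<and> inner q (y - c) \<le> of_int 1 \<and>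
        of_int (- 1) \<le> inner p (y - c) + inner q (y - c) \<and> inner p (y - c) + inner q (y - c) \<le> of_int 1}"
      unfolding H cl by auto
    show "\<exists>i j. - 1 * int m < i \<and> i < 1 * int m \<and> - 1 * int m < j \<and> j < 1 * int m \<and>
        - 1 * int m < i + j \<and> i + j < 1 * int m" if "m \<ge> 2" for m :: nat
      by (rule exI[of _ 0], rule exI[of _ 0]) (use that in auto)
  qed (fact dual expand | simp)+
  then show ?thesis unfolding uu_def vv_def by blast
qed

section \<open>Return to the finite element matrices\<close>

lemma in_positive_rectangle_cong:
  "(\<And>m. m \<in> M \<Longrightarrow> X m = Y m) \<Longrightarrow> in_positive_rectangle M X \<longleftrightarrow> in_positive_rectangle M Y"
  by (simp add: in_positive_rectangle_def)

lemma C2_closure_imp_C1_closure: "C2_closure \<Omega> f \<Longrightarrow> C1_closure \<Omega> f"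
  unfolding C2_closure_def C1_closure_def by blast

context lattice_domain
begin

lemma ma_1: "m > 0 \<Longrightarrow> t \<in> tris m \<Longrightarrow> ma m (\<lambda>_. 1) t = 1"
  using ma_close[of m t 0 "\<lambda>_. 1" 0] by simp

lemma qa_1: "qa qf \<nu> m (\<lambda>_. 1) t = qW qf"
  by (simp add: qa_def qW_def)

text \<open>Both halves verify the hypotheses of \<open>mean_data_spectrum\<close>: exact data do so
  on every mesh, quadrature data from some level on.\<close>

lemma lattice_meshes_spectrum:
  fixes \<T> :: "nat \<Rightarrow> R2 set set" and L :: real and x :: "nat \<Rightarrow> nat \<Rightarrow> R2"
  assumes L: "L > 0" and m0: "m0 \<ge> 1" "m0 \<le> 2" and \<T>: "\<And>m. m \<ge> m0 \<Longrightarrow> \<T> m = tri m ` tris m"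
    and a: "C1_closure \<Omega> a" and a0: "a0 > 0" and a_ge: "\<And>y. y \<in> closure \<Omega> \<Longrightarrow> a y \<ge> a0"
    and \<beta>: "C1_closure \<Omega> \<beta>" and div: "\<And>y. y \<in> \<Omega> \<Longrightarrow> divergence \<beta> y \<ge> 0"
    and x: "\<And>m. m \<ge> m0 \<Longrightarrow> bij_betw (x m) {..<num_nodes \<Omega> (\<T> m)} (internal_nodes \<Omega> (\<T> m))"
  shows "let \<Theta> = (\<lambda>m b. stiffness \<Omega> (\<T> m) (x m) b);
          \<Psi> = (\<lambda>m. convection \<Omega> (\<T> m) (x m) \<beta>);
          P = (\<lambda>m. precond (\<Theta> m a) (\<Theta> m (\<lambda>_. 1)));
          A = (\<lambda>m. \<Theta> m a + \<Psi> m);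
          X = (\<lambda>m. cmat (minv (P m) * A m))
      in (\<forall>m\<ge>m0. invertible_mat (P m)) \<and>
         properly_clustered {m0..} X 1 \<and>
         in_positive_rectangle {m0..} X" (is ?exact)
    and "quadrature_formula qf \<Longrightarrow> (\<forall>m\<ge>m0. local_numbering (\<T> m) (\<nu> m)) \<Longrightarrow>
      let \<Theta> = (\<lambda>m b. stiffness_quad qf (\<nu> m) \<Omega> (\<T> m) (x m) b);
           \<Psi> = (\<lambda>m. convection_quad qf (\<nu> m) \<Omega> (\<T> m) (x m) \<beta>);
           P = (\<lambda>m. precond (\<Theta> m a) (\<Theta> m (\<lambda>_. 1)));
           A = (\<lambda>m. \<Theta> m a + \<Psi> m);
           X = (\<lambda>m. cmat (minv (P m) * A m))
       in entries_error_h2 (\<lambda>m. L / real m) m0 (\<lambda>m. \<Theta> m a) (\<lambda>m. stiffness \<Omega> (\<T> m) (x m) a) \<longrightarrow>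
          properly_clustered {m. m \<ge> m0 \<and> invertible_mat (P m)} X 1 \<and>
          (\<exists>m1\<ge>m0. (\<forall>m\<ge>m1. invertible_mat (P m)) \<and> in_positive_rectangle {m1..} X)"
      (is "_ \<Longrightarrow> _ \<Longrightarrow> ?quad")
proof -
  have ac: "continuous_on (closure \<Omega>) a" and \<beta>c: "continuous_on (closure \<Omega>) \<beta>"
    using a \<beta> by (simp_all add: C1_closure_def)
  note lipschitz = C1_closure_lipschitz[OF open_Omega convex_Omega compact_closure_Omega]
  obtain La where La: "La \<ge> 0" "\<And>y z. y \<in> closure \<Omega> \<Longrightarrow> z \<in> closure \<Omega> \<Longrightarrow> norm (a y - a z) \<le> La * norm (y - z)"
    using lipschitz[OF a] by blast
  obtain Lb where Lb: "Lb \<ge> 0" "\<And>y z. y \<in> closure \<Omega> \<Longrightarrow> z \<in> closure \<Omega> \<Longrightarrow> norm (\<beta> y - \<beta> z) \<le> Lb * norm (y - z)"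
    using lipschitz[OF \<beta>] by blast
  have "bounded (a ` closure \<Omega>)" "bounded (\<beta> ` closure \<Omega>)"
    by (intro compact_imp_bounded compact_continuous_image ac \<beta>c compact_closure_Omega)+
  then obtain Am Bb where Am: "\<And>y. y \<in> closure \<Omega> \<Longrightarrow> norm (a y) \<le> Am"
    and Bb: "Bb > 0" "\<And>y. y \<in> closure \<Omega> \<Longrightarrow> norm (\<beta> y) \<le> Bb"
    unfolding bounded_pos by (auto simp: image_iff)
  have up: "a y \<le> Am" if "y \<in> closure \<Omega>" for y using Am[OF that] by simp
  define n where "n m = num_nodes \<Omega> (\<T> m)" for m
  \<comment> \<open>\<open>x\<close> numbers points of the plane, \<open>\<kappa>\<close> their
    lattice coordinates in the same order.\<close>
  define \<kappa> where "\<kappa> m i = inv_into (nodes m) (nd m) (x m i)" for m i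
  have mp: "m > 0" "m \<ge> 1" if "m \<ge> m0" for m using that m0 by auto
  have int: "internal_nodes \<Omega> (\<T> m) = nd m ` nodes m" if "m \<ge> m0" for m
    using tri_nodes_internal[OF mp(1)] \<T> that by simp
  have \<kappa>: "bij_betw (\<kappa> m) {..<n m} (nodes m)" if m: "m \<ge> m0" for m
  proof -
    have "inj_on (nd m) (nodes m)" using nd_inj[OF mp(1)[OF m]] by (simp add: inj_on_def)
    then have "bij_betw (inv_into (nodes m) (nd m)) (nd m ` nodes m) (nodes m)"
      by (intro bij_betw_inv_into) (simp add: bij_betw_def)
    from bij_betw_trans[OF x[OF m, unfolded int[OF m]] this]
    show ?thesis unfolding \<kappa>_def n_def by (simp add: o_def int[OF m])
  qed
  have \<kappa>n: "\<kappa> m i \<in> nodes m" if "m \<ge> m0" "i < n m" for m i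
    using \<kappa>[OF that(1)] that(2) by (auto simp: bij_betw_def)
  have \<kappa>x: "\<kappa> m i \<in> nodes m \<and> x m i = nd m (\<kappa> m i)" if "m \<ge> m0" "i < n m" for m i
  proof -
    have "x m i \<in> nd m ` nodes m"
      using bij_betwE[OF x[OF that(1)]] that(2) by (simp add: n_def int[OF that(1)])
    then show ?thesis unfolding \<kappa>_def by (simp add: f_inv_into_f inv_into_into)
  qed
  have nT: "num_nodes \<Omega> (tri m ` tris m) = n m" if "m \<ge> m0" for m using \<T>[OF that] by (simp add: n_def)
  note mats = matrices_eq[OF mp(1) \<kappa>x nT]
  have Sa: "stiffness \<Omega> (\<T> m) (x m) a = theta_mat m (n m) (\<kappa> m) (ma m a)"
    and S1: "stiffness \<Omega> (\<T> m) (x m) (\<lambda>_. 1) = theta_mat m (n m) (\<kappa> m) (\<lambda>_. 1)"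
    and Cb: "convection \<Omega> (\<T> m) (x m) \<beta> = psi_mat m (n m) (\<kappa> m) (mb m \<beta>)" if m: "m \<ge> m0" for m
  proof -
    show "stiffness \<Omega> (\<T> m) (x m) a = theta_mat m (n m) (\<kappa> m) (ma m a)"
      and "convection \<Omega> (\<T> m) (x m) \<beta> = psi_mat m (n m) (\<kappa> m) (mb m \<beta>)"
      using mats(1)[OF m m _ m ac] mats(2)[OF m m _ m \<beta>c] by (simp_all add: \<T>[OF m])
    have "stiffness \<Omega> (\<T> m) (x m) (\<lambda>_. 1) = theta_mat m (n m) (\<kappa> m) (ma m (\<lambda>_. 1))"
      using mats(1)[OF m m _ m continuous_on_const] by (simp add: \<T>[OF m])
    then show "stiffness \<Omega> (\<T> m) (x m) (\<lambda>_. 1) = theta_mat m (n m) (\<kappa> m) (\<lambda>_. 1)"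
      using theta_mat_cong[of m "ma m (\<lambda>_. 1)" "\<lambda>_. 1"] ma_1[OF mp(1)[OF m]] by simp
  qed
  define E where "E = La * dia"
  have E: "E \<ge> 0" using La dia_nonneg by (simp add: E_def)
  have al: "\<bar>ma m a t - a (nd m (vtx t r))\<bar> \<le> E / m" if "m \<ge> m0" "t \<in> tris m" "r < 3" for m t r
    unfolding E_def by (rule ma_close[OF mp(1)[OF that(1)] that(2,3) ac La(2,1)])
  show ?exact
  proof -
    \<comment> \<open>With exact integrals the means of \<open>a\<close> stay above
      \<open>a0\<close> and the convection form has nonnegative real part, so no threshold on
      \<open>m\<close> arises.\<close>
    have l: "sqrt a0 > 0" and l2: "(sqrt a0)\<^sup>2 = a0" using a0 by simp_all
    have low: "- ((sqrt a0)\<^sup>2 / 2 * (min ku kv * dir_energy m (zf (n m) (\<kappa> m) X))) \<le> Re (FC m (mb m \<beta>) (zf (n m) (\<kappa> m) X))"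
      if m: "m \<in> {m0..}" for m X
    proof -
      have "0 \<le> (sqrt a0)\<^sup>2 / 2 * (min ku kv * dir_energy m (zf (n m) (\<kappa> m) X))"
        using k_pos dir_energy_nonneg by (intro mult_nonneg_nonneg) auto
      moreover have "0 \<le> Re (FC m (mb m \<beta>) (zf (n m) (\<kappa> m) X))"
        using m by (intro Re_FC_nonneg \<beta> div mp \<kappa>n) auto
      ultimately show ?thesis by linarith
    qed
    have M: "m \<ge> 1" and \<kappa>': "bij_betw (\<kappa> m) {..<n m} (nodes m)" if "m \<in> {m0..}" for m using that mp \<kappa> by auto
    have lo: "(sqrt a0)\<^sup>2 \<le> a y" if "y \<in> closure \<Omega>" for y using a_ge[OF that] l2 by simp
    have al': "\<bar>ma m a t - a (nd m (vtx t r))\<bar> \<le> E / m" if "m \<in> {m0..}" "t \<in> tris m" "r < 3" for m t r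
      using al that by simp
    have alo: "(sqrt a0)\<^sup>2 \<le> ma m a t" if "m \<in> {m0..}" "t \<in> tris m" for m t
      using that by (intro ma_ge ac lo mp) auto
    have bb: "norm (mb m \<beta> t r) \<le> Bb" if "m \<in> {m0..}" "t \<in> tris m" "r < 3" for m t r
      using that by (intro mb_bound Bb \<beta>c mp) auto
    note R = mean_data_spectrum[where M="{m0..}" and n=n and \<kappa>=\<kappa> and \<alpha>="\<lambda>m. ma m a" and b="\<lambda>m. mb m \<beta>",
        OF M \<kappa>' l E lo up al' alo bb low]
    show ?thesis unfolding Let_def
    proof (intro conjI allI impI)
      show "invertible_mat (precond (stiffness \<Omega> (\<T> m) (x m) a) (stiffness \<Omega> (\<T> m) (x m) (\<lambda>_. 1)))" if "m \<ge> m0" for m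
        unfolding Sa[OF that] S1[OF that] by (rule R(1)) (use that in auto)
      show "in_positive_rectangle {m0..} (\<lambda>m. cmat (minv (precond (stiffness \<Omega> (\<T> m) (x m) a) (stiffness \<Omega> (\<T> m) (x m) (\<lambda>_. 1))) *
          (stiffness \<Omega> (\<T> m) (x m) a + convection \<Omega> (\<T> m) (x m) \<beta>)))"
        by (rule in_positive_rectangle_cong[THEN iffD2, OF _ R(2)]) (simp_all add: Sa S1 Cb)
      show "properly_clustered {m0..} (\<lambda>m. cmat (minv (precond (stiffness \<Omega> (\<T> m) (x m) a) (stiffness \<Omega> (\<T> m) (x m) (\<lambda>_. 1))) *
          (stiffness \<Omega> (\<T> m) (x m) a + convection \<Omega> (\<T> m) (x m) \<beta>))) 1"
      proof (rule properly_clusteredI)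
        fix \<epsilon> :: real assume "\<epsilon> > 0"
        then obtain m1 D where "\<forall>m\<in>{m0..}. m \<ge> m1 \<longrightarrow> real (num_eigenvalues_outside
            (cmat (minv (precond (theta_mat m (n m) (\<kappa> m) (ma m a)) (theta_mat m (n m) (\<kappa> m) (\<lambda>_. 1))) *
              (theta_mat m (n m) (\<kappa> m) (ma m a) + psi_mat m (n m) (\<kappa> m) (mb m \<beta>)))) (ball 1 \<epsilon>)) \<le> D"
          using R(3) by blast
        then show "\<exists>m1 C. \<forall>m\<in>{m0..}. m1 \<le> m \<longrightarrow> real (num_eigenvalues_outside
            (cmat (minv (precond (stiffness \<Omega> (\<T> m) (x m) a) (stiffness \<Omega> (\<T> m) (x m) (\<lambda>_. 1))) *
              (stiffness \<Omega> (\<T> m) (x m) a + convection \<Omega> (\<T> m) (x m) \<beta>))) (ball 1 \<epsilon>)) \<le> C"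
          by (intro exI[of _ m1] exI[of _ D]) (simp add: Sa S1 Cb)
      qed
    qed
  qed
  show ?quad if qf: "quadrature_formula qf" and num: "\<forall>m\<ge>m0. local_numbering (\<T> m) (\<nu> m)"
    unfolding Let_def
  proof (intro impI)
    assume err: "entries_error_h2 (\<lambda>m. L / real m) m0 (\<lambda>m. stiffness_quad qf (\<nu> m) \<Omega> (\<T> m) (x m) a) (\<lambda>m. stiffness \<Omega> (\<T> m) (x m) a)"
    have \<nu>: "local_numbering (tri m ` tris m) (\<nu> m)" if "m \<ge> m0" for m using num \<T> that by auto
    define E' where "E' = qN qf * La * dia"
    have E': "E' \<ge> 0" unfolding E'_def using La(1) dia_nonneg qN_nonneg by simp
    have qa: "\<bar>qa qf (\<nu> m) m a t - qW qf * a (nd m (vtx t r))\<bar> \<le> E' / m" if "m \<ge> m0" "t \<in> tris m" "r < 3" for m t r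
      unfolding E'_def by (rule qa_close[OF mp(1)[OF that(1)] qf \<nu>[OF that(1)] that(2,3) La(2,1)])
    have Qa: "stiffness_quad qf (\<nu> m) \<Omega> (\<T> m) (x m) b = theta_mat m (n m) (\<kappa> m) (qa qf (\<nu> m) m b)" if m: "m \<ge> m0" for m b
      using mats(3)[OF m m _ m qf \<nu>[OF m]] by (simp add: \<T>[OF m])
    have Qb: "convection_quad qf (\<nu> m) \<Omega> (\<T> m) (x m) \<beta> = psi_mat m (n m) (\<kappa> m) (qb qf (\<nu> m) m \<beta>)" if m: "m \<ge> m0" for m
      using mats(4)[OF m m _ m qf \<nu>[OF m]] by (simp add: \<T>[OF m])
    obtain C where C: "\<And>m i j. m \<ge> m0 \<Longrightarrow> i < n m \<Longrightarrow> j < n m \<Longrightarrow>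
        \<bar>theta_mat m (n m) (\<kappa> m) (qa qf (\<nu> m) m a) $$ (i, j) - theta_mat m (n m) (\<kappa> m) (ma m a) $$ (i, j)\<bar> \<le> C * (L / real m)\<^sup>2"
      using err unfolding entries_error_h2_def by (auto simp: Sa Qa carrier_matD[OF theta_carrier])
    \<comment> \<open>From here on the formula reproduces constants, so that the computed Theta(1)
      is the exact one.\<close>
    have W: "qW qf = 1"
    proof (rule total_weight_1[where a=a and \<alpha>="\<lambda>m. ma m a" and \<alpha>'="\<lambda>m. qa qf (\<nu> m) m a" and n=n and \<kappa>=\<kappa> and E=E and E'=E' and ?C0.0="C * L\<^sup>2", OF a0 a_ge])
      fix m i assume "m \<ge> 2" "i < n m"
      then show "\<bar>theta_mat m (n m) (\<kappa> m) (qa qf (\<nu> m) m a) $$ (i, i) - theta_mat m (n m) (\<kappa> m) (ma m a) $$ (i, i)\<bar> \<le> C * L\<^sup>2 / (real m)\<^sup>2"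
        using C[of m i i] m0 by (simp add: power_divide)
    qed (use al qa \<kappa> m0 in auto)
    have Q1: "stiffness_quad qf (\<nu> m) \<Omega> (\<T> m) (x m) (\<lambda>_. 1) = theta_mat m (n m) (\<kappa> m) (\<lambda>_. 1)" if m: "m \<ge> m0" for m
      unfolding Qa[OF m] by (rule theta_mat_cong) (simp add: qa_1 W)
    \<comment> \<open>\<open>B\<close> bounds each difference of quadrature and exact data, and
      \<open>m\<close> times the sum of the three differences on a triangle.\<close>
    define B where "B = (qN qf + 1) * (Bb + Lb * dia)"
    have B: "B \<ge> 0" unfolding B_def using qN_nonneg[of qf] Bb(1) Lb(1) dia_nonneg by simp
    define N where "N = (norm p + norm q) * B * 60"
    \<comment> \<open>Quadrature means lie only within \<open>E' / m\<close> of \<open>a\<close>;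
      half of \<open>a0\<close> is given up for this.\<close>
    define l where "l = sqrt (a0 / 2)"
    have l: "l > 0" and l2: "l\<^sup>2 = a0 / 2" using a0 by (simp_all add: l_def)
    \<comment> \<open>The last condition keeps the convection error, at most \<open>N / m\<close>
      times the energy, within half of the diffusion bound.\<close>
    obtain m1 where m1: "m1 \<ge> m0" "\<And>m. m \<ge> m1 \<Longrightarrow> E' / m \<le> a0 / 2"
      "\<And>m. m \<ge> m1 \<Longrightarrow> N / m \<le> l\<^sup>2 / 2 * min ku kv"
    proof -
      have *: "eventually (\<lambda>m. c / real m \<le> e) sequentially" if "e > 0" for c e :: real
        using order_tendstoD(2)[OF lim_const_over_n that, of c] by (rule eventually_mono) simp
      have "eventually (\<lambda>m. m \<ge> m0 \<and> E' / m \<le> a0 / 2 \<and> N / m \<le> l\<^sup>2 / 2 * min ku kv) sequentially"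
        using a0 l k_pos by (intro eventually_conj eventually_ge_at_top *) auto
      then show thesis using that by (auto simp: eventually_sequentially)
    qed
    have low: "- (l\<^sup>2 / 2 * (min ku kv * dir_energy m (zf (n m) (\<kappa> m) X))) \<le> Re (FC m (qb qf (\<nu> m) m \<beta>) (zf (n m) (\<kappa> m) X))"
      if m: "m \<in> {m1..}" for m X
    proof -
      have mm: "m \<ge> m0" using m m1(1) by simp
      let ?z = "zf (n m) (\<kappa> m) X" and ?b = "\<lambda>t r. qb qf (\<nu> m) m \<beta> t r - mb m \<beta> t r"
      have b: "norm (?b t r) \<le> B" if "t \<in> tris m" "r < 3" for t r
      proof -
        have "norm (?b t r) \<le> qN qf * Bb + Bb"
          by (rule order_trans[OF norm_triangle_ineq4], intro add_mono qb_bound mb_bound mp mm qf \<nu> \<beta>c Bb that)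
        also have "\<dots> \<le> B" unfolding B_def using qN_nonneg[of qf] Lb(1) dia_nonneg by (simp add: algebra_simps)
        finally show ?thesis .
      qed
      have sb: "norm (\<Sum>r<3. ?b t r) \<le> B / m" if t: "t \<in> tris m" for t
      proof -
        let ?v = "\<beta> (nd m (vtx t 0))"
        \<comment> \<open>The nodal value of \<beta> cancels because the total weight is 1; what
          remains is of order 1/m, as \<open>FC_cancel_bound\<close> asks.\<close>
        have "(\<Sum>r<3. ?b t r) = ((\<Sum>r<3. qb qf (\<nu> m) m \<beta> t r) - qW qf *\<^sub>R ?v) - ((\<Sum>r<3. mb m \<beta> t r) - ?v)"
          by (simp add: W sum_subtractf)
        also have "norm \<dots> \<le> qN qf * Lb * dia / m + Lb * dia / m"
          by (rule order_trans[OF norm_triangle_ineq4], intro add_mono qb_sum mb_sum mp mm qf \<nu> \<beta>c Lb t)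
        also have "\<dots> \<le> B / m" unfolding B_def add_divide_distrib[symmetric]
          using qN_nonneg[of qf] Bb(1) by (intro divide_right_mono) (simp_all add: algebra_simps)
        finally show ?thesis .
      qed
      have "cmod (FC m ?b ?z) \<le> (1 / m) * (norm p + norm q) * B * (60 * dir_energy m ?z)"
        by (rule FC_cancel_bound[OF mp(2)[OF mm] supp_zf b sb B]) (rule \<kappa>n[OF mm])
      also have "\<dots> = N / m * dir_energy m ?z" by (simp add: N_def)
      also have "\<dots> \<le> (l\<^sup>2 / 2 * min ku kv) * dir_energy m ?z"
        using m m1(3) by (intro mult_right_mono dir_energy_nonneg) auto
      finally have "cmod (FC m (qb qf (\<nu> m) m \<beta>) ?z - FC m (mb m \<beta>) ?z) \<le> l\<^sup>2 / 2 * (min ku kv * dir_energy m ?z)"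
        unfolding FC_diff by (simp add: mult.assoc)
      moreover have "0 \<le> Re (FC m (mb m \<beta>) ?z)" by (intro Re_FC_nonneg \<beta> div mp mm \<kappa>n)
      ultimately show ?thesis
        using abs_Re_le_cmod[of "FC m (qb qf (\<nu> m) m \<beta>) ?z - FC m (mb m \<beta>) ?z"] by simp
    qed
    have M: "m \<ge> 1" and \<kappa>': "bij_betw (\<kappa> m) {..<n m} (nodes m)" if "m \<in> {m1..}" for m using that mp \<kappa> m1(1) by auto
    have lo: "l\<^sup>2 \<le> a y" if "y \<in> closure \<Omega>" for y using a_ge[OF that] l2 a0 by simp
    have al': "\<bar>qa qf (\<nu> m) m a t - a (nd m (vtx t r))\<bar> \<le> E' / m" if "m \<in> {m1..}" "t \<in> tris m" "r < 3" for m t r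
      using qa[of m t r] that m1(1) by (simp add: W)
    have alo: "l\<^sup>2 \<le> qa qf (\<nu> m) m a t" if m: "m \<in> {m1..}" and t: "t \<in> tris m" for m t
    proof -
      have "nd m (vtx t 0) \<in> closure \<Omega>" using m m1(1) mp by (intro vtx_closure t) auto
      then have "a0 \<le> a (nd m (vtx t 0))" by (rule a_ge)
      moreover have "E' / m \<le> a0 / 2" using m by (intro m1(2)) simp
      ultimately show ?thesis using al'[OF m t, of 0] l2 by linarith
    qed
    have bb: "norm (qb qf (\<nu> m) m \<beta> t r) \<le> qN qf * Bb" if "m \<in> {m1..}" "t \<in> tris m" "r < 3" for m t r
      using that m1(1) by (intro qb_bound Bb mp qf \<nu>) auto
    note R = mean_data_spectrum[where M="{m1..}" and n=n and \<kappa>=\<kappa> and \<alpha>="\<lambda>m. qa qf (\<nu> m) m a" and b="\<lambda>m. qb qf (\<nu> m) m \<beta>",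
        OF M \<kappa>' l E' lo up al' alo bb low]
    let ?P = "\<lambda>m. precond (stiffness_quad qf (\<nu> m) \<Omega> (\<T> m) (x m) a) (stiffness_quad qf (\<nu> m) \<Omega> (\<T> m) (x m) (\<lambda>_. 1))"
    let ?A = "\<lambda>m. stiffness_quad qf (\<nu> m) \<Omega> (\<T> m) (x m) a + convection_quad qf (\<nu> m) \<Omega> (\<T> m) (x m) \<beta>"
    have "invertible_mat (?P m)" if "m \<ge> m1" for m
    proof -
      have m: "m \<ge> m0" using that m1(1) by simp
      show ?thesis unfolding Q1[OF m] unfolding Qa[OF m] by (rule R(1)) (use that in auto)
    qed
    moreover have "in_positive_rectangle {m1..} (\<lambda>m. cmat (minv (?P m) * ?A m))"
      by (rule in_positive_rectangle_cong[THEN iffD2, OF _ R(2)]) (use m1(1) in \<open>simp_all add: Q1 Qb\<close>, simp_all add: Qa)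
    \<comment> \<open>This set may contain levels below \<open>m1\<close> whose preconditioner
      happens to be invertible; \<open>properly_clusteredI\<close> absorbs these finitely
      many.\<close>
    moreover have "properly_clustered {m. m \<ge> m0 \<and> invertible_mat (?P m)} (\<lambda>m. cmat (minv (?P m) * ?A m)) 1"
    proof (rule properly_clusteredI)
      fix \<epsilon> :: real assume "\<epsilon> > 0"
      then obtain m2 D where D: "\<forall>m\<in>{m1..}. m \<ge> m2 \<longrightarrow> real (num_eigenvalues_outside
          (cmat (minv (precond (theta_mat m (n m) (\<kappa> m) (qa qf (\<nu> m) m a)) (theta_mat m (n m) (\<kappa> m) (\<lambda>_. 1))) *
            (theta_mat m (n m) (\<kappa> m) (qa qf (\<nu> m) m a) + psi_mat m (n m) (\<kappa> m) (qb qf (\<nu> m) m \<beta>)))) (ball 1 \<epsilon>)) \<le> D"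
        using R(3) by blast
      have "real (num_eigenvalues_outside (cmat (minv (?P m) * ?A m)) (ball 1 \<epsilon>)) \<le> D" if "m \<ge> max m1 m2" for m
      proof -
        have m: "m \<ge> m0" using that m1(1) by simp
        show ?thesis unfolding Q1[OF m] Qb[OF m] unfolding Qa[OF m] using D that by simp
      qed
      then show "\<exists>m1 C. \<forall>m\<in>{m. m \<ge> m0 \<and> invertible_mat (?P m)}. m1 \<le> m \<longrightarrow>
          real (num_eigenvalues_outside (cmat (minv (?P m) * ?A m)) (ball 1 \<epsilon>)) \<le> C"
        by blast
    qed
    ultimately show "properly_clustered {m. m \<ge> m0 \<and> invertible_mat (?P m)} (\<lambda>m. cmat (minv (?P m) * ?A m)) 1 \<and>
        (\<exists>m1\<ge>m0. (\<forall>m\<ge>m1. invertible_mat (?P m)) \<and> in_positive_rectangle {m1..} (\<lambda>m. cmat (minv (?P m) * ?A m)))"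
      using m1(1) by blast
  qed
qed

end

theorem theorem3p7:
  fixes \<Omega> :: "R2 set" and \<T> :: "nat \<Rightarrow> R2 set set" and h :: "nat \<Rightarrow> real" and m0 :: nat
    and a :: "R2 \<Rightarrow> real" and a0 :: real and \<beta> :: "R2 \<Rightarrow> R2" and f :: "R2 \<Rightarrow> real"
    and x :: "nat \<Rightarrow> nat \<Rightarrow> R2"
  assumes mesh: "structured_meshes \<Omega> \<T> h m0"
    and a_C2: "C2_closure \<Omega> a"
    and a0_pos: "a0 > 0"
    and a_ge: "\<And>y. y \<in> closure \<Omega> \<Longrightarrow> a y \<ge> a0"
    and beta_C1: "C1_closure \<Omega> \<beta>"
    and div_nonneg: "\<And>y. y \<in> \<Omega> \<Longrightarrow> divergence \<beta> y \<ge> 0"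
    and f_measurable: "f \<in> borel_measurable (lebesgue_on \<Omega>)"
    and f_L2: "integrable (lebesgue_on \<Omega>) (\<lambda>y. (f y)\<^sup>2)"
    and numbering: "\<And>m. m \<ge> m0 \<Longrightarrow>
      bij_betw (x m) {..<num_nodes \<Omega> (\<T> m)} (internal_nodes \<Omega> (\<T> m))"
  shows
    "(let \<Theta> = (\<lambda>m b. stiffness \<Omega> (\<T> m) (x m) b);
          \<Psi> = (\<lambda>m. convection \<Omega> (\<T> m) (x m) \<beta>);
          P = (\<lambda>m. precond (\<Theta> m a) (\<Theta> m (\<lambda>_. 1)));
          A = (\<lambda>m. \<Theta> m a + \<Psi> m);
          X = (\<lambda>m. cmat (minv (P m) * A m))
      in (\<forall>m\<ge>m0. invertible_mat (P m)) \<and>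
         properly_clustered {m0..} X 1 \<and>
         in_positive_rectangle {m0..} X)
     \<and>
     (\<forall>q \<nu>. quadrature_formula q \<longrightarrow> (\<forall>m\<ge>m0. local_numbering (\<T> m) (\<nu> m)) \<longrightarrow>
        (let \<Theta> = (\<lambda>m b. stiffness_quad q (\<nu> m) \<Omega> (\<T> m) (x m) b);
             \<Psi> = (\<lambda>m. convection_quad q (\<nu> m) \<Omega> (\<T> m) (x m) \<beta>);
             P = (\<lambda>m. precond (\<Theta> m a) (\<Theta> m (\<lambda>_. 1)));
             A = (\<lambda>m. \<Theta> m a + \<Psi> m);
             X = (\<lambda>m. cmat (minv (P m) * A m))
         in entries_error_h2 h m0 (\<lambda>m. \<Theta> m a) (\<lambda>m. stiffness \<Omega> (\<T> m) (x m) a) \<longrightarrow>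
            entries_error_h2 h m0 \<Psi> (\<lambda>m. convection \<Omega> (\<T> m) (x m) \<beta>) \<longrightarrow>
            properly_clustered {m. m \<ge> m0 \<and> invertible_mat (P m)} X 1 \<and>
            (\<exists>m1\<ge>m0. (\<forall>m\<ge>m1. invertible_mat (P m)) \<and> in_positive_rectangle {m1..} X)))"
proof -
  note a_C1 = C2_closure_imp_C1_closure[OF a_C2]
  from mesh consider
      (hexagon) c \<theta> L where "L > 0" "\<Omega> = hexagon c \<theta> L" "\<T> = hexagon_mesh c \<theta> L" "h = (\<lambda>m. L / real m)" "m0 = 1"
    | (square) \<sigma> where "\<sigma> = 1 \<or> \<sigma> = - 1" "\<Omega> = unit_square" "\<T> = friedrichs_keller_mesh \<sigma>" "h = (\<lambda>m. 1 / real m)" "m0 = 2"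
    unfolding structured_meshes_def by blast
  then show ?thesis
  proof cases
    case hexagon
    obtain p q where "lattice_domain \<Omega> c (L *\<^sub>R direction \<theta>) (L *\<^sub>R direction (\<theta> + pi / 3)) p q (- 1) 1 (- 1) 1 (- 1) 1"
      using lattice_domain_hexagon[OF hexagon(1)] unfolding hexagon(2) by blast
    then interpret lattice_domain \<Omega> c "L *\<^sub>R direction \<theta>" "L *\<^sub>R direction (\<theta> + pi / 3)" p q "- 1" 1 "- 1" 1 "- 1" 1 .
    \<comment> \<open>The locale absorbs \<open>L\<close> into its basis, so that level
      \<open>m\<close> has lattice vectors of length L/m.\<close>
    have T: "\<T> m = tri m ` tris m" if "m \<ge> m0" for m
      using mesh_eq[of m] that by (simp add: hexagon hexagon_mesh_def)
    have m0: "m0 \<ge> 1" "m0 \<le> 2" by (simp_all add: hexagon(5))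
    note spectrum = lattice_meshes_spectrum[OF hexagon(1) m0 T a_C1 a0_pos a_ge beta_C1 div_nonneg numbering]
    show ?thesis unfolding hexagon(4) using spectrum(1) spectrum(2) unfolding Let_def by auto
  next
    case square
    interpret lattice_domain \<Omega> "(0, 0)" "(\<sigma>, 0)" "(0, 1)" "(\<sigma>, 0)" "(0, 1)" "if \<sigma> = 1 then 0 else - 1"
      "if \<sigma> = 1 then 1 else 0" 0 1 "if \<sigma> = 1 then 0 else - 1" "if \<sigma> = 1 then 2 else 1"
      unfolding square(2) by (rule lattice_domain_unit_square[OF square(1)])
    have T: "\<T> m = tri m ` tris m" if "m \<ge> m0" for m
      using mesh_eq[of m] that by (simp add: square friedrichs_keller_mesh_def)
    have one: "(1::real) > 0" and m0: "m0 \<ge> 1" "m0 \<le> 2" by (simp_all add: square(5))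
    note spectrum = lattice_meshes_spectrum[OF one m0 T a_C1 a0_pos a_ge beta_C1 div_nonneg numbering]
    show ?thesis unfolding square(4) using spectrum(1) spectrum(2) unfolding Let_def by auto
  qed
qed

end
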